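(* Let $\alpha_1\approx 0.24760367$ be the root in $[0,1]$ of $16\alpha^4+16\alpha^3-52\alpha^2+48\alpha-9=0$. For every $\alpha$ with $0<\alpha\le \alpha_1$, the map $G_\alpha$ admits an absolutely continuous invariant probability measure (absolutely continuous with respect to two-dimensional Lebesgue measure on $[0,1]^2$).
   Context: Let $\tau:[0,1]\to[0,1]$ be the symmetric tent map, $\tau(x)=2x$ for $0\le x<1/2$ and $\tau(x)=2-2x$ for $1/2\le x\le 1$. For $0<\alpha<1$ define $G_\alpha:[0,1]^2\to[0,1]^2$ by $G_\alpha(x,y)=(y,\tau(\alpha y+(1-\alpha)x))$. *)

theory Defs
  imports "HOL-Probability.Probability"
begin

definition tent :: "real \<Rightarrow> real" where
  "tent x = (if x < 1/2 then 2 * x else 2 - 2 * x)"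

definition G :: "real \<Rightarrow> real \<times> real \<Rightarrow> real \<times> real" where
  "G \<alpha> p = (snd p, tent (\<alpha> * snd p + (1 - \<alpha>) * fst p))"

end

theory Submission
  imports Defs
begin

text \<open>Let \<open>L\<close> be the critical line \<open>\<alpha> y + (1 - \<alpha>) x = 1/2\<close>. Moving a point by the pull-back of a small
  vector \<open>v\<close> along its orbit preserves area and the itinerary unless the orbit comes within
  \<open>O(\<bar>v\<bar>)\<close> of \<open>L\<close>; pull-backs contract when \<open>\<alpha> < 1/4\<close>. So the push-forwards of Lebesgue measure
  are uniformly regular as soon as they do not charge thin strips around \<open>L\<close>. Shifting a strip
  away from \<open>L\<close> bounds its mass by masses of strips at earlier times, for orbits that return from \<open>L\<close> to \<open>L\<close>,
  weighted by a covector transported along the orbit. This renewal inequality closes because the weights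
  along a single orbit sum to less than one: returns are sparse, and the branches taken after a visit
  are forced. The averaged push-forwards are then uniformly integrable, and any
  cluster point is an absolutely continuous invariant measure.\<close>

subsection \<open>Shifting points along orbits\<close>

text \<open>The condition \<alpha> < 1/4 is exactly \<beta> + c < 1, and the quartic root obeys
  \<alpha>1 \<le> 0.2481, just below this threshold. Contraction alone is not enough: the decay
  bound for the weights sums to 1/(\<theta>(1-\<theta>)) \<ge> 4, so the sum has to be estimated
  along actual orbits. A strip at time k is charged to visits at all earlier times i. Summing over k
  as well and exchanging the sums leaves, for each i, the future of one orbit point; this controls
  the sums over k, hence averages and not single push-forwards. Seen from the visit, the total
  future weight is an even sublinear function of a covector. Gauges on a finite graph of itineraries
  dominate it, and whether they do is a finite check in integers. The direction \<open>e\<close> of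
  the shift is free up to lin e = 1: it is a multiple of (1, 0) for \<alpha> \<le> 0.18 and of (1,
  3/10) above; the split exists because some forced branches are available only for larger \<alpha>.
  The exponent p stays below 1 because strips of width r carry a source term of order r, and r * r
  powr (-1-p) must be integrable at 0.\<close>

abbreviation unit_square :: "(real \<times> real) set" where
  "unit_square \<equiv> {0..1} \<times> {0..1}"

definition sgb :: "bool \<Rightarrow> real" where "sgb b = (if b then 1 else -1)"

locale memory_map =
  fixes \<alpha> :: real
  assumes \<alpha>_pos: "0 < \<alpha>" and \<alpha>_less: "\<alpha> < 1/4"
begin

text \<open>Entries of the inverse derivatives: solving dw = +-2(\<alpha> dy + (1-\<alpha>) dx) for
  dx gives dx = +-c dw - \<beta> dy.\<close>

definition \<beta> :: real where "\<beta> = \<alpha> / (1 - \<alpha>)"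
definition c :: real where "c = 1 / (2 * (1 - \<alpha>))"

definition lin :: "real \<times> real \<Rightarrow> real" where
  "lin z = \<alpha> * snd z + (1 - \<alpha>) * fst z"

definition lo :: "real \<times> real \<Rightarrow> bool" where "lo z \<longleftrightarrow> lin z < 1/2"

definition dev :: "real \<times> real \<Rightarrow> real" where "dev z = \<bar>lin z - 1/2\<bar>"

text \<open>Inverse derivatives of the two branches (\<open>True\<close>: the rising one) on vectors,
  and their transposes on covectors.\<close>

definition binv :: "bool \<Rightarrow> real \<times> real \<Rightarrow> real \<times> real" where
  "binv b v = (sgb b * c * snd v - \<beta> * fst v, fst v)"

definition cstep :: "bool \<Rightarrow> real \<times> real \<Rightarrow> real \<times> real" where
  "cstep b w = (snd w - \<beta> * fst w, sgb b * c * fst w)"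

fun pull :: "bool list \<Rightarrow> real \<times> real \<Rightarrow> real \<times> real" where
  "pull [] v = v"
| "pull (b # bs) v = binv b (pull bs v)"

fun push :: "bool list \<Rightarrow> real \<times> real \<Rightarrow> real \<times> real" where
  "push [] w = w"
| "push (b # bs) w = push bs (cstep b w)"

fun itin :: "nat \<Rightarrow> real \<times> real \<Rightarrow> bool list" where
  "itin 0 z = []"
| "itin (Suc k) z = lo z # itin k (G \<alpha> z)"

lemma \<beta>_pos: "0 < \<beta>" and c_pos: "0 < c" and c_eq: "c = (1 + \<beta>) / 2"
  and \<beta>_less: "\<beta> < 1/3"
  using \<alpha>_pos \<alpha>_less by (auto simp: \<beta>_def c_def field_simps)

text \<open>As c = (1 + \<beta>)/2, this is \<beta> < 1/3, that is \<alpha> < 1/4.\<close>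

lemma \<beta>_c_less_1: "\<beta> + c < 1"
  using \<beta>_less by (simp add: c_eq field_simps)

text \<open>Appending a later branch changes the innermost factor of \<open>pull\<close> but the
  outermost one of \<open>push\<close>. The transposed form therefore makes the weights of
  successive hits a recursion forward in time.\<close>

lemma push_pull: "fst (push bs w) * fst v + snd (push bs w) * snd v
    = fst w * fst (pull bs v) + snd w * snd (pull bs v)"
  by (induction bs arbitrary: w) (auto simp: cstep_def binv_def algebra_simps)

text \<open>The component \<open>fst u\<close> cancels because the second row of the derivative of G
  is +-2 times \<open>lin\<close>.\<close>

lemma lin_binv: "lin (z + binv b u) = lin z + sgb b * snd u / 2"
proof -
  have \<beta>: "(1 - \<alpha>) * \<beta> = \<alpha>" and c: "(1 - \<alpha>) * c = 1 / 2"
    using \<alpha>_less by (simp_all add: c_def \<beta>_def)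
  have "lin (z + binv b u) = lin z + \<alpha> * fst u + sgb b * snd u * ((1 - \<alpha>) * c)
      - fst u * ((1 - \<alpha>) * \<beta>)"
    by (simp add: lin_def binv_def algebra_simps)
  then show ?thesis unfolding \<beta> c by simp
qed

lemma tent_lin: "tent (lin z) = (if lo z then 2 * lin z else 2 - 2 * lin z)"
  by (simp add: tent_def lo_def)

lemma G_eq: "G \<alpha> z = (snd z, tent (lin z))"
  by (simp add: G_def lin_def)

lemma G_square: "z \<in> unit_square \<Longrightarrow> G \<alpha> z \<in> unit_square"
proof -
  assume z: "z \<in> unit_square"
  have "0 \<le> lin z" using z \<alpha>_pos \<alpha>_less by (auto simp: lin_def)
  moreover have "lin z \<le> \<alpha> * 1 + (1 - \<alpha>) * 1"
    unfolding lin_def using z \<alpha>_pos \<alpha>_less by (intro add_mono mult_left_mono) auto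
  ultimately show ?thesis using z by (auto simp: G_eq tent_def)
qed

lemma funpow_G_square: "z \<in> unit_square \<Longrightarrow> (G \<alpha> ^^ k) z \<in> unit_square"
  by (induction k) (simp_all add: G_square del: mem_Times_iff)

text \<open>A deviation larger than the shift of \<open>lin\<close> keeps both points on one side of
  the line, where G is affine. If \<open>snd u = 0\<close> the shift is parallel to the line, so
  points on the line are allowed too.\<close>

lemma binv_shift:
  assumes "dev z > \<bar>snd u\<bar> / 2 \<or> snd u = 0"
  shows "lo (z + binv (lo z) u) = lo z" "G \<alpha> (z + binv (lo z) u) = G \<alpha> z + u"
proof -
  show 1: "lo (z + binv (lo z) u) = lo z"
    using assms by (auto simp: lo_def lin_binv dev_def sgb_def split: if_splits)
  show "G \<alpha> (z + binv (lo z) u) = G \<alpha> z + u"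
    unfolding G_eq tent_lin 1 unfolding lin_binv by (simp add: prod_eq_iff binv_def sgb_def)
qed

definition sep :: "real \<times> real \<Rightarrow> real \<times> real \<Rightarrow> bool" where
  "sep z u \<longleftrightarrow> dev z \<le> \<bar>snd u\<bar> / 2 \<and> snd u \<noteq> 0"

fun cross :: "nat \<Rightarrow> real \<times> real \<Rightarrow> real \<times> real \<Rightarrow> bool" where
  "cross 0 v z = False"
| "cross (Suc k) v z \<longleftrightarrow>
     sep z (pull (itin k (G \<alpha> z)) v) \<or> cross k v (G \<alpha> z)"

lemma cross_iff: "cross k v z \<longleftrightarrow>
    (\<exists>i<k. sep ((G \<alpha> ^^ i) z) (pull (itin (k - Suc i) ((G \<alpha> ^^ Suc i) z)) v))"
proof (induction k arbitrary: z)
  case (Suc k)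
  show ?case
    unfolding cross.simps Suc Ex_less_Suc2 by (simp add: funpow_swap1)
qed auto

lemma pull_shift:
  assumes "\<not> cross k v z"
  shows "itin k (z + pull (itin k z) v) = itin k z \<and>
    (G \<alpha> ^^ k) (z + pull (itin k z) v) = (G \<alpha> ^^ k) z + v"
  using assms
proof (induction k arbitrary: z)
  case (Suc k)
  have "\<not> sep z (pull (itin k (G \<alpha> z)) v)" "\<not> cross k v (G \<alpha> z)"
    using Suc.prems by auto
  then show ?case
    using Suc.IH[of "G \<alpha> z"] binv_shift[of "pull (itin k (G \<alpha> z)) v" z]
    by (auto simp: funpow_swap1 sep_def not_le)
qed auto

section \<open>Measurability of orbits and itineraries\<close>

lemma lin_measurable [measurable]: "lin \<in> borel_measurable borel"
  unfolding lin_def by (intro borel_measurable_continuous_onI continuous_intros)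

lemma dev_measurable [measurable]: "dev \<in> borel_measurable borel"
  unfolding dev_def by measurable

lemma lo_measurable [measurable]: "Measurable.pred borel lo"
  unfolding lo_def by measurable

lemma G_measurable [measurable]: "G \<alpha> \<in> borel \<rightarrow>\<^sub>M borel"
proof -
  have "tent \<in> borel_measurable borel" unfolding tent_def by measurable
  then have "(\<lambda>z. tent (lin z)) \<in> borel_measurable borel" by measurable
  then show ?thesis unfolding G_eq by (simp add: borel_prod[symmetric])
qed

lemma funpow_G_measurable [measurable]: "(G \<alpha> ^^ k) \<in> borel \<rightarrow>\<^sub>M borel"
  by (induction k) (auto simp: comp_def id_def)

lemma itin_measurable [measurable]: "itin k \<in> borel \<rightarrow>\<^sub>M count_space UNIV"
proof (induction k)
  case (Suc k)
  have [measurable]: "itin k \<in> borel \<rightarrow>\<^sub>M count_space UNIV" by (rule Suc)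
  have [simp]: "itin (Suc k) -` {bs} = (if bs = [] then {} else
       {z. lo z = hd bs} \<inter> {z. itin k (G \<alpha> z) = tl bs})" for bs
    by (cases bs) auto
  show ?case
    by (subst measurable_count_space_eq2_countable) auto
qed auto

lemma pull_itin_measurable [measurable]:
  "(\<lambda>z. pull (itin k z) v) \<in> borel \<rightarrow>\<^sub>M borel"
  by (rule measurable_compose[OF itin_measurable]) auto

lemma snd_pull_measurable [measurable]:
  "(\<lambda>z. snd (pull (itin k z) v)) \<in> borel_measurable borel"
  by (rule measurable_compose[OF itin_measurable]) auto

lemma sep_measurable [measurable]:
  "Measurable.pred borel (\<lambda>z. sep ((G \<alpha> ^^ i) z) (pull (itin n ((G \<alpha> ^^ j) z)) v))"
  unfolding sep_def by measurable

lemma cross_measurable [measurable]: "Measurable.pred borel (cross k v)"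
  unfolding cross_iff by measurable

lemma length_itin: "length (itin k z) = k"
  by (induction k arbitrary: z) auto

section \<open>Translation inequality for the push-forwards\<close>

lemma emeasure_lborel_translate:
  fixes a :: "real \<times> real"
  assumes "E \<in> sets borel"
  shows "emeasure lborel {x. x + a \<in> E} = emeasure lborel E"
proof -
  have "emeasure lborel E = emeasure (distr lborel borel ((+) a)) E"
    by (simp add: lborel_distr_plus)
  also have "\<dots> = emeasure lborel {x. x + a \<in> E}"
    using assms by (subst emeasure_distr) (auto simp: vimage_def add.commute)
  finally show ?thesis ..
qed

lemma S_measurable [measurable]: "unit_square \<in> sets (borel :: (real \<times> real) measure)"
  by (intro borel_closed closed_Times) auto

text \<open>The remaining points with itinerary \<open>bs\<close> are all translated by the one
  vector \<open>pull bs v\<close>, which preserves area. By \<open>pull_shift\<close> the itinerary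
  survives, so the images for different \<open>bs\<close> are disjoint and lie in the first set on
  the right.\<close>

lemma emeasure_shift:
  assumes [measurable]: "A \<in> sets borel"
  shows "emeasure lborel {x\<in>unit_square. (G \<alpha> ^^ k) x \<in> A}
    \<le> emeasure lborel {x\<in>unit_square. (G \<alpha> ^^ k) x - v \<in> A}
     + emeasure lborel {x\<in>unit_square. (G \<alpha> ^^ k) x \<in> A \<and> cross k v x}
     + emeasure lborel {x\<in>unit_square. (G \<alpha> ^^ k) x \<in> A \<and> x + pull (itin k x) v \<notin> unit_square}"
    (is "?L \<le> ?T + ?C + ?B")
proof -
  define D where "D = {x\<in>unit_square. (G \<alpha> ^^ k) x \<in> A \<and> \<not> cross k v x \<and> x + pull (itin k x) v \<in> unit_square}"
  define W where "W = {bs :: bool list. length bs = k}"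
  define E where "E bs = {x\<in>unit_square. (G \<alpha> ^^ k) x - v \<in> A \<and> itin k x = bs}" for bs
  have W: "finite W" using finite_lists_length_eq[of "UNIV :: bool set" k] by (simp add: W_def)
  have [measurable]: "D \<in> sets borel" "E bs \<in> sets borel" for bs
    unfolding D_def E_def by measurable
  have "?L \<le> emeasure lborel (D \<union> {x\<in>unit_square. (G \<alpha> ^^ k) x \<in> A \<and> cross k v x}
      \<union> {x\<in>unit_square. (G \<alpha> ^^ k) x \<in> A \<and> x + pull (itin k x) v \<notin> unit_square})"
    by (rule emeasure_mono) (auto simp: D_def)
  also have "\<dots> \<le> emeasure lborel D + ?C + ?B"
    by (intro order_trans[OF emeasure_subadditive] add_right_mono) auto
  also have "emeasure lborel D \<le> ?T"
  proof -
    have "D = (\<Union>bs\<in>W. D \<inter> {x. itin k x = bs})"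
      by (auto simp: W_def length_itin)
    then have "emeasure lborel D = emeasure lborel (\<Union>bs\<in>W. D \<inter> {x. itin k x = bs})"
      by simp
    also have "\<dots> = (\<Sum>bs\<in>W. emeasure lborel (D \<inter> {x. itin k x = bs}))"
      using W by (intro sum_emeasure[symmetric]) (auto simp: disjoint_family_on_def)
    also have "\<dots> \<le> (\<Sum>bs\<in>W. emeasure lborel {x. x + pull bs v \<in> E bs})"
    proof (intro sum_mono emeasure_mono subsetI)
      fix bs x assume "x \<in> D \<inter> {x. itin k x = bs}"
      then have "x \<in> D" and bs: "bs = itin k x" by auto
      then show "x \<in> {x. x + pull bs v \<in> E bs}"
        using pull_shift[of k v x] unfolding bs D_def E_def by simp
    qed measurable
    also have "\<dots> = (\<Sum>bs\<in>W. emeasure lborel (E bs))"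
      by (simp add: emeasure_lborel_translate)
    also have "\<dots> = emeasure lborel (\<Union>bs\<in>W. E bs)"
      using W by (intro sum_emeasure) (auto simp: disjoint_family_on_def E_def)
    also have "\<dots> \<le> ?T"
      by (rule emeasure_mono) (auto simp: E_def)
    finally show ?thesis .
  qed
  finally show ?thesis by simp
qed

section \<open>Exponential contraction of pull-backs\<close>

definition \<theta> :: real where "\<theta> = (1 + \<beta> + c) / 2"

text \<open>The last inequality says that \<open>binv\<close> contracts the norm max(|fst|,
  \<theta>|snd|) by the factor \<theta>. It holds since \<theta> is the mean of 1 and \<beta> + c,
  whence \<theta>^2 \<ge> \<beta> + c.\<close>

lemma \<theta>_pos: "0 < \<theta>" and \<theta>_less_1: "\<theta> < 1" and \<theta>_ineq: "\<beta> * \<theta> + c \<le> \<theta>\<^sup>2"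
proof -
  show "0 < \<theta>" and 1: "\<theta> < 1" using \<beta>_pos c_pos \<beta>_c_less_1 by (auto simp: \<theta>_def)
  have "\<beta> * \<theta> \<le> \<beta>" using 1 \<beta>_pos by (simp add: mult_left_le)
  moreover have "\<theta>\<^sup>2 - (\<beta> + c) = ((1 - (\<beta> + c)) / 2)\<^sup>2"
    unfolding \<theta>_def by (simp add: power2_eq_square field_simps)
  then have "\<beta> + c \<le> \<theta>\<^sup>2" using zero_le_power2[of "(1 - (\<beta> + c)) / 2"] by linarith
  ultimately show "\<beta> * \<theta> + c \<le> \<theta>\<^sup>2" by linarith
qed

lemma abs_sgb [simp]: "\<bar>sgb b\<bar> = 1" by (simp add: sgb_def)

lemma abs_fst_binv: "\<bar>fst (binv b v)\<bar> \<le> c * \<bar>snd v\<bar> + \<beta> * \<bar>fst v\<bar>"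
  using abs_triangle_ineq4[of "sgb b * c * snd v" "\<beta> * fst v"] c_pos \<beta>_pos
  by (simp add: binv_def abs_mult)

lemma pull_bound:
  assumes "\<bar>fst v\<bar> \<le> M" "\<bar>snd v\<bar> \<le> M"
  shows "\<bar>fst (pull bs v)\<bar> \<le> M \<and> \<bar>snd (pull bs v)\<bar> \<le> M"
proof (induction bs)
  case (Cons b bs)
  let ?u = "pull bs v"
  have "c * \<bar>snd ?u\<bar> + \<beta> * \<bar>fst ?u\<bar> \<le> c * M + \<beta> * M"
    using Cons c_pos \<beta>_pos by (intro add_mono mult_left_mono) auto
  also have "\<dots> = (\<beta> + c) * M" by (simp add: algebra_simps)
  also have "\<dots> \<le> M" using \<beta>_c_less_1 Cons by (intro mult_left_le_one_le) (use \<beta>_pos c_pos in auto)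
  finally show ?case using Cons abs_fst_binv[of b ?u] by (simp add: binv_def)
qed (use assms in auto)

text \<open>One step merely copies the first component into the second, so the sup norm need not
  shrink; giving the second component the weight \<theta> repairs this.\<close>

lemma pull_decay:
  assumes "\<bar>fst v\<bar> \<le> M" "\<bar>snd v\<bar> \<le> M"
  shows "\<bar>snd (pull bs v)\<bar> \<le> M / \<theta> * \<theta> ^ length bs"
proof -
  have "\<bar>fst (pull bs v)\<bar> \<le> \<theta> ^ length bs * M \<and> \<theta> * \<bar>snd (pull bs v)\<bar> \<le> \<theta> ^ length bs * M"
  proof (induction bs)
    case Nil
    have "\<theta> * \<bar>snd v\<bar> \<le> 1 * M"
      using \<theta>_less_1 \<theta>_pos assms by (intro mult_mono) auto
    then show ?case using assms by simp
  next
    case (Cons b bs)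
    let ?u = "pull bs v" and ?T = "\<theta> ^ length bs * M"
    have "\<theta> * \<bar>fst (binv b ?u)\<bar> \<le> \<theta> * (c * \<bar>snd ?u\<bar> + \<beta> * \<bar>fst ?u\<bar>)"
      using abs_fst_binv[of b ?u] \<theta>_pos by simp
    also have "\<dots> = c * (\<theta> * \<bar>snd ?u\<bar>) + \<beta> * \<theta> * \<bar>fst ?u\<bar>" by (simp add: algebra_simps)
    also have "\<dots> \<le> c * ?T + \<beta> * \<theta> * ?T"
      using Cons c_pos \<beta>_pos \<theta>_pos by (intro add_mono mult_left_mono) auto
    also have "\<dots> = (\<beta> * \<theta> + c) * ?T" by (simp add: algebra_simps)
    also have "\<dots> \<le> \<theta>\<^sup>2 * ?T"
      using \<theta>_ineq Cons by (intro mult_right_mono) auto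
    finally have "\<bar>fst (binv b ?u)\<bar> \<le> \<theta> * ?T"
      using \<theta>_pos by (simp add: power2_eq_square)
    then show ?case using Cons \<theta>_pos by (simp add: binv_def)
  qed
  then have "\<bar>snd (pull bs v)\<bar> \<le> \<theta> ^ length bs * M / \<theta>"
    using \<theta>_pos by (simp add: pos_le_divide_eq mult.commute)
  then show ?thesis by (simp add: mult.commute)
qed

lemma pull_scaleR: "pull bs (r *\<^sub>R v) = r *\<^sub>R pull bs v"
  by (induction bs) (auto simp: binv_def algebra_simps)

section \<open>Boundary and crossing errors, averaging over slices\<close>

lemma emeasure_Times: "emeasure lborel ({a..b} \<times> {a'..b'} :: (real \<times> real) set)
   = emeasure lborel {a..b} * emeasure lborel {a'..b'}"
  by (simp add: lborel_prod[symmetric] lborel.emeasure_pair_measure_Times)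

lemma emeasure_square: "emeasure lborel unit_square = 1"
  by (simp add: emeasure_Times)

text \<open>A point that leaves the square was within \<rho> of one of the four sides.\<close>

lemma emeasure_boundary:
  assumes "0 \<le> \<rho>" and u: "\<And>x. \<bar>fst (u x)\<bar> \<le> \<rho>" "\<And>x. \<bar>snd (u x)\<bar> \<le> \<rho>"
  shows "emeasure lborel {x\<in>unit_square. P x \<and> x + u x \<notin> unit_square} \<le> ennreal (4 * \<rho>)"
proof -
  let ?B = "({0..\<rho>} \<times> {0..1} \<union> {1-\<rho>..1} \<times> {0..1}) \<union> ({0..1} \<times> {0..\<rho>} \<union> {0..1} \<times> {1-\<rho>..1}) :: (real \<times> real) set"
  have [measurable]: "{a..b} \<times> {a'..b'} \<in> sets borel" for a b a' b' :: real
    by (intro borel_closed closed_Times closed_atLeastAtMost)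
  have "emeasure lborel {x\<in>unit_square. P x \<and> x + u x \<notin> unit_square} \<le> emeasure lborel ?B"
  proof (rule emeasure_mono)
    show "{x\<in>unit_square. P x \<and> x + u x \<notin> unit_square} \<subseteq> ?B"
    proof
      fix x assume x: "x \<in> {x\<in>unit_square. P x \<and> x + u x \<notin> unit_square}"
      obtain a b p q where eq: "x = (a, b)" "u x = (p, q)" by fastforce
      have "0 \<le> a" "a \<le> 1" "0 \<le> b" "b \<le> 1" "\<not> (0 \<le> a + p \<and> a + p \<le> 1 \<and> 0 \<le> b + q \<and> b + q \<le> 1)"
        using x eq by auto
      moreover have "\<bar>p\<bar> \<le> \<rho>" "\<bar>q\<bar> \<le> \<rho>" using u(1)[of x] u(2)[of x] eq by auto
      then have pq: "- \<rho> \<le> p" "p \<le> \<rho>" "- \<rho> \<le> q" "q \<le> \<rho>" by (auto simp: abs_le_iff)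
      have "\<rho> < a \<Longrightarrow> 0 \<le> a + p" "a < 1 - \<rho> \<Longrightarrow> a + p \<le> 1"
        "\<rho> < b \<Longrightarrow> 0 \<le> b + q" "b < 1 - \<rho> \<Longrightarrow> b + q \<le> 1" using pq by linarith+
      ultimately have "\<not> (\<rho> < a \<and> a < 1 - \<rho> \<and> \<rho> < b \<and> b < 1 - \<rho>)" by blast
      then have "a \<le> \<rho> \<or> 1 - \<rho> \<le> a \<or> b \<le> \<rho> \<or> 1 - \<rho> \<le> b" by argo
      with \<open>0 \<le> a\<close> \<open>a \<le> 1\<close> \<open>0 \<le> b\<close> \<open>b \<le> 1\<close> show "x \<in> ?B" unfolding eq by auto
    qed
  qed auto
  also have "\<dots> \<le> (ennreal \<rho> + ennreal \<rho>) + (ennreal \<rho> + ennreal \<rho>)"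
    by (intro order_trans[OF emeasure_subadditive] add_mono) (auto simp: emeasure_Times assms)
  also have "\<dots> = ennreal (4 * \<rho>)"
    using assms by (simp flip: ennreal_plus)
  finally show ?thesis .
qed

lemma emeasure_cross_le:
  assumes [measurable]: "Measurable.pred borel P"
  shows "emeasure lborel {x\<in>unit_square. P x \<and> cross k v x}
    \<le> (\<Sum>i<k. emeasure lborel {x\<in>unit_square. P x \<and>
          sep ((G \<alpha> ^^ i) x) (pull (itin (k - Suc i) ((G \<alpha> ^^ Suc i) x)) v)})"
proof -
  let ?A = "\<lambda>i. {x\<in>unit_square. P x \<and>
          sep ((G \<alpha> ^^ i) x) (pull (itin (k - Suc i) ((G \<alpha> ^^ Suc i) x)) v)}"
  have "{x\<in>unit_square. P x \<and> cross k v x} = (\<Union>i<k. ?A i)"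
    unfolding cross_iff by blast
  moreover have "?A i \<in> sets lborel" for i by measurable
  then have "emeasure lborel (\<Union>i<k. ?A i) \<le> (\<Sum>i<k. emeasure lborel (?A i))"
    by (intro emeasure_subadditive_finite) auto
  ultimately show ?thesis by simp
qed

text \<open>The slices are consecutive translates by \<open>v\<close>. Telescope the translation
  inequality from slice 0 to slice n and average over n < N: disjointness turns the mass of the end
  slice into 1/N, and lets the crossing and boundary errors be counted once for the union instead of
  once per slice.\<close>

lemma emeasure_slices:
  fixes A :: "nat \<Rightarrow> (real \<times> real) set"
  assumes [measurable]: "\<And>l. A l \<in> sets borel" and "disjoint_family A"
    and A: "\<And>l z. z - v \<in> A l \<longleftrightarrow> z \<in> A (Suc l)" and "0 < N"
    and v: "\<bar>fst v\<bar> \<le> \<rho>" "\<bar>snd v\<bar> \<le> \<rho>"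
  shows "emeasure lborel {x\<in>unit_square. (G \<alpha> ^^ k) x \<in> A 0}
    \<le> ennreal (1 / N) + emeasure lborel {x\<in>unit_square. (G \<alpha> ^^ k) x \<in> (\<Union>l<N. A l) \<and> cross k v x}
      + ennreal (4 * \<rho>)"
proof -
  define a where "a l = emeasure lborel {x\<in>unit_square. (G \<alpha> ^^ k) x \<in> A l}" for l
  define b where "b l = emeasure lborel {x\<in>unit_square. (G \<alpha> ^^ k) x \<in> A l \<and> cross k v x}
     + emeasure lborel {x\<in>unit_square. (G \<alpha> ^^ k) x \<in> A l \<and> x + pull (itin k x) v \<notin> unit_square}" for l
  let ?C = "emeasure lborel {x\<in>unit_square. (G \<alpha> ^^ k) x \<in> (\<Union>l<N. A l) \<and> cross k v x}"
  have disj: "disjoint_family_on (\<lambda>l. {x\<in>unit_square. (G \<alpha> ^^ k) x \<in> A l \<and> P x}) {..<N}" for P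
    using \<open>disjoint_family A\<close> by (fastforce simp: disjoint_family_on_def)
  have sum: "(\<Sum>l<N. emeasure lborel {x\<in>unit_square. (G \<alpha> ^^ k) x \<in> A l \<and> P x})
      = emeasure lborel {x\<in>unit_square. (G \<alpha> ^^ k) x \<in> (\<Union>l<N. A l) \<and> P x}"
    if [measurable]: "Measurable.pred borel P" for P
    by (subst sum_emeasure[OF _ disj]) (auto intro!: arg_cong[where f="emeasure lborel"])
  have step: "a l \<le> a (Suc l) + b l" for l
    using emeasure_shift[of "A l" k v] by (simp add: a_def b_def A add.assoc)
  have tele: "a 0 \<le> a n + (\<Sum>l<n. b l)" for n
  proof (induction n)
    case (Suc n)
    have "a n + (\<Sum>l<n. b l) \<le> (a (Suc n) + b n) + (\<Sum>l<n. b l)"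
      by (intro add_right_mono step)
    with Suc have "a 0 \<le> (a (Suc n) + b n) + (\<Sum>l<n. b l)" by (rule order_trans)
    then show ?case by (simp add: ac_simps)
  qed simp
  have "(\<Sum>l<N. b l) \<le> ?C + ennreal (4 * \<rho>)"
  proof -
    have "(\<Sum>l<N. b l) = ?C + emeasure lborel {x\<in>unit_square. (G \<alpha> ^^ k) x \<in> (\<Union>l<N. A l) \<and> x + pull (itin k x) v \<notin> unit_square}"
      unfolding b_def sum.distrib by (subst (1 2) sum) auto
    also have "\<dots> \<le> ?C + ennreal (4 * \<rho>)"
    proof (intro add_left_mono emeasure_boundary)
      show "0 \<le> \<rho>" using v by linarith
    qed (simp_all add: pull_bound[OF v])
    finally show ?thesis .
  qed
  have a0: "a 0 \<le> a n + (?C + ennreal (4 * \<rho>))" if "n < N" for n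
  proof -
    have "(\<Sum>l<n. b l) \<le> (\<Sum>l<N. b l)" using that by (intro sum_mono2) auto
    also note \<open>(\<Sum>l<N. b l) \<le> ?C + ennreal (4 * \<rho>)\<close>
    finally show ?thesis by (intro order_trans[OF tele[of n]] add_left_mono)
  qed
  have "of_nat N * a 0 = (\<Sum>n<N. a 0)" by simp
  also have "\<dots> \<le> (\<Sum>n<N. a n + (?C + ennreal (4 * \<rho>)))"
    by (intro sum_mono a0) auto
  also have "\<dots> = (\<Sum>n<N. a n) + of_nat N * (?C + ennreal (4 * \<rho>))"
    by (simp add: sum.distrib)
  also have "(\<Sum>n<N. a n) \<le> 1"
    using sum[of "\<lambda>_. True"] unfolding a_def emeasure_square[symmetric]
    by (auto intro!: emeasure_mono)
  also have "1 + of_nat N * (?C + ennreal (4 * \<rho>)) = of_nat N * (ennreal (1 / N) + (?C + ennreal (4 * \<rho>)))"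
  proof -
    have "of_nat N * ennreal (1 / N) = 1"
      using \<open>0 < N\<close> by (simp add: ennreal_of_nat_eq_real_of_nat flip: ennreal_mult)
    then show ?thesis by (simp add: distrib_left)
  qed
  finally have "of_nat N * a 0 \<le> of_nat N * (ennreal (1 / N) + (?C + ennreal (4 * \<rho>)))" by simp
  then have "a 0 \<le> ennreal (1 / N) + (?C + ennreal (4 * \<rho>))"
    using \<open>0 < N\<close> by (subst (asm) ennreal_mult_le_mult_iff) auto
  then show ?thesis by (simp add: a_def add.assoc)
qed

end

subsection \<open>Mass of strips around the critical line\<close>

lemma nn_integral_powr_unit:
  assumes "p < 1"
  shows "(\<integral>\<^sup>+r. ennreal (r powr (-p)) * indicator {0<..<1} r \<partial>lborel) \<le> ennreal (1 / (1 - p))"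
proof -
  have "((\<lambda>x. x powr (-p)) has_integral (1 powr (-p + 1) / (-p + 1))) {0..1::real}"
    using assms by (intro has_integral_powr_from_0) auto
  then have "((\<lambda>x. if x \<in> {0..1} then x powr (-p) else 0) has_integral (1 / (1 - p))) UNIV"
    unfolding has_integral_restrict_UNIV by simp
  then have "(\<integral>\<^sup>+r. ennreal (if r \<in> {0..1} then r powr (-p) else 0) \<partial>lborel) = ennreal (1 / (1 - p))"
    by (rule nn_integral_has_integral_lborel[rotated 2]) (auto intro!: borel_measurable_if_I)
  moreover have "(\<integral>\<^sup>+r. ennreal (r powr (-p)) * indicator {0<..<1} r \<partial>lborel)
      \<le> (\<integral>\<^sup>+r. ennreal (if r \<in> {0..1} then r powr (-p) else 0) \<partial>lborel)"
    by (intro nn_integral_mono) (auto simp: indicator_def)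
  ultimately show ?thesis by simp
qed

text \<open>Integrating over all strip widths makes the strip masses exactly homogeneous: thinning a strip
  by the factor \<open>w\<close> multiplies the kernel by \<open>w powr p\<close>, pointwise along each orbit.\<close>

definition hker :: "real \<Rightarrow> real \<Rightarrow> ennreal" where
  "hker p y = (\<integral>\<^sup>+r. ennreal (r powr (-1-p)) * indicator {0<..<1} r * (if y \<le> r then 1 else 0) \<partial>lborel)"

text \<open>Substitute x = r * w. The power contributes \<open>w powr (1+p)\<close> and the Jacobian
  1/w; it is an inequality because the cut-off r < 1 becomes x < w.\<close>

lemma hker_scale:
  assumes "0 < w" "w \<le> 1"
  shows "(\<integral>\<^sup>+r. ennreal (r powr (-1-p)) * indicator {0<..<1} r * (if y \<le> r * w then 1 else 0) \<partial>lborel)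
    \<le> ennreal (w powr p) * hker p y"
proof -
  let ?f = "\<lambda>r. ennreal (r powr (-1-p)) * indicator {0<..<1} r * (if y \<le> r * w then 1 else 0)"
  have "(\<integral>\<^sup>+r. ?f r \<partial>lborel) = ennreal \<bar>1/w\<bar> * (\<integral>\<^sup>+x. ?f (0 + (1/w) * x) \<partial>lborel)"
    using assms by (intro nn_integral_real_affine) auto
  also have "\<dots> \<le> ennreal (1/w) * (\<integral>\<^sup>+x. ennreal (w powr (1+p)) *
      (ennreal (x powr (-1-p)) * indicator {0<..<1} x * (if y \<le> x then 1 else 0)) \<partial>lborel)"
  proof -
    have "?f (0 + (1/w) * x) \<le> ennreal (w powr (1+p)) *
      (ennreal (x powr (-1-p)) * indicator {0<..<1} x * (if y \<le> x then 1 else 0))" for x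
    proof (cases "0 < x \<and> x < w \<and> y \<le> x")
      case True
      have "(x / w) powr (-1-p) = w powr (1+p) * x powr (-1-p)"
      proof -
        have "(x / w) powr (-1-p) = x powr (-1-p) / w powr (-1-p)"
          using True assms by (simp add: powr_divide)
        also have "w powr (-1-p) = 1 / w powr (1+p)"
          using powr_minus_divide[of w "1+p"] by simp
        finally show ?thesis by simp
      qed
      then show ?thesis using True assms by (auto simp: ennreal_mult' indicator_def)
    next
      case False
      then show ?thesis using assms by (auto simp: indicator_def field_simps)
    qed
    then show ?thesis using assms by (intro mult_mono[OF _ nn_integral_mono]) auto
  qed
  also have "\<dots> = ennreal (1/w) * (ennreal (w powr (1+p)) * hker p y)"
    unfolding hker_def by (subst nn_integral_cmult) auto
  also have "\<dots> = ennreal (w powr p) * hker p y"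
  proof -
    have "1 / w * w powr (1 + p) = w powr p"
      using assms by (simp add: powr_add)
    then show ?thesis using assms by (simp add: mult.assoc[symmetric] flip: ennreal_mult)
  qed
  finally show ?thesis .
qed

lemma hker_far:
  assumes "0 < \<epsilon>" "\<epsilon> < y" "0 < p"
  shows "hker p y \<le> ennreal (\<epsilon> powr (-1-p))"
proof -
  have "hker p y \<le> (\<integral>\<^sup>+r. ennreal (\<epsilon> powr (-1-p)) * indicator {0<..<1::real} r \<partial>lborel)"
    unfolding hker_def
    by (intro nn_integral_mono) (use assms in \<open>auto simp: indicator_def intro!: powr_mono2'\<close>)
  also have "\<dots> = ennreal (\<epsilon> powr (-1-p))" by (simp add: nn_integral_cmult)
  finally show ?thesis .
qed

text \<open>Makes a Markov inequality possible: the part of the integral over (r, 2r) is already at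
  least \<open>r powr (-p) / 4\<close>, and 2r \<le> 1 keeps this interval inside the range.\<close>

lemma hker_near:
  assumes "0 < r" "2 * r \<le> 1" "y \<le> r" "0 < p" "p \<le> 1"
  shows "1 \<le> ennreal (4 * r powr p) * hker p y"
proof -
  have "(\<integral>\<^sup>+x. ennreal ((2*r) powr (-1-p)) * indicator {r<..<2*r} x \<partial>lborel) \<le> hker p y"
    unfolding hker_def
    by (intro nn_integral_mono) (use assms in \<open>auto simp: indicator_def intro!: powr_mono2'\<close>)
  then have *: "ennreal ((2*r) powr (-1-p) * r) \<le> hker p y"
    using assms by (simp add: nn_integral_cmult ennreal_mult')
  have "(2*r) powr (-1-p) * r = 2 powr (-1-p) * r powr (-p)"
    using assms by (simp add: powr_mult powr_diff powr_minus field_simps)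
  also have "\<dots> \<ge> 1/4 * r powr (-p)"
  proof (intro mult_right_mono)
    have "(2::real) powr (-2) \<le> 2 powr (-1-p)" using assms by (intro powr_mono) auto
    then show "1/4 \<le> (2::real) powr (-1-p)" by (simp add: powr_minus)
  qed auto
  finally have "1 \<le> 4 * r powr p * ((2*r) powr (-1-p) * r)"
    using assms by (simp add: powr_minus field_simps)
  then have "1 \<le> ennreal (4 * r powr p) * ennreal ((2*r) powr (-1-p) * r)"
    using assms by (simp flip: ennreal_mult add: ennreal_ge_1)
  also have "\<dots> \<le> ennreal (4 * r powr p) * hker p y" by (intro mult_left_mono *) auto
  finally show ?thesis .
qed

lemma hker_measurable [measurable]: "hker p \<in> borel_measurable borel"
  unfolding hker_def by measurable

section \<open>Strip inequality with renewal weights\<close>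

context memory_map begin

text \<open>The thinning factor: a strip of half-width r at the later time corresponds to half-width
  r * \<open>wt\<close> at the visit. The argument \<open>z\<close> is the image of the visited
  point, since its own branch enters through \<open>lin_binv\<close>, which also gives the
  1/2.\<close>

definition wt :: "real \<times> real \<Rightarrow> nat \<Rightarrow> real \<times> real \<Rightarrow> real" where
  "wt e n z = \<bar>snd (pull (itin n z) e)\<bar> / 2"

lemma wt_measurable [measurable]: "wt e n \<in> borel_measurable borel"
  unfolding wt_def by measurable

lemma sep_scaleR: "0 < r \<Longrightarrow> sep z (pull (itin n w) (r *\<^sub>R e)) \<longleftrightarrow> dev z \<le> r * wt e n w \<and> wt e n w \<noteq> 0"
  by (auto simp: sep_def pull_scaleR wt_def abs_mult)

lemma cross_minus: "cross k (- v) x = cross k v x"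
  using pull_scaleR[of _ "-1" v] by (simp add: cross_iff sep_def)

text \<open>The upper half of the strip moves up by r e, the lower half down by r e. Both shifts
  have the same crossing events (\<open>cross_minus\<close>) and the slices of the two sides are
  disjoint, so the renewal sum appears once. A factor 2 here would spoil the later bound 0.948 <
  1.\<close>

lemma emeasure_strip:
  assumes lin_e: "\<And>z t. lin (z + t *\<^sub>R e) = lin z + t"
    and e: "\<bar>fst e\<bar> \<le> E" "\<bar>snd e\<bar> \<le> E" and "0 < r" "0 < N" "real N * r \<le> \<epsilon>"
  shows "emeasure lborel {x\<in>unit_square. dev ((G \<alpha> ^^ k) x) < r}
    \<le> ennreal (2 / N + 8 * (r * E)) + (\<Sum>i<k. emeasure lborel {x\<in>unit_square. dev ((G \<alpha> ^^ k) x) \<le> \<epsilon> \<and>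
         dev ((G \<alpha> ^^ i) x) \<le> r * wt e (k - Suc i) ((G \<alpha> ^^ Suc i) x) \<and>
         wt e (k - Suc i) ((G \<alpha> ^^ Suc i) x) \<noteq> 0})"
proof -
  define A where "A l = {z. 1/2 + real l * r \<le> lin z \<and> lin z < 1/2 + (real l + 1) * r}" for l
  define B where "B l = {z. 1/2 - (real l + 1) * r \<le> lin z \<and> lin z < 1/2 - real l * r}" for l
  let ?g = "G \<alpha> ^^ k"
  have [measurable]: "A l \<in> sets borel" "B l \<in> sets borel" for l
    unfolding A_def B_def by measurable
  have [measurable]: "(\<Union>l<N. A l) \<in> sets borel" "(\<Union>l<N. B l) \<in> sets borel"
    by auto
  have mono: "(real l + 1) * r \<le> real l' * r" if "l < l'" for l l'
    using that \<open>0 < r\<close> by (intro mult_right_mono) auto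
  have "disjoint_family A" "disjoint_family B"
  proof -
    have "A l \<inter> A l' = {}" "B l \<inter> B l' = {}" if "l < l'" for l l'
      using mono[OF that] by (auto simp: A_def B_def)
    then show "disjoint_family A" "disjoint_family B"
      unfolding disjoint_family_on_def by (metis Int_commute nat_neq_iff)+
  qed
  moreover have "z - r *\<^sub>R e \<in> A l \<longleftrightarrow> z \<in> A (Suc l)" "z - (- (r *\<^sub>R e)) \<in> B l \<longleftrightarrow> z \<in> B (Suc l)" for z l
    using lin_e[of z "-r"] lin_e[of z r] by (auto simp: A_def B_def algebra_simps)
  moreover have "\<bar>fst (r *\<^sub>R e)\<bar> \<le> r * E" "\<bar>snd (r *\<^sub>R e)\<bar> \<le> r * E"
    using e \<open>0 < r\<close> by (auto simp: abs_mult)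
  ultimately have AB: "emeasure lborel {x\<in>unit_square. ?g x \<in> A 0}
    \<le> ennreal (1 / N) + emeasure lborel {x\<in>unit_square. ?g x \<in> (\<Union>l<N. A l) \<and> cross k (r *\<^sub>R e) x}
      + ennreal (4 * (r * E))"
    "emeasure lborel {x\<in>unit_square. ?g x \<in> B 0}
    \<le> ennreal (1 / N) + emeasure lborel {x\<in>unit_square. ?g x \<in> (\<Union>l<N. B l) \<and> cross k (- (r *\<^sub>R e)) x}
      + ennreal (4 * (r * E))"
    using \<open>0 < N\<close> by (intro emeasure_slices; simp)+
  have "0 \<le> E" using e by linarith
  have "emeasure lborel {x\<in>unit_square. dev (?g x) < r}
      \<le> emeasure lborel ({x\<in>unit_square. ?g x \<in> A 0} \<union> {x\<in>unit_square. ?g x \<in> B 0})"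
    by (intro emeasure_mono) (auto simp: A_def B_def dev_def abs_less_iff)
  also have "\<dots> \<le> emeasure lborel {x\<in>unit_square. ?g x \<in> A 0} + emeasure lborel {x\<in>unit_square. ?g x \<in> B 0}"
    by (intro emeasure_subadditive) auto
  also have "\<dots> \<le> (ennreal (1 / N) + emeasure lborel {x\<in>unit_square. ?g x \<in> (\<Union>l<N. A l) \<and> cross k (r *\<^sub>R e) x}
      + ennreal (4 * (r * E))) + (ennreal (1 / N) + emeasure lborel {x\<in>unit_square. ?g x \<in> (\<Union>l<N. B l) \<and> cross k (r *\<^sub>R e) x}
      + ennreal (4 * (r * E)))"
    using AB by (intro add_mono) (simp_all add: cross_minus)
  also have "\<dots> = ennreal (2 / N + 8 * (r * E)) +
      (emeasure lborel {x\<in>unit_square. ?g x \<in> (\<Union>l<N. A l) \<and> cross k (r *\<^sub>R e) x}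
       + emeasure lborel {x\<in>unit_square. ?g x \<in> (\<Union>l<N. B l) \<and> cross k (r *\<^sub>R e) x})"
  proof -
    have "ennreal (2 / N + 8 * (r * E)) = (ennreal (1 / N) + ennreal (1 / N)) + (ennreal (4 * (r * E)) + ennreal (4 * (r * E)))"
      using \<open>0 < r\<close> \<open>0 \<le> E\<close> by (simp flip: ennreal_plus)
    then show ?thesis by (simp add: ac_simps)
  qed
  also have "emeasure lborel {x\<in>unit_square. ?g x \<in> (\<Union>l<N. A l) \<and> cross k (r *\<^sub>R e) x}
       + emeasure lborel {x\<in>unit_square. ?g x \<in> (\<Union>l<N. B l) \<and> cross k (r *\<^sub>R e) x}
     = emeasure lborel ({x\<in>unit_square. ?g x \<in> (\<Union>l<N. A l) \<and> cross k (r *\<^sub>R e) x}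
       \<union> {x\<in>unit_square. ?g x \<in> (\<Union>l<N. B l) \<and> cross k (r *\<^sub>R e) x})"
  proof (rule plus_emeasure)
    have "A l \<inter> B l' = {}" for l l'
    proof -
      have "0 \<le> real l * r" "0 \<le> real l' * r" using \<open>0 < r\<close> by auto
      then show ?thesis by (auto simp: A_def B_def)
    qed
    then show "{x\<in>unit_square. ?g x \<in> (\<Union>l<N. A l) \<and> cross k (r *\<^sub>R e) x}
       \<inter> {x\<in>unit_square. ?g x \<in> (\<Union>l<N. B l) \<and> cross k (r *\<^sub>R e) x} = {}" by blast
  qed measurable
  also have "\<dots> \<le> emeasure lborel {x\<in>unit_square. dev (?g x) \<le> \<epsilon> \<and> cross k (r *\<^sub>R e) x}"
  proof (rule emeasure_mono)
    have "A l \<subseteq> {z. dev z \<le> \<epsilon>}" "B l \<subseteq> {z. dev z \<le> \<epsilon>}" if "l < N" for l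
    proof -
      have "(real l + 1) * r \<le> \<epsilon>" "0 \<le> real l * r" using order_trans[OF mono[OF that] assms(6)] \<open>0 < r\<close> by auto
      then show "A l \<subseteq> {z. dev z \<le> \<epsilon>}" "B l \<subseteq> {z. dev z \<le> \<epsilon>}"
        by (auto simp: A_def B_def dev_def abs_le_iff)
    qed
    then show "{x\<in>unit_square. ?g x \<in> (\<Union>l<N. A l) \<and> cross k (r *\<^sub>R e) x}
       \<union> {x\<in>unit_square. ?g x \<in> (\<Union>l<N. B l) \<and> cross k (r *\<^sub>R e) x}
       \<subseteq> {x\<in>unit_square. dev (?g x) \<le> \<epsilon> \<and> cross k (r *\<^sub>R e) x}" by blast
  qed measurable
  also have "\<dots> \<le> (\<Sum>i<k. emeasure lborel {x\<in>unit_square. dev ((G \<alpha> ^^ k) x) \<le> \<epsilon> \<and>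
         dev ((G \<alpha> ^^ i) x) \<le> r * wt e (k - Suc i) ((G \<alpha> ^^ Suc i) x) \<and>
         wt e (k - Suc i) ((G \<alpha> ^^ Suc i) x) \<noteq> 0})"
    using emeasure_cross_le[of "\<lambda>x. dev (?g x) \<le> \<epsilon>" k "r *\<^sub>R e"] \<open>0 < r\<close>
    by (simp add: sep_scaleR)
  finally show ?thesis by simp
qed

end

section \<open>Renewal inequality for the kernel integrals\<close>

lemma emeasure_eq_nn_integral:
  assumes [measurable]: "Measurable.pred borel P" "S \<in> sets borel"
  shows "emeasure lborel {x\<in>S. P x} = (\<integral>\<^sup>+x. (if P x then 1 else 0) * indicator S x \<partial>lborel)"
proof -
  have "emeasure lborel {x\<in>S. P x} = (\<integral>\<^sup>+x. indicator {x\<in>S. P x} x \<partial>lborel)"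
    by (subst nn_integral_indicator) auto
  also have "\<dots> = (\<integral>\<^sup>+x. (if P x then 1 else 0) * indicator S x \<partial>lborel)"
    by (intro nn_integral_cong) (auto simp: indicator_def)
  finally show ?thesis .
qed

text \<open>Young's inequality with second factor 1. Passing from a weight to its p-th power costs
  at most 1 - p.\<close>

lemma powr_le_add:
  fixes x :: real
  assumes "0 \<le> x" "0 \<le> p" "p \<le> 1"
  shows "x powr p \<le> x + (1 - p)"
proof (cases "x = 0")
  case False
  then have "x powr p * 1 powr (1 - p) \<le> p * x + (1 - p) * 1"
    using assms by (intro Youngs_inequality_0) auto
  also have "p * x \<le> 1 * x" using assms by (intro mult_right_mono) auto
  finally show ?thesis by simp
qed (use assms in auto)

lemma sum_power_less:
  fixes r :: real
  assumes "0 \<le> r" "r < 1"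
  shows "(\<Sum>j<n. r ^ j) \<le> 1 / (1 - r)"
  using assms by (simp add: sum_gp_strict divide_right_mono)

text \<open>The last assumption says that the renewal weights collected by an orbit which starts near the
  critical line sum up to less than one.\<close>

locale expanding_memory_map = memory_map +
  fixes e :: "real \<times> real" and \<epsilon> \<kappa> :: real
  assumes lin_e: "\<And>z t. lin (z + t *\<^sub>R e) = lin z + t"
    and e_le: "\<bar>fst e\<bar> \<le> 2" "\<bar>snd e\<bar> \<le> 2"
    and \<epsilon>_pos: "0 < \<epsilon>" and \<kappa>_less: "\<kappa> < 1"
    and hits: "\<And>z n. z \<in> unit_square \<Longrightarrow> dev z \<le> \<epsilon> \<Longrightarrow>
      (\<Sum>j<n. if dev ((G \<alpha> ^^ Suc j) z) \<le> \<epsilon> then wt e j (G \<alpha> z) else 0) \<le> \<kappa>"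
begin

lemma wt_nonneg: "0 \<le> wt e n z" by (simp add: wt_def)

text \<open>The bounds 2 in \<open>e_le\<close> are normalised for this.\<close>

lemma wt_le_1: "wt e n z \<le> 1"
  using pull_bound[OF e_le, of "itin n z"] by (simp add: wt_def)

lemma wt_decay: "wt e n z \<le> \<theta> ^ n / \<theta>"
  using pull_decay[OF e_le, of "itin n z"] \<theta>_pos by (simp add: wt_def length_itin field_simps)

text \<open>4/\<epsilon> comes from 2/N with N the integer part of \<epsilon>/r, and 16 from the
  boundary term 8 r E with E = 2.\<close>

definition strip_const :: real where "strip_const = 4 / \<epsilon> + 16"

lemma strip_const_nonneg: "0 \<le> strip_const" using \<epsilon>_pos by (simp add: strip_const_def)

lemma strip_le:
  assumes "0 < r"
  shows "emeasure lborel {x\<in>unit_square. dev ((G \<alpha> ^^ k) x) < r}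
    \<le> ennreal (strip_const * r) + (\<Sum>i<k. emeasure lborel {x\<in>unit_square. dev ((G \<alpha> ^^ k) x) \<le> \<epsilon> \<and>
         dev ((G \<alpha> ^^ i) x) \<le> r * wt e (k - Suc i) ((G \<alpha> ^^ Suc i) x) \<and>
         wt e (k - Suc i) ((G \<alpha> ^^ Suc i) x) \<noteq> 0})" (is "_ \<le> _ + ?S")
proof (cases "r \<le> \<epsilon>")
  case True
  define N where "N = nat \<lfloor>\<epsilon> / r\<rfloor>"
  have 1: "1 \<le> \<epsilon> / r" using True assms by simp
  then have "1 \<le> \<lfloor>\<epsilon> / r\<rfloor>" by simp
  then have N: "0 < N" "real N = of_int \<lfloor>\<epsilon> / r\<rfloor>" by (auto simp: N_def)
  have "real N \<le> \<epsilon> / r" "\<epsilon> / r < real N + 1" unfolding N by linarith+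
  then have Nr: "real N * r \<le> \<epsilon>" and "\<epsilon> / r \<le> 2 * real N"
    using assms N(1) by (simp add: field_simps, linarith)
  then have "2 / N \<le> 4 / \<epsilon> * r" using assms N(1) \<epsilon>_pos by (simp add: field_simps)
  then have "ennreal (2 / N + 8 * (r * 2)) \<le> ennreal (strip_const * r)"
    by (intro ennreal_leI) (simp add: strip_const_def algebra_simps)
  then show ?thesis
    using emeasure_strip[OF lin_e e_le assms N(1) Nr, of k] by (meson add_right_mono order_trans)
next
  case False
  \<comment> \<open>Slices of thickness r > \<epsilon> do not fit into the \<epsilon>-neighbourhood;
    the bound then exceeds the total mass.\<close>
  have "1 \<le> strip_const * r"
  proof -
    have "1 \<le> 1 / \<epsilon> * r" using False \<epsilon>_pos by simp
    also have "\<dots> \<le> strip_const * r" using assms \<epsilon>_pos by (intro mult_right_mono) (auto simp: strip_const_def field_simps)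
    finally show ?thesis .
  qed
  have "emeasure lborel {x\<in>unit_square. dev ((G \<alpha> ^^ k) x) < r} \<le> emeasure lborel unit_square"
    by (intro emeasure_mono) auto
  also have "\<dots> \<le> ennreal (strip_const * r)" using \<open>1 \<le> strip_const * r\<close> by (simp add: emeasure_square ennreal_ge_1)
  finally show ?thesis by (rule order_trans) simp
qed

text \<open>Up to an affine change of the integrand, the integral of dev powr (-p) against the k-th
  push-forward.\<close>

definition U :: "real \<Rightarrow> nat \<Rightarrow> ennreal" where
  "U p k = (\<integral>\<^sup>+x. hker p (dev ((G \<alpha> ^^ k) x)) * indicator unit_square x \<partial>lborel)"

text \<open>The factor with which a visit at time i enters the inequality for time k. It tests
  closeness to the line at the later time k; closeness at time i is measured by the kernel.\<close>

definition hit_weight :: "real \<Rightarrow> nat \<Rightarrow> nat \<Rightarrow> real \<times> real \<Rightarrow> real" where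
  "hit_weight p k i x = (if dev ((G \<alpha> ^^ k) x) \<le> \<epsilon> then wt e (k - Suc i) ((G \<alpha> ^^ Suc i) x) powr p else 0)"

lemma hit_weight_measurable [measurable]: "hit_weight p k i \<in> borel_measurable borel"
  unfolding hit_weight_def by measurable

text \<open>\<open>strip_le\<close> integrated against \<open>r powr (-1-p)\<close>: the source term
  leaves the integral of \<open>r powr (-p)\<close>, which gives 1/(1-p), and the crossing terms
  turn into kernels by \<open>hker_scale\<close>.\<close>

lemma U_le:
  assumes p: "0 < p" "p < 1"
  shows "U p k \<le> ennreal (strip_const / (1 - p)) +
    (\<Sum>i<k. \<integral>\<^sup>+x. ennreal (hit_weight p k i x) * hker p (dev ((G \<alpha> ^^ i) x)) * indicator unit_square x \<partial>lborel)"
proof -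
  define W where "W r = ennreal (r powr (-1-p)) * indicator {0<..<1} r" for r :: real
  define D where "D i r x \<longleftrightarrow> dev ((G \<alpha> ^^ k) x) \<le> \<epsilon> \<and>
         dev ((G \<alpha> ^^ i) x) \<le> r * wt e (k - Suc i) ((G \<alpha> ^^ Suc i) x) \<and>
         wt e (k - Suc i) ((G \<alpha> ^^ Suc i) x) \<noteq> 0" for i r x
  let ?d = "\<lambda>x. dev ((G \<alpha> ^^ k) x)"
  let ?I = "indicator unit_square :: real \<times> real \<Rightarrow> ennreal"
  have [measurable]: "W \<in> borel_measurable borel" unfolding W_def by measurable
  have [measurable]: "(\<lambda>(r, x). if D i r x then 1 else 0 :: ennreal) \<in> borel_measurable (borel \<Otimes>\<^sub>M borel)" for i
    unfolding D_def by measurable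
  have [measurable]: "Measurable.pred borel (D i r)" for i r unfolding D_def by measurable
  have "U p k = (\<integral>\<^sup>+x. (\<integral>\<^sup>+r. W r * ((if ?d x < r then 1 else 0) * ?I x) \<partial>lborel) \<partial>lborel)"
    unfolding U_def
  proof (intro nn_integral_cong)
    fix x
    have "hker p (?d x) * ?I x = (\<integral>\<^sup>+r. W r * (if ?d x \<le> r then 1 else 0) * ?I x \<partial>lborel)"
      unfolding hker_def W_def by (subst nn_integral_multc) auto
    \<comment> \<open>The kernel uses closed strips and \<open>strip_le\<close> open ones; for fixed
      \<open>x\<close> they differ at one value of r.\<close>
    also have "\<dots> = (\<integral>\<^sup>+r. W r * ((if ?d x < r then 1 else 0) * ?I x) \<partial>lborel)"
    proof (rule nn_integral_cong_AE)
      have "AE r in lborel. r \<noteq> ?d x" by (rule AE_lborel_singleton)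
      then show "AE r in lborel. W r * (if ?d x \<le> r then 1 else 0) * ?I x = W r * ((if ?d x < r then 1 else 0) * ?I x)"
        by eventually_elim (auto simp: mult.assoc)
    qed
    finally show "hker p (?d x) * ?I x = (\<integral>\<^sup>+r. W r * ((if ?d x < r then 1 else 0) * ?I x) \<partial>lborel)" .
  qed
  also have "\<dots> = (\<integral>\<^sup>+r. (\<integral>\<^sup>+x. W r * ((if ?d x < r then 1 else 0) * ?I x) \<partial>lborel) \<partial>lborel)"
    by (rule lborel_pair.Fubini') measurable
  also have "\<dots> = (\<integral>\<^sup>+r. W r * emeasure lborel {x\<in>unit_square. ?d x < r} \<partial>lborel)"
    by (intro nn_integral_cong) (simp add: emeasure_eq_nn_integral nn_integral_cmult)
  also have "\<dots> \<le> (\<integral>\<^sup>+r. ennreal strip_const * (ennreal (r powr (-p)) * indicator {0<..<1} r)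
      + (\<Sum>i<k. \<integral>\<^sup>+x. W r * ((if D i r x then 1 else 0) * ?I x) \<partial>lborel) \<partial>lborel)"
  proof (intro nn_integral_mono)
    fix r :: real
    show "W r * emeasure lborel {x\<in>unit_square. ?d x < r} \<le> ennreal strip_const * (ennreal (r powr (-p)) * indicator {0<..<1} r)
      + (\<Sum>i<k. \<integral>\<^sup>+x. W r * ((if D i r x then 1 else 0) * ?I x) \<partial>lborel)"
    proof (cases "0 < r \<and> r < 1")
      case True
      have "W r * emeasure lborel {x\<in>unit_square. ?d x < r}
          \<le> W r * (ennreal (strip_const * r) + (\<Sum>i<k. emeasure lborel {x\<in>unit_square. D i r x}))"
        unfolding D_def using True by (intro mult_left_mono strip_le) auto
      also have "\<dots> = W r * ennreal (strip_const * r) + (\<Sum>i<k. \<integral>\<^sup>+x. W r * ((if D i r x then 1 else 0) * ?I x) \<partial>lborel)"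
        by (simp add: distrib_left sum_distrib_left emeasure_eq_nn_integral nn_integral_cmult)
      also have "W r * ennreal (strip_const * r) = ennreal strip_const * (ennreal (r powr (-p)) * indicator {0<..<1} r)"
      proof -
        have "r powr (-1-p) * (strip_const * r) = strip_const * r powr (-p)"
          using True by (simp add: powr_diff powr_minus field_simps)
        then show ?thesis using True strip_const_nonneg by (simp add: W_def flip: ennreal_mult)
      qed
      finally show ?thesis .
    qed (auto simp: W_def)
  qed
  also have "\<dots> = ennreal strip_const * (\<integral>\<^sup>+r. ennreal (r powr (-p)) * indicator {0<..<1::real} r \<partial>lborel)
      + (\<Sum>i<k. \<integral>\<^sup>+r. (\<integral>\<^sup>+x. W r * ((if D i r x then 1 else 0) * ?I x) \<partial>lborel) \<partial>lborel)"
    by (subst nn_integral_add) (auto simp: nn_integral_cmult nn_integral_sum)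
  also have "\<dots> \<le> ennreal (strip_const / (1 - p)) + (\<Sum>i<k. \<integral>\<^sup>+x. ennreal (hit_weight p k i x) * hker p (dev ((G \<alpha> ^^ i) x)) * ?I x \<partial>lborel)"
  proof (intro add_mono sum_mono)
    have "ennreal strip_const * (\<integral>\<^sup>+r. ennreal (r powr (-p)) * indicator {0<..<1::real} r \<partial>lborel) \<le> ennreal strip_const * ennreal (1 / (1 - p))"
      using p by (intro mult_left_mono nn_integral_powr_unit) auto
    also have "\<dots> = ennreal (strip_const / (1 - p))"
      using p strip_const_nonneg by (simp flip: ennreal_mult)
    finally show "ennreal strip_const * (\<integral>\<^sup>+r. ennreal (r powr (-p)) * indicator {0<..<1::real} r \<partial>lborel) \<le> ennreal (strip_const / (1 - p))" .
  next
    fix i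
    have "(\<integral>\<^sup>+r. (\<integral>\<^sup>+x. W r * ((if D i r x then 1 else 0) * ?I x) \<partial>lborel) \<partial>lborel)
        = (\<integral>\<^sup>+x. (\<integral>\<^sup>+r. W r * ((if D i r x then 1 else 0) * ?I x) \<partial>lborel) \<partial>lborel)"
      by (rule lborel_pair.Fubini'[symmetric]) measurable
    also have "\<dots> \<le> (\<integral>\<^sup>+x. ennreal (hit_weight p k i x) * hker p (dev ((G \<alpha> ^^ i) x)) * ?I x \<partial>lborel)"
    proof (intro nn_integral_mono)
      fix x
      let ?w = "wt e (k - Suc i) ((G \<alpha> ^^ Suc i) x)"
      show "(\<integral>\<^sup>+r. W r * ((if D i r x then 1 else 0) * ?I x) \<partial>lborel) \<le> ennreal (hit_weight p k i x) * hker p (dev ((G \<alpha> ^^ i) x)) * ?I x"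
      proof (cases "dev ((G \<alpha> ^^ k) x) \<le> \<epsilon> \<and> ?w \<noteq> 0")
        case True
        then have w: "0 < ?w" "?w \<le> 1" using wt_nonneg[of "k - Suc i" "(G \<alpha> ^^ Suc i) x"] wt_le_1 by auto
        have "(\<integral>\<^sup>+r. W r * ((if D i r x then 1 else 0) * ?I x) \<partial>lborel)
            = (\<integral>\<^sup>+r. W r * (if dev ((G \<alpha> ^^ i) x) \<le> r * ?w then 1 else 0) \<partial>lborel) * ?I x"
          using True by (subst nn_integral_multc[symmetric]) (auto intro!: nn_integral_cong simp: D_def mult.assoc)
        also have "\<dots> \<le> (ennreal (?w powr p) * hker p (dev ((G \<alpha> ^^ i) x))) * ?I x"
          unfolding W_def by (intro mult_right_mono hker_scale w) auto
        finally show ?thesis using True by (simp add: hit_weight_def)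
      next
        case False
        then have "\<not> D i r x" for r by (auto simp: D_def)
        then show ?thesis by simp
      qed
    qed
    finally show "(\<integral>\<^sup>+r. (\<integral>\<^sup>+x. W r * ((if D i r x then 1 else 0) * ?I x) \<partial>lborel) \<partial>lborel)
       \<le> (\<integral>\<^sup>+x. ennreal (hit_weight p k i x) * hker p (dev ((G \<alpha> ^^ i) x)) * ?I x \<partial>lborel)" .
  qed
  finally show ?thesis .
qed

end

text \<open>Exchanges the time k of the hit with the time i of the visit. The gap j = k - i - 1 is
  the length of the itinerary in \<open>wt e j\<close>.\<close>

lemma sum_triangle_reindex:
  fixes f :: "nat \<Rightarrow> nat \<Rightarrow> 'a :: comm_monoid_add"
  shows "(\<Sum>k<n. \<Sum>i<k. f k i) = (\<Sum>i<n. \<Sum>j<n - Suc i. f (Suc i + j) i)"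
proof (induction n)
  case (Suc n)
  have "(\<Sum>i<Suc n. \<Sum>j<Suc n - Suc i. f (Suc i + j) i) = (\<Sum>i<n. \<Sum>j<n - i. f (Suc i + j) i)"
    by (subst sum.lessThan_Suc) (simp only: diff_Suc_Suc diff_self_eq_0 lessThan_0 sum.empty add_0_right)
  also have "\<dots> = (\<Sum>i<n. (\<Sum>j<n - Suc i. f (Suc i + j) i) + f n i)"
  proof (intro sum.cong refl)
    fix i assume "i \<in> {..<n}"
    then have "n - i = Suc (n - Suc i)" "Suc i + (n - Suc i) = n" by auto
    then show "(\<Sum>j<n - i. f (Suc i + j) i) = (\<Sum>j<n - Suc i. f (Suc i + j) i) + f n i"
      by (simp only: sum.lessThan_Suc)
  qed
  finally show ?case by (simp add: Suc sum.distrib)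
qed simp

section \<open>Kernel integrals summed over time\<close>

context expanding_memory_map begin

lemma emeasure_reflect:
  fixes a :: "real \<times> real"
  assumes [measurable]: "E \<in> sets borel"
  shows "emeasure lborel {v. a - v \<in> E} = emeasure lborel E"
proof -
  have "lborel = distr lborel borel (\<lambda>v. a - v)"
    using lborel_affine[of "-1" a] by (simp add: density_1)
  then have "emeasure lborel E = emeasure (distr lborel borel (\<lambda>v. a - v)) E" by simp
  also have "\<dots> = emeasure lborel {v. a - v \<in> E}"
    by (subst emeasure_distr) (auto simp: vimage_def add.commute)
  finally show ?thesis ..
qed

text \<open>\<open>hits\<close> is the case p = 1, where the source term diverges. For p = 1 -
  \<delta> each of the first J terms grows by at most \<delta>, and the later ones are dominated by
  a geometric tail uniformly in p \<ge> 1/2. Each error takes at most a quarter of the gap 1 -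
  \<kappa>.\<close>

lemma exponent_exists:
  obtains p \<kappa>' K where "0 < p" "p < 1" "0 \<le> \<kappa>'" "\<kappa>' < 1" "0 \<le> K"
    "\<And>z n. z \<in> unit_square \<Longrightarrow> dev z \<le> \<epsilon> \<Longrightarrow>
      (\<Sum>j<n. if dev ((G \<alpha> ^^ Suc j) z) \<le> \<epsilon> then wt e j (G \<alpha> z) powr p else 0) \<le> \<kappa>'"
    "\<And>z n. (\<Sum>j<n. wt e j z powr p) \<le> K"
proof -
  \<comment> \<open>For p \<ge> 1/2 the power \<open>(\<theta> ^ j) powr p\<close> is at most r^j *
    r^j: one factor makes the tail beyond J small, the other keeps it summable.\<close>
  define r where "r = \<theta> powr (1/4)"
  define B where "B = 1 / \<theta>"
  have \<kappa>: "0 \<le> \<kappa>"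
  proof -
    \<comment> \<open>This point lies on the critical line for every \<alpha>, and the empty sum in
      \<open>hits\<close> gives 0 \<le> \<kappa>.\<close>
    have "(1/2, 1/2) \<in> unit_square" "dev (1/2, 1/2) \<le> \<epsilon>" using \<epsilon>_pos by (auto simp: dev_def lin_def field_simps)
    from hits[OF this, of 0] show ?thesis by simp
  qed
  have r: "0 < r" "r < 1" using \<theta>_pos \<theta>_less_1 using powr_less_mono2[of "1/4" \<theta> 1] by (auto simp: r_def)
  have B: "1 \<le> B" using \<theta>_pos \<theta>_less_1 by (simp add: B_def)
  have "(\<lambda>J. B * r ^ J / (1 - r)) \<longlonglongrightarrow> B * 0 / (1 - r)"
    using r by (intro tendsto_intros LIMSEQ_power_zero) auto
  then have "eventually (\<lambda>J. B * r ^ J / (1 - r) < (1 - \<kappa>) / 4) sequentially"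
    using \<kappa>_less by (intro order_tendstoD) auto
  then obtain J where J: "B * r ^ J / (1 - r) < (1 - \<kappa>) / 4"
    by (auto simp: eventually_sequentially)
  define \<delta> where "\<delta> = (1 - \<kappa>) / (4 * (real J + 1))"
  have \<delta>: "0 < \<delta>" "\<delta> \<le> 1/2" "\<delta> * J \<le> (1 - \<kappa>) / 4"
    using \<kappa>_less \<kappa> by (auto simp: \<delta>_def field_simps)
  define p where "p = 1 - \<delta>"
  have p: "1/2 \<le> p" "p < 1" using \<delta> by (auto simp: p_def)
  have decay: "wt e j z powr p \<le> B * (r ^ j * r ^ j)" for j z
  proof -
    have "wt e j z powr p \<le> (B * \<theta> ^ j) powr p"
      using wt_decay[of j z] p by (intro powr_mono2) (auto simp: wt_nonneg B_def)
    also have "\<dots> = B powr p * (\<theta> ^ j) powr p" using B \<theta>_pos by (simp add: powr_mult)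
    also have "\<dots> \<le> B powr 1 * (\<theta> ^ j) powr (1/2)"
      using B p \<theta>_pos \<theta>_less_1 by (intro mult_mono powr_mono powr_mono') (auto simp: power_le_one)
    also have "(\<theta> ^ j) powr (1/2) = r ^ j * r ^ j"
      using \<theta>_pos by (simp add: r_def powr_realpow[symmetric] powr_powr powr_add[symmetric])
    finally show ?thesis using B by simp
  qed
  show ?thesis
  proof (rule that[of p "\<kappa> + (1 - \<kappa>) / 4 + (1 - \<kappa>) / 4" "B / (1 - r)"])
    show "0 < p" "p < 1" "0 \<le> B / (1 - r)" using p r B by auto
    show "0 \<le> \<kappa> + (1 - \<kappa>) / 4 + (1 - \<kappa>) / 4" "\<kappa> + (1 - \<kappa>) / 4 + (1 - \<kappa>) / 4 < 1"
      using \<kappa> \<kappa>_less by (auto simp: field_simps)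
  next
    fix z n
    have "(\<Sum>j<n. wt e j z powr p) \<le> (\<Sum>j<n. B * r ^ j)"
    proof (intro sum_mono order_trans[OF decay] mult_left_mono)
      fix j show "r ^ j * r ^ j \<le> r ^ j" using r by (simp add: mult_left_le power_le_one)
    qed (use B in auto)
    also have "\<dots> = B * (\<Sum>j<n. r ^ j)" by (simp add: sum_distrib_left)
    also have "\<dots> \<le> B * (1 / (1 - r))" using B r by (intro mult_left_mono sum_power_less) auto
    finally show "(\<Sum>j<n. wt e j z powr p) \<le> B / (1 - r)" by simp
  next
    fix z :: "real \<times> real" and n assume z: "z \<in> unit_square" "dev z \<le> \<epsilon>"
    let ?near = "\<lambda>j. dev ((G \<alpha> ^^ Suc j) z) \<le> \<epsilon>"
    have "(\<Sum>j<n. if ?near j then wt e j (G \<alpha> z) powr p else 0)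
        \<le> (\<Sum>j<n. (if ?near j then wt e j (G \<alpha> z) else 0) + (if j < J then \<delta> else 0) + B * (r ^ J * r ^ j))"
    proof (rule sum_mono)
      fix j
      have pos: "0 \<le> B * (r ^ J * r ^ j)" using B r by auto
      have 1: "wt e j (G \<alpha> z) powr p \<le> wt e j (G \<alpha> z) + \<delta>"
        using powr_le_add[of "wt e j (G \<alpha> z)" p] p wt_nonneg by (simp add: p_def)
      have 2: "wt e j (G \<alpha> z) powr p \<le> B * (r ^ J * r ^ j)" if "J \<le> j"
      proof -
        have "r ^ j * r ^ j \<le> r ^ J * r ^ j"
          using r that by (intro mult_right_mono power_decreasing) auto
        then show ?thesis using decay[of j "G \<alpha> z"] B by (meson mult_left_mono order_trans zero_le_one)
      qed
      show "(if ?near j then wt e j (G \<alpha> z) powr p else 0)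
         \<le> (if ?near j then wt e j (G \<alpha> z) else 0) + (if j < J then \<delta> else 0) + B * (r ^ J * r ^ j)"
        using 1 2 pos \<delta>(1) wt_nonneg[of j "G \<alpha> z"] by (auto simp: not_less add_nonneg_nonneg intro: add_increasing)
    qed
    also have "\<dots> = (\<Sum>j<n. if ?near j then wt e j (G \<alpha> z) else 0) + (\<Sum>j<n. if j < J then \<delta> else 0)
        + B * r ^ J * (\<Sum>j<n. r ^ j)"
      by (simp add: sum.distrib sum_distrib_left mult.assoc)
    also have "\<dots> \<le> \<kappa> + (1 - \<kappa>) / 4 + (1 - \<kappa>) / 4"
    proof (intro add_mono hits z)
      have "(\<Sum>j<n. if j < J then \<delta> else 0) = \<delta> * card ({..<n} \<inter> {j. j < J})"
        by (simp add: sum.If_cases)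
      also have "\<dots> \<le> \<delta> * J"
        using \<delta> card_mono[of "{..<J}" "{..<n} \<inter> {j. j < J}"] by (intro mult_left_mono) auto
      also note \<delta>(3)
      finally show "(\<Sum>j<n. if j < J then \<delta> else 0) \<le> (1 - \<kappa>) / 4" .
      have "B * r ^ J * (\<Sum>j<n. r ^ j) \<le> B * r ^ J * (1 / (1 - r))"
        using B r by (intro mult_left_mono sum_power_less) auto
      also have "\<dots> \<le> (1 - \<kappa>) / 4" using J by simp
      finally show "B * r ^ J * (\<Sum>j<n. r ^ j) \<le> (1 - \<kappa>) / 4" .
    qed
    finally show "(\<Sum>j<n. if ?near j then wt e j (G \<alpha> z) powr p else 0) \<le> \<kappa> + (1 - \<kappa>) / 4 + (1 - \<kappa>) / 4" .
  qed
qed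

text \<open>A crude bound that grows with k. Finiteness allows \<kappa>' times the sum to be
  subtracted in \<open>sum_U_bound\<close>.\<close>

lemma U_finite:
  assumes p: "0 < p" "p < 1"
  shows "U p k < \<infinity>"
proof (induction k rule: less_induct)
  case (less k)
  have "U p k \<le> ennreal (strip_const / (1 - p)) +
    (\<Sum>i<k. \<integral>\<^sup>+x. ennreal (hit_weight p k i x) * hker p (dev ((G \<alpha> ^^ i) x)) * indicator unit_square x \<partial>lborel)"
    by (rule U_le[OF p])
  also have "\<dots> \<le> ennreal (strip_const / (1 - p)) + (\<Sum>i<k. U p i)"
    unfolding U_def
  proof (intro add_left_mono sum_mono nn_integral_mono)
    fix i x
    have "hit_weight p k i x \<le> 1"
      using wt_le_1 wt_nonneg p by (auto simp: hit_weight_def powr_le1)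
    then have "ennreal (hit_weight p k i x) * hker p (dev ((G \<alpha> ^^ i) x)) \<le> 1 * hker p (dev ((G \<alpha> ^^ i) x))"
      by (intro mult_right_mono) (auto simp: ennreal_le_1)
    then show "ennreal (hit_weight p k i x) * hker p (dev ((G \<alpha> ^^ i) x)) * indicator unit_square x
        \<le> hker p (dev ((G \<alpha> ^^ i) x)) * indicator unit_square x"
      by (intro mult_right_mono) auto
  qed
  also have "\<dots> < \<infinity>"
    using less by (simp add: ennreal_add_less_top)
  finally show ?case .
qed

text \<open>After reindexing, the terms belonging to time i integrate the kernel against the total
  weight of all later hits. Close to the line this weight is at most \<kappa>'; elsewhere it is at
  most K while the kernel is at most H by \<open>hker_far\<close>. Hence the sum is at most
  \<kappa>' times itself plus O(n).\<close>

lemma sum_U_bound: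
  assumes p: "0 < p" "p < 1" and \<kappa>': "0 \<le> \<kappa>'" "\<kappa>' < 1" and K: "0 \<le> K"
    and near: "\<And>z n. z \<in> unit_square \<Longrightarrow> dev z \<le> \<epsilon> \<Longrightarrow>
      (\<Sum>j<n. if dev ((G \<alpha> ^^ Suc j) z) \<le> \<epsilon> then wt e j (G \<alpha> z) powr p else 0) \<le> \<kappa>'"
    and far: "\<And>z n. (\<Sum>j<n. wt e j z powr p) \<le> K"
  obtains M where "0 \<le> M" "\<And>n. (\<Sum>k<n. U p k) \<le> ennreal (M * real n)"
proof -
  define C1 where "C1 = strip_const / (1 - p)"
  define H where "H = \<epsilon> powr (-1-p)"
  have C1: "0 \<le> C1" using \<epsilon>_pos p by (simp add: C1_def strip_const_def)
  have H: "0 \<le> H" by (simp add: H_def)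
  define M where "M = (C1 + K * H) / (1 - \<kappa>')"
  have inner: "(\<Sum>j<m. \<integral>\<^sup>+x. ennreal (hit_weight p (Suc i + j) i x) * hker p (dev ((G \<alpha> ^^ i) x)) * indicator unit_square x \<partial>lborel)
     \<le> ennreal \<kappa>' * U p i + ennreal (K * H)" for i m
  proof -
    have "(\<Sum>j<m. \<integral>\<^sup>+x. ennreal (hit_weight p (Suc i + j) i x) * hker p (dev ((G \<alpha> ^^ i) x)) * indicator unit_square x \<partial>lborel)
       = (\<integral>\<^sup>+x. (\<Sum>j<m. ennreal (hit_weight p (Suc i + j) i x) * hker p (dev ((G \<alpha> ^^ i) x)) * indicator unit_square x) \<partial>lborel)"
      by (rule nn_integral_sum[symmetric]) measurable
    also have "\<dots> \<le> (\<integral>\<^sup>+x. ennreal \<kappa>' * (hker p (dev ((G \<alpha> ^^ i) x)) * indicator unit_square x)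
        + ennreal (K * H) * indicator unit_square x \<partial>lborel)"
    proof (rule nn_integral_mono)
      fix x
      let ?z = "(G \<alpha> ^^ i) x" and ?h = "hker p (dev ((G \<alpha> ^^ i) x))"
      show "(\<Sum>j<m. ennreal (hit_weight p (Suc i + j) i x) * ?h * indicator unit_square x)
         \<le> ennreal \<kappa>' * (?h * indicator unit_square x) + ennreal (K * H) * indicator unit_square x"
      proof (cases "x \<in> unit_square")
        case True
        have hw0: "0 \<le> hit_weight p (Suc i + j) i x" for j by (simp add: hit_weight_def)
        have hit_weight: "hit_weight p (Suc i + j) i x = (if dev ((G \<alpha> ^^ Suc j) ?z) \<le> \<epsilon> then wt e j (G \<alpha> ?z) powr p else 0)" for j
        proof -
          have "(G \<alpha> ^^ (Suc i + j)) x = (G \<alpha> ^^ Suc j) ?z"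
            by (metis add.commute add_Suc_right comp_apply funpow_add)
          then show ?thesis by (simp add: hit_weight_def)
        qed
        have S: "(\<Sum>j<m. ennreal (hit_weight p (Suc i + j) i x) * ?h) = ennreal (\<Sum>j<m. hit_weight p (Suc i + j) i x) * ?h"
          by (simp only: sum_distrib_right[symmetric] sum_ennreal[OF hw0])
        show ?thesis
        proof (cases "dev ?z \<le> \<epsilon>")
          case near': True
          have "(\<Sum>j<m. hit_weight p (Suc i + j) i x) \<le> \<kappa>'"
            unfolding hit_weight by (rule near[OF funpow_G_square[OF True] near'])
          then have "ennreal (\<Sum>j<m. hit_weight p (Suc i + j) i x) * ?h \<le> ennreal \<kappa>' * ?h"
            by (intro mult_right_mono ennreal_leI) auto
          then show ?thesis using True S by (simp add: add_increasing2)
        next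
          case far': False
          have "(\<Sum>j<m. hit_weight p (Suc i + j) i x) \<le> (\<Sum>j<m. wt e j (G \<alpha> ?z) powr p)"
            unfolding hit_weight by (intro sum_mono) auto
          also have "\<dots> \<le> K" by (rule far)
          finally have "ennreal (\<Sum>j<m. hit_weight p (Suc i + j) i x) * ?h \<le> ennreal K * ennreal H"
            unfolding H_def using far' \<epsilon>_pos p by (intro mult_mono ennreal_leI hker_far) auto
          then show ?thesis using True S K H by (simp add: ennreal_mult add_increasing)
        qed
      qed simp
    qed
    also have "\<dots> = ennreal \<kappa>' * U p i + ennreal (K * H)"
      unfolding U_def by (subst nn_integral_add) (auto simp: nn_integral_cmult emeasure_square)
    finally show ?thesis .
  qed
  have "(\<Sum>k<n. U p k) \<le> ennreal (M * real n)" for n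
  proof -
    define u where "u k = enn2real (U p k)" for k
    have u: "U p k = ennreal (u k)" for k using U_finite[OF p, of k] by (simp add: u_def)
    have u0: "0 \<le> u k" for k by (simp add: u_def)
    have "(\<Sum>k<n. U p k) \<le> (\<Sum>k<n. ennreal C1 + (\<Sum>i<k. \<integral>\<^sup>+x. ennreal (hit_weight p k i x) * hker p (dev ((G \<alpha> ^^ i) x)) * indicator unit_square x \<partial>lborel))"
      unfolding C1_def by (intro sum_mono U_le p)
    also have "\<dots> = of_nat n * ennreal C1 + (\<Sum>i<n. \<Sum>j<n - Suc i. \<integral>\<^sup>+x. ennreal (hit_weight p (Suc i + j) i x) * hker p (dev ((G \<alpha> ^^ i) x)) * indicator unit_square x \<partial>lborel)"
      by (simp only: sum.distrib sum_triangle_reindex sum_constant card_lessThan)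
    also have "\<dots> \<le> of_nat n * ennreal C1 + (\<Sum>i<n. ennreal \<kappa>' * U p i + ennreal (K * H))"
      by (intro add_left_mono sum_mono inner)
    also have "\<dots> = ennreal (real n * C1 + (\<Sum>i<n. \<kappa>' * u i + K * H))"
      using C1 K H \<kappa>' u0
      by (simp add: u ennreal_of_nat_eq_real_of_nat sum_nonneg flip: ennreal_mult ennreal_plus)
    finally have "ennreal (\<Sum>k<n. u k) \<le> ennreal (real n * C1 + (\<Sum>i<n. \<kappa>' * u i + K * H))"
      by (simp add: u u0)
    then have "(\<Sum>k<n. u k) \<le> real n * C1 + (\<Sum>i<n. \<kappa>' * u i + K * H)"
      using C1 K H \<kappa>' u0 by (subst (asm) ennreal_le_iff) (auto intro!: add_nonneg_nonneg sum_nonneg)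
    then have "(\<Sum>k<n. u k) * (1 - \<kappa>') \<le> (C1 + K * H) * real n"
      by (simp add: sum.distrib sum_distrib_left[symmetric] algebra_simps)
    then have "(\<Sum>k<n. u k) \<le> M * real n" using \<kappa>' by (simp add: M_def field_simps)
    then show ?thesis by (simp add: u u0 ennreal_leI)
  qed
  then show ?thesis using C1 K H \<kappa>' by (intro that[of M]) (auto simp: M_def)
qed

section \<open>Uniform integrability of the averaged push-forwards\<close>

lemma emeasure_dev_le:
  assumes "0 < r" "2 * r \<le> 1" and p: "0 < p" "p < 1"
  shows "emeasure lborel {x\<in>unit_square. dev ((G \<alpha> ^^ i) x) \<le> r} \<le> ennreal (4 * r powr p) * U p i"
proof -
  have "emeasure lborel {x\<in>unit_square. dev ((G \<alpha> ^^ i) x) \<le> r}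
      = (\<integral>\<^sup>+x. (if dev ((G \<alpha> ^^ i) x) \<le> r then 1 else 0) * indicator unit_square x \<partial>lborel)"
    by (rule emeasure_eq_nn_integral) measurable
  also have "\<dots> \<le> (\<integral>\<^sup>+x. ennreal (4 * r powr p) * (hker p (dev ((G \<alpha> ^^ i) x)) * indicator unit_square x) \<partial>lborel)"
  proof (rule nn_integral_mono)
    fix x
    show "(if dev ((G \<alpha> ^^ i) x) \<le> r then 1 else 0) * indicator unit_square x
      \<le> ennreal (4 * r powr p) * (hker p (dev ((G \<alpha> ^^ i) x)) * indicator unit_square x)"
      using hker_near[of r "dev ((G \<alpha> ^^ i) x)" p] assms by (auto simp: indicator_def)
  qed
  also have "\<dots> = ennreal (4 * r powr p) * U p i"
    unfolding U_def by (rule nn_integral_cmult) measurable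
  finally show ?thesis .
qed

text \<open>Crossing at time i forces dev \<le> (t/\<theta>) \<theta>^(k-1-i), an event whose mass
  \<open>U p i\<close> controls. The condition 2t \<le> \<theta> makes this half-width at most 1/2,
  as \<open>emeasure_dev_le\<close> requires.\<close>

lemma emeasure_orbit_shift_le:
  assumes [measurable]: "A \<in> sets borel" and t: "0 < t" "2 * t \<le> \<theta>" and p: "0 < p" "p < 1"
    and v: "\<bar>fst v\<bar> \<le> t" "\<bar>snd v\<bar> \<le> t"
  shows "emeasure lborel {x\<in>unit_square. (G \<alpha> ^^ k) x \<in> A}
    \<le> emeasure lborel {x\<in>unit_square. (G \<alpha> ^^ k) x - v \<in> A}
      + ((\<Sum>i<k. ennreal (4 * (t / \<theta> * \<theta> ^ (k - Suc i)) powr p) * U p i) + ennreal (4 * t))"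
proof -
  have "emeasure lborel {x\<in>unit_square. (G \<alpha> ^^ k) x \<in> A \<and> cross k v x}
      \<le> (\<Sum>i<k. emeasure lborel {x\<in>unit_square. (G \<alpha> ^^ k) x \<in> A \<and>
          sep ((G \<alpha> ^^ i) x) (pull (itin (k - Suc i) ((G \<alpha> ^^ Suc i) x)) v)})"
    by (rule emeasure_cross_le) measurable
  also have "\<dots> \<le> (\<Sum>i<k. ennreal (4 * (t / \<theta> * \<theta> ^ (k - Suc i)) powr p) * U p i)"
  proof (rule sum_mono)
    fix i
    let ?r = "t / \<theta> * \<theta> ^ (k - Suc i)"
    have r: "0 < ?r" "2 * ?r \<le> 1"
    proof -
      show "0 < ?r" using t \<theta>_pos by simp
      have "2 * (t / \<theta>) * \<theta> ^ (k - Suc i) \<le> 1 * 1"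
        using t \<theta>_pos \<theta>_less_1 by (intro mult_mono) (auto simp: field_simps power_le_one)
      then show "2 * ?r \<le> 1" by simp
    qed
    have "emeasure lborel {x\<in>unit_square. (G \<alpha> ^^ k) x \<in> A \<and>
          sep ((G \<alpha> ^^ i) x) (pull (itin (k - Suc i) ((G \<alpha> ^^ Suc i) x)) v)}
        \<le> emeasure lborel {x\<in>unit_square. dev ((G \<alpha> ^^ i) x) \<le> ?r}"
    proof (rule emeasure_mono)
      have "dev ((G \<alpha> ^^ i) x) \<le> ?r" if "sep ((G \<alpha> ^^ i) x) (pull (itin (k - Suc i) ((G \<alpha> ^^ Suc i) x)) v)" for x
        using that pull_decay[OF v, of "itin (k - Suc i) ((G \<alpha> ^^ Suc i) x)"]
          abs_ge_zero[of "lin ((G \<alpha> ^^ i) x) - 1/2"]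
        unfolding sep_def length_itin dev_def by linarith
      then show "{x\<in>unit_square. (G \<alpha> ^^ k) x \<in> A \<and>
          sep ((G \<alpha> ^^ i) x) (pull (itin (k - Suc i) ((G \<alpha> ^^ Suc i) x)) v)}
        \<subseteq> {x\<in>unit_square. dev ((G \<alpha> ^^ i) x) \<le> ?r}" by blast
    qed measurable
    also have "\<dots> \<le> ennreal (4 * ?r powr p) * U p i" by (rule emeasure_dev_le[OF r p])
    finally show "emeasure lborel {x\<in>unit_square. (G \<alpha> ^^ k) x \<in> A \<and>
          sep ((G \<alpha> ^^ i) x) (pull (itin (k - Suc i) ((G \<alpha> ^^ Suc i) x)) v)} \<le> ennreal (4 * ?r powr p) * U p i" .
  qed
  finally have C: "emeasure lborel {x\<in>unit_square. (G \<alpha> ^^ k) x \<in> A \<and> cross k v x}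
     \<le> (\<Sum>i<k. ennreal (4 * (t / \<theta> * \<theta> ^ (k - Suc i)) powr p) * U p i)" .
  have B: "emeasure lborel {x\<in>unit_square. (G \<alpha> ^^ k) x \<in> A \<and> x + pull (itin k x) v \<notin> unit_square} \<le> ennreal (4 * t)"
    using t pull_bound[OF v] by (intro emeasure_boundary) simp_all
  show ?thesis
    using emeasure_shift[of A k v] add_mono[OF C B] by (simp add: add.assoc) (meson add_left_mono order_trans)
qed

text \<open>Average over shifts \<open>v\<close> in a square of side t. By Fubini the mean mass of
  the translates of A is at most area(A)/t^2, whatever the push-forward looks like.\<close>

lemma emeasure_orbit_le:
  assumes [measurable]: "A \<in> sets borel" and t: "0 < t" "2 * t \<le> \<theta>" and p: "0 < p" "p < 1"
  shows "emeasure lborel {x\<in>unit_square. (G \<alpha> ^^ k) x \<in> A}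
    \<le> ennreal (1 / t\<^sup>2) * emeasure lborel A
      + ((\<Sum>i<k. ennreal (4 * (t / \<theta> * \<theta> ^ (k - Suc i)) powr p) * U p i) + ennreal (4 * t))" (is "?a \<le> _ + ?Q")
proof -
  let ?V = "{0..t} \<times> {0..t} :: (real \<times> real) set"
  let ?b = "\<lambda>v. emeasure lborel {x\<in>unit_square. (G \<alpha> ^^ k) x - v \<in> A}"
  let ?f = "\<lambda>v x. (if (G \<alpha> ^^ k) x - v \<in> A then 1 else 0) * indicator unit_square x :: ennreal"
  have [measurable]: "?V \<in> sets borel" by (intro borel_closed closed_Times closed_atLeastAtMost)
  have V: "emeasure lborel ?V = ennreal (t\<^sup>2)"
    using t by (simp add: emeasure_Times power2_eq_square flip: ennreal_mult)
  have fm: "(\<lambda>(v, x). ?f v x) \<in> borel_measurable (lborel \<Otimes>\<^sub>M lborel)"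
    by measurable
  have b: "?b v = (\<integral>\<^sup>+x. ?f v x \<partial>lborel)" for v
    by (rule emeasure_eq_nn_integral) measurable
  have bm[measurable]: "?b \<in> borel_measurable lborel"
    unfolding b by (rule lborel.borel_measurable_nn_integral[OF fm])
  have "ennreal (t\<^sup>2) * ?a = (\<integral>\<^sup>+v. ?a * indicator ?V v \<partial>lborel)"
    by (subst nn_integral_cmult) (auto simp: V mult.commute)
  also have "\<dots> \<le> (\<integral>\<^sup>+v. ?b v + ?Q * indicator ?V v \<partial>lborel)"
  proof (rule nn_integral_mono)
    fix v :: "real \<times> real"
    show "?a * indicator ?V v \<le> ?b v + ?Q * indicator ?V v"
      using emeasure_orbit_shift_le[OF assms(1) t p, of v k] by (auto simp: indicator_def)
  qed
  also have "\<dots> = (\<integral>\<^sup>+v. ?b v \<partial>lborel) + ?Q * ennreal (t\<^sup>2)"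
    by (subst nn_integral_add) (auto simp: nn_integral_cmult V)
  also have "(\<integral>\<^sup>+v. ?b v \<partial>lborel) = (\<integral>\<^sup>+x. (\<integral>\<^sup>+v. ?f v x \<partial>lborel) \<partial>lborel)"
    unfolding b by (rule lborel_pair.Fubini'[symmetric]) (rule fm)
  also have "\<dots> = (\<integral>\<^sup>+x. emeasure lborel A * indicator unit_square x \<partial>lborel)"
  proof (rule nn_integral_cong)
    fix x
    have "(\<integral>\<^sup>+v. ?f v x \<partial>lborel) = (\<integral>\<^sup>+v. indicator {v. (G \<alpha> ^^ k) x - v \<in> A} v * indicator unit_square x \<partial>lborel)"
      by (intro nn_integral_cong) (auto simp: indicator_def)
    also have "\<dots> = emeasure lborel A * indicator unit_square x"
      by (subst nn_integral_multc) (auto simp: emeasure_reflect)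
    finally show "(\<integral>\<^sup>+v. ?f v x \<partial>lborel) = emeasure lborel A * indicator unit_square x" .
  qed
  also have "\<dots> = emeasure lborel A"
    by (subst nn_integral_cmult) (auto simp: emeasure_square)
  finally have "ennreal (1 / t\<^sup>2) * (ennreal (t\<^sup>2) * ?a) \<le> ennreal (1 / t\<^sup>2) * (emeasure lborel A + ?Q * ennreal (t\<^sup>2))"
    by (intro mult_left_mono) auto
  moreover have one: "ennreal (1 / t\<^sup>2) * ennreal (t\<^sup>2) = 1"
    using t by (simp flip: ennreal_mult)
  then have "ennreal (1 / t\<^sup>2) * (ennreal (t\<^sup>2) * ?a) = ?a"
    by (simp add: mult.assoc[symmetric])
  moreover have "ennreal (1 / t\<^sup>2) * (emeasure lborel A + ?Q * ennreal (t\<^sup>2))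
      = ennreal (1 / t\<^sup>2) * emeasure lborel A + ?Q * (ennreal (1 / t\<^sup>2) * ennreal (t\<^sup>2))"
    unfolding distrib_left by (simp add: ac_simps)
  ultimately show ?thesis unfolding one by simp
qed

text \<open>The crossing errors form a convolution of \<open>U p i\<close> with a geometric sequence
  of ratio \<theta> powr p, so their sum is O(n). Letting t tend to 0 makes the error per step, of
  order t powr p, uniformly small.\<close>

lemma cesaro_mass_bound:
  obtains p K where "0 < p" "p < 1" "0 \<le> K" "\<And>A t n. A \<in> sets borel \<Longrightarrow> 0 < t \<Longrightarrow> 2 * t \<le> \<theta> \<Longrightarrow>
    (\<Sum>k<n. emeasure lborel {x\<in>unit_square. (G \<alpha> ^^ k) x \<in> A})
      \<le> of_nat n * (ennreal (1 / t\<^sup>2) * emeasure lborel A + ennreal (K * t powr p))"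
proof -
  obtain p \<kappa>' K0 where p: "0 < p" "p < 1" and \<kappa>': "0 \<le> \<kappa>'" "\<kappa>' < 1" "0 \<le> K0"
    "\<And>z n. z \<in> unit_square \<Longrightarrow> dev z \<le> \<epsilon> \<Longrightarrow>
      (\<Sum>j<n. if dev ((G \<alpha> ^^ Suc j) z) \<le> \<epsilon> then wt e j (G \<alpha> z) powr p else 0) \<le> \<kappa>'"
    "\<And>z n. (\<Sum>j<n. wt e j z powr p) \<le> K0"
    by (rule exponent_exists) blast
  obtain M where M: "0 \<le> M" "\<And>n. (\<Sum>k<n. U p k) \<le> ennreal (M * real n)"
    by (rule sum_U_bound[OF p \<kappa>']) blast+
  define q where "q = \<theta> powr p"
  have q: "0 < q" "q < 1"
    using \<theta>_pos \<theta>_less_1 p powr_less_mono2[of p \<theta> 1] by (auto simp: q_def)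
  define L where "L = 4 * (1 / \<theta>) powr p / (1 - q)"
  have L: "0 \<le> L" using q by (simp add: L_def)
  show ?thesis
  proof (rule that[of p "L * M + 4"])
    show "0 < p" "p < 1" "0 \<le> L * M + 4" using p L M by auto
    fix A :: "(real \<times> real) set" and t :: real and n assume A: "A \<in> sets borel" and t: "0 < t" "2 * t \<le> \<theta>"
    let ?w = "\<lambda>k i. ennreal (4 * (t / \<theta> * \<theta> ^ (k - Suc i)) powr p) * U p i"
    have t1: "t \<le> t powr p"
      using t \<theta>_less_1 p powr_mono'[of p 1 t] by simp
    have w: "ennreal (4 * (t / \<theta> * \<theta> ^ j) powr p) = ennreal (4 * (1 / \<theta>) powr p * t powr p * q ^ j)" for j
    proof -
      have "(t / \<theta> * \<theta> ^ j) powr p = (1 / \<theta>) powr p * t powr p * (\<theta> ^ j) powr p"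
        using t \<theta>_pos powr_mult[of "1/\<theta>" t p] powr_mult[of "t/\<theta>" "\<theta>^j" p] by simp
      also have "(\<theta> ^ j) powr p = q ^ j"
        using \<theta>_pos by (simp add: q_def powr_realpow[symmetric] powr_powr mult.commute)
      finally show ?thesis by (simp add: mult.assoc)
    qed
    have "(\<Sum>k<n. \<Sum>i<k. ?w k i) = (\<Sum>i<n. \<Sum>j<n - Suc i. ?w (Suc i + j) i)"
      by (rule sum_triangle_reindex)
    also have "\<dots> \<le> (\<Sum>i<n. ennreal (L * t powr p) * U p i)"
    proof (rule sum_mono)
      fix i
      have "(\<Sum>j<n - Suc i. ?w (Suc i + j) i) = (\<Sum>j<n - Suc i. ennreal (4 * (1 / \<theta>) powr p * t powr p * q ^ j)) * U p i"
        by (simp only: add_diff_cancel_left' w sum_distrib_right)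
      also have "(\<Sum>j<n - Suc i. ennreal (4 * (1 / \<theta>) powr p * t powr p * q ^ j)) = ennreal (\<Sum>j<n - Suc i. 4 * (1 / \<theta>) powr p * t powr p * q ^ j)"
        using q by (intro sum_ennreal) auto
      also have "(\<Sum>j<n - Suc i. 4 * (1 / \<theta>) powr p * t powr p * q ^ j) = 4 * (1 / \<theta>) powr p * t powr p * (\<Sum>j<n - Suc i. q ^ j)"
        by (simp add: sum_distrib_left)
      also have "ennreal \<dots> \<le> ennreal (4 * (1 / \<theta>) powr p * t powr p * (1 / (1 - q)))"
        using q by (intro ennreal_leI mult_left_mono sum_power_less) auto
      also have "4 * (1 / \<theta>) powr p * t powr p * (1 / (1 - q)) = L * t powr p" by (simp add: L_def)
      finally show "(\<Sum>j<n - Suc i. ?w (Suc i + j) i) \<le> ennreal (L * t powr p) * U p i"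
        by (simp add: mult_right_mono)
    qed
    also have "\<dots> = ennreal (L * t powr p) * (\<Sum>i<n. U p i)" by (simp add: sum_distrib_left)
    also have "\<dots> \<le> ennreal (L * t powr p) * ennreal (M * real n)" by (intro mult_left_mono M) auto
    also have "\<dots> = of_nat n * ennreal (L * M * t powr p)"
      using L M by (simp add: ennreal_of_nat_eq_real_of_nat ac_simps flip: ennreal_mult)
    finally have W: "(\<Sum>k<n. \<Sum>i<k. ?w k i) \<le> of_nat n * ennreal (L * M * t powr p)" .
    have "(\<Sum>k<n. emeasure lborel {x\<in>unit_square. (G \<alpha> ^^ k) x \<in> A})
       \<le> (\<Sum>k<n. ennreal (1 / t\<^sup>2) * emeasure lborel A + ((\<Sum>i<k. ?w k i) + ennreal (4 * t)))"
      by (intro sum_mono emeasure_orbit_le A t p)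
    also have "\<dots> = of_nat n * (ennreal (1 / t\<^sup>2) * emeasure lborel A) + ((\<Sum>k<n. \<Sum>i<k. ?w k i) + of_nat n * ennreal (4 * t))"
      by (simp add: sum.distrib)
    also have "\<dots> \<le> of_nat n * (ennreal (1 / t\<^sup>2) * emeasure lborel A) + (of_nat n * ennreal (L * M * t powr p) + of_nat n * ennreal (4 * t powr p))"
      using t1 by (intro add_left_mono add_mono W mult_left_mono ennreal_leI) auto
    also have "\<dots> = of_nat n * (ennreal (1 / t\<^sup>2) * emeasure lborel A + ennreal ((L * M + 4) * t powr p))"
    proof -
      have "ennreal ((L * M + 4) * t powr p) = ennreal (L * M * t powr p) + ennreal (4 * t powr p)"
        using L M by (simp add: distrib_right flip: ennreal_plus)
      then show ?thesis by (simp add: distrib_left)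
    qed
    finally show "(\<Sum>k<n. emeasure lborel {x\<in>unit_square. (G \<alpha> ^^ k) x \<in> A})
      \<le> of_nat n * (ennreal (1 / t\<^sup>2) * emeasure lborel A + ennreal ((L * M + 4) * t powr p))" .
  qed
qed

end

subsection \<open>Cluster points of averaged push-forwards\<close>

lemma compact_unit_cube: "compact {f :: 'a \<Rightarrow> real. \<forall>x. f x \<in> {0..1}}"
proof -
  have "compactin (product_topology (\<lambda>_::'a. euclidean :: real topology) UNIV) (PiE UNIV (\<lambda>_. {0..1}))"
    by (simp add: compactin_PiE)
  moreover have "PiE UNIV (\<lambda>_::'a. {0..1::real}) = {f. \<forall>x. f x \<in> {0..1}}" by auto
  ultimately show ?thesis by (simp add: euclidean_product_topology)
qed

text \<open>The cube indexed by all sets need not be sequentially compact, so no subsequence is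
  extracted. Membership in every closed set that eventually contains the sequence suffices, because
  all properties to be inherited are closed conditions on coordinates.\<close>

lemma cluster_point_exists:
  fixes X :: "nat \<Rightarrow> 'a :: topological_space"
  assumes "compact K" and "\<And>n. X n \<in> K"
  obtains x where "\<And>C N. closed C \<Longrightarrow> (\<And>n. N \<le> n \<Longrightarrow> X n \<in> C) \<Longrightarrow> x \<in> C"
proof -
  let ?F = "filtermap X sequentially"
  have "?F \<noteq> bot" by (simp add: filtermap_bot_iff)
  moreover have "eventually (\<lambda>x. x \<in> K) ?F" using assms by (simp add: eventually_filtermap)
  ultimately obtain x where x: "inf (nhds x) ?F \<noteq> bot"
    using assms(1) unfolding compact_filter by blast
  have "x \<in> C" if "closed C" and C: "\<And>n. N \<le> n \<Longrightarrow> X n \<in> C" for C N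
  proof (rule ccontr)
    assume "x \<notin> C"
    then have "eventually (\<lambda>y. y \<in> - C) (nhds x)"
      using \<open>closed C\<close> by (intro eventually_nhds_in_open) auto
    moreover have "eventually (\<lambda>y. y \<in> C) ?F"
      using C by (auto simp: eventually_filtermap eventually_sequentially)
    ultimately have "eventually (\<lambda>_. False) (inf (nhds x) ?F)"
      unfolding eventually_inf by blast
    with x show False by (simp add: trivial_limit_def)
  qed
  then show ?thesis by (rule that)
qed

text \<open>The averaged push-forwards are functions from sets to $[0,1]$; Tychonoff's theorem gives
  a cluster point, which is finitely additive and invariant, and the uniform integrability bound
  makes it countably additive.\<close>

lemma invariant_measure_exists:
  fixes T :: "'a \<Rightarrow> 'a" and M :: "'a measure"
  assumes T [measurable]: "T \<in> M \<rightarrow>\<^sub>M M" and S [measurable]: "S \<in> sets M"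
    and S1: "emeasure M S = 1" and TS: "\<And>x. x \<in> S \<Longrightarrow> T x \<in> S"
    and bound: "\<And>\<eta>::real. 0 < \<eta> \<Longrightarrow> \<exists>C::real. \<forall>A n. A \<in> sets M \<longrightarrow>
      (\<Sum>k<n. emeasure M {x\<in>S. (T ^^ k) x \<in> A}) \<le> of_nat n * (ennreal C * emeasure M A + ennreal \<eta>)"
  shows "\<exists>\<mu>. sets \<mu> = sets M \<and> prob_space \<mu> \<and> emeasure \<mu> (space M - S) = 0 \<and>
    absolutely_continuous M \<mu> \<and> T \<in> \<mu> \<rightarrow>\<^sub>M \<mu> \<and> distr \<mu> \<mu> T = \<mu>"
proof -
  have Tk [measurable]: "(T ^^ k) \<in> M \<rightarrow>\<^sub>M M" for k
    by (induction k) (auto simp: comp_def id_def)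
  have TkS: "x \<in> S \<Longrightarrow> (T ^^ k) x \<in> S" for x k
    by (induction k) (auto simp: TS)
  have SM: "x \<in> S \<Longrightarrow> x \<in> space M" for x using sets.sets_into_space[OF S] by blast
  define m where "m k A = measure M {x\<in>S. (T ^^ k) x \<in> A}" for k A
  have fin: "emeasure M {x\<in>S. P x} \<noteq> \<infinity>" for P
    using emeasure_mono[of "{x\<in>S. P x}" S M] S1 by (metis (no_types, lifting) S ennreal_one_neq_top infinity_ennreal_def mem_Collect_eq neq_top_trans subsetI)
  have m_emeasure: "emeasure M {x\<in>S. (T ^^ k) x \<in> A} = ennreal (m k A)" for k A
    using fin by (simp add: m_def emeasure_eq_ennreal_measure)
  have m01: "0 \<le> m k A" "m k A \<le> 1" for k A
  proof -
    have "ennreal (m k A) \<le> 1"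
      unfolding m_emeasure[symmetric] S1[symmetric] by (intro emeasure_mono) auto
    then show "m k A \<le> 1" by (simp add: ennreal_le_1)
  qed (simp add: m_def)
  have meas: "{x\<in>S. (T ^^ k) x \<in> A} \<in> sets M" if "A \<in> sets M" for k A
  proof -
    have "{x\<in>S. (T ^^ k) x \<in> A} = S \<inter> ((T ^^ k) -` A \<inter> space M)" using SM by auto
    also have "\<dots> \<in> sets M" using that by measurable
    finally show ?thesis .
  qed
  \<comment> \<open>\<open>Suc n\<close> avoids the empty average, and the value 0 on non-measurable
    sets keeps X inside the cube.\<close>
  define X where "X n A = (if A \<in> sets M then (\<Sum>k<Suc n. m k A) / real (Suc n) else 0)" for n A
  have X01: "X n A \<in> {0..1}" for n A
  proof -
    have "(\<Sum>k<Suc n. m k A) \<le> (\<Sum>k<Suc n. 1)" by (intro sum_mono m01)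
    moreover have "0 \<le> (\<Sum>k<Suc n. m k A)" by (intro sum_nonneg m01)
    ultimately show ?thesis by (auto simp: X_def field_simps)
  qed
  obtain \<nu> where \<nu>: "\<And>C N. closed C \<Longrightarrow> (\<And>n. N \<le> n \<Longrightarrow> X n \<in> C) \<Longrightarrow> \<nu> \<in> C"
    by (rule cluster_point_exists[OF compact_unit_cube, of X]) (use X01 in auto)
  have cont [continuous_intros]: "continuous_on UNIV (\<lambda>f :: 'a set \<Rightarrow> real. f A)" for A
    by simp
  have \<nu>01: "0 \<le> \<nu> A" "\<nu> A \<le> 1" for A
  proof -
    have "\<nu> \<in> {f. 0 \<le> f A}" "\<nu> \<in> {f. f A \<le> 1}"
      by (rule \<nu>[where N=0], intro closed_Collect_le continuous_intros, use X01 in force)+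
    then show "0 \<le> \<nu> A" "\<nu> A \<le> 1" by auto
  qed
  have \<nu>_add: "\<nu> (A \<union> B) = \<nu> A + \<nu> B" if "A \<in> sets M" "B \<in> sets M" "A \<inter> B = {}" for A B
  proof -
    have "m k (A \<union> B) = m k A + m k B" for k
    proof -
      have "{x\<in>S. (T ^^ k) x \<in> A \<union> B} = {x\<in>S. (T ^^ k) x \<in> A} \<union> {x\<in>S. (T ^^ k) x \<in> B}" by auto
      then show ?thesis
        unfolding m_def using that fin by (subst measure_Union[symmetric]) (auto intro: meas)
    qed
    then have "X n (A \<union> B) = X n A + X n B" for n
      using that by (simp add: X_def sum.distrib add_divide_distrib)
    then have "\<nu> \<in> {f. f (A \<union> B) = f A + f B}"
      by (intro \<nu>[where N=0] closed_Collect_eq continuous_intros) auto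
    then show ?thesis by simp
  qed
  have \<nu>_S: "\<nu> S = 1"
  proof -
    have "m k S = 1" for k
    proof -
      have "{x\<in>S. (T ^^ k) x \<in> S} = S" using TkS by auto
      then show ?thesis using S1 by (simp add: m_def measure_def)
    qed
    then have "\<nu> \<in> {f. f S = 1}"
      by (intro \<nu>[where N=0] closed_Collect_eq continuous_intros) (auto simp: X_def)
    then show ?thesis by simp
  qed
  have \<nu>_inv: "\<nu> (T -` A \<inter> space M) = \<nu> A" if A: "A \<in> sets M" for A
  proof -
    have m_Suc: "m k (T -` A \<inter> space M) = m (Suc k) A" for k
      unfolding m_def using SM TkS by (intro arg_cong[where f="measure M"]) auto
    have X: "\<bar>X n (T -` A \<inter> space M) - X n A\<bar> \<le> 2 / real (Suc n)" for n
    proof -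
      have "(\<Sum>k<Suc n. m (Suc k) A) - (\<Sum>k<Suc n. m k A) = m (Suc n) A - m 0 A"
        unfolding sum_subtractf[symmetric] by (rule sum_lessThan_telescope)
      moreover have "X n (T -` A \<inter> space M) - X n A
          = ((\<Sum>k<Suc n. m (Suc k) A) - (\<Sum>k<Suc n. m k A)) / real (Suc n)"
        using A measurable_sets[OF T A] by (simp add: X_def m_Suc diff_divide_distrib)
      ultimately have "X n (T -` A \<inter> space M) - X n A = (m (Suc n) A - m 0 A) / real (Suc n)" by simp
      moreover have "\<bar>m (Suc n) A - m 0 A\<bar> \<le> 2" using m01[of "Suc n" A] m01[of 0 A] by (auto simp: abs_le_iff)
      ultimately show ?thesis by (simp add: divide_right_mono)
    qed
    \<comment> \<open>The averages need not be invariant, but each fixed bound 2/(N+1) on the defect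
      is a closed condition valid from N on.\<close>
    have "\<bar>\<nu> (T -` A \<inter> space M) - \<nu> A\<bar> \<le> 2 / real (Suc N)" for N
    proof -
      have "X n \<in> {f. \<bar>f (T -` A \<inter> space M) - f A\<bar> \<le> 2 / real (Suc N)}" if "N \<le> n" for n
      proof -
        have "2 / real (Suc n) \<le> 2 / real (Suc N)" using that by (intro divide_left_mono) auto
        then show ?thesis using X[of n] by simp
      qed
      then have "\<nu> \<in> {f. \<bar>f (T -` A \<inter> space M) - f A\<bar> \<le> 2 / real (Suc N)}"
        by (intro \<nu>[where N=N] closed_Collect_le continuous_intros)
      then show ?thesis by simp
    qed
    moreover have "(\<lambda>N. 2 / real (Suc N)) \<longlonglongrightarrow> 0" by real_asymp
    ultimately have "\<bar>\<nu> (T -` A \<inter> space M) - \<nu> A\<bar> \<le> 0"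
      by (intro LIMSEQ_le_const) auto
    then show ?thesis by simp
  qed
  have \<nu>_bound: "\<exists>C. \<forall>A\<in>sets M. emeasure M A < \<infinity> \<longrightarrow> \<nu> A \<le> C * measure M A + \<eta>" if "0 < \<eta>" for \<eta>
  proof -
    obtain C :: real where C: "\<And>A n. A \<in> sets M \<Longrightarrow>
      (\<Sum>k<n. emeasure M {x\<in>S. (T ^^ k) x \<in> A}) \<le> of_nat n * (ennreal C * emeasure M A + ennreal \<eta>)"
      using bound[OF \<open>0 < \<eta>\<close>] by blast
    \<comment> \<open>C may be negative; \<open>ennreal\<close> then truncates it to 0.\<close>
    define D where "D = max 0 C"
    have CD: "ennreal C = ennreal D" and D: "0 \<le> D" by (simp_all add: D_def ennreal_max_0)
    have "\<nu> A \<le> D * measure M A + \<eta>" if A: "A \<in> sets M" "emeasure M A < \<infinity>" for A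
    proof -
      have "X n A \<le> D * measure M A + \<eta>" for n
      proof -
        have "ennreal (\<Sum>k<Suc n. m k A) \<le> of_nat (Suc n) * (ennreal C * emeasure M A + ennreal \<eta>)"
          using C[OF A(1), of "Suc n"] m01 by (simp only: m_emeasure sum_ennreal)
        also have "\<dots> = of_nat (Suc n) * (ennreal (D) * ennreal (measure M A) + ennreal \<eta>)"
          using A(2) by (simp add: emeasure_eq_ennreal_measure CD)
        also have "\<dots> = ennreal (real (Suc n) * (D * measure M A + \<eta>))"
          using \<open>0 < \<eta>\<close> D unfolding ennreal_of_nat_eq_real_of_nat by (simp flip: ennreal_mult ennreal_plus)
        finally have "(\<Sum>k<Suc n. m k A) \<le> real (Suc n) * (D * measure M A + \<eta>)"
          using \<open>0 < \<eta>\<close> D by (subst (asm) ennreal_le_iff) auto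
        then show ?thesis using A by (simp add: X_def field_simps)
      qed
      then have "\<nu> \<in> {f. f A \<le> D * measure M A + \<eta>}"
        by (intro \<nu>[where N=0] closed_Collect_le continuous_intros) auto
      then show ?thesis by simp
    qed
    then show ?thesis by blast
  qed
  have \<nu>_mono: "\<nu> A \<le> \<nu> B" if "A \<in> sets M" "B \<in> sets M" "A \<subseteq> B" for A B
  proof -
    have "B = A \<union> (B - A)" using that by auto
    then have "\<nu> B = \<nu> A + \<nu> (B - A)" using \<nu>_add[of A "B - A"] that by auto
    then show ?thesis using \<nu>01 by simp
  qed
  have \<nu>_space: "\<nu> (space M) = 1"
    using \<nu>_mono[of S "space M"] \<nu>_S \<nu>01(2)[of "space M"] SM by force
  have \<nu>_compl: "\<nu> (space M - S) = 0"
    using \<nu>_add[of S "space M - S"] \<nu>_S \<nu>_space SM by (metis Diff_disjoint S Un_Diff_cancel add_cancel_right_right sets.compl_sets sets.sets_into_space sup.absorb_iff2)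
  have \<nu>_Int: "\<nu> A = \<nu> (A \<inter> S)" if A: "A \<in> sets M" for A
  proof -
    have "\<nu> A = \<nu> ((A \<inter> S) \<union> (A - S))" by (intro arg_cong[where f=\<nu>]) auto
    also have "\<dots> = \<nu> (A \<inter> S) + \<nu> (A - S)" using A by (intro \<nu>_add) auto
    also have "\<nu> (A - S) = 0"
    proof (rule antisym[OF _ \<nu>01(1)])
      have "A - S \<subseteq> space M - S" using sets.sets_into_space[OF A] by blast
      then have "\<nu> (A - S) \<le> \<nu> (space M - S)" using A by (intro \<nu>_mono) auto
      then show "\<nu> (A - S) \<le> 0" by (simp only: \<nu>_compl)
    qed
    finally show ?thesis by simp
  qed
  have \<nu>_null: "\<nu> A = 0" if A: "A \<in> null_sets M" for A
  proof (rule antisym[OF field_le_epsilon \<nu>01(1)])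
    fix \<eta> :: real assume "0 < \<eta>"
    from \<nu>_bound[OF this] obtain C where "\<forall>A\<in>sets M. emeasure M A < \<infinity> \<longrightarrow> \<nu> A \<le> C * measure M A + \<eta>" ..
    then have "\<nu> A \<le> C * measure M A + \<eta>" using A by (simp add: null_sets_def)
    then show "\<nu> A \<le> 0 + \<eta>" using A by (simp add: measure_eq_0_null_sets)
  qed
  have pos: "positive (sets M) (\<lambda>A. ennreal (\<nu> A))"
    using \<nu>_null[of "{}"] by (simp add: positive_def)
  have "countably_additive (sets M) (\<lambda>A. ennreal (\<nu> A))"
  proof (rule sets.empty_continuous_imp_countably_additive[OF pos])
    show "additive (sets M) (\<lambda>A. ennreal (\<nu> A))"
      using \<nu>_add \<nu>01 by (simp add: additive_def)
    fix A :: "nat \<Rightarrow> 'a set" assume A: "range A \<subseteq> sets M" "decseq A" "(\<Inter>i. A i) = {}"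
    \<comment> \<open>M may be infinite, so continuity from above is applied inside S, outside of
      which \<nu> vanishes.\<close>
    have AS: "A i \<inter> S \<in> sets M" "emeasure M (A i \<inter> S) < \<infinity>" for i
      using A fin[of "\<lambda>x. x \<in> A i"] by (auto simp: Int_def conj_commute less_top)
    have "(\<lambda>i. measure M (A i \<inter> S)) \<longlonglongrightarrow> measure M (\<Inter>i. A i \<inter> S)"
    proof (rule Lim_measure_decseq)
      show "decseq (\<lambda>i. A i \<inter> S)" using A(2) unfolding decseq_def by blast
    qed (use AS in \<open>auto simp: less_top\<close>)
    moreover have "(\<Inter>i. A i \<inter> S) = {}" using A(3) by auto
    ultimately have lim: "(\<lambda>i. measure M (A i \<inter> S)) \<longlonglongrightarrow> 0" by simp
    have "(\<lambda>i. \<nu> (A i)) \<longlonglongrightarrow> 0"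
    proof (rule LIMSEQ_I)
      fix r :: real assume "0 < r"
      then have "0 < r / 2" by simp
      from \<nu>_bound[OF this] obtain C where C: "\<forall>A\<in>sets M. emeasure M A < \<infinity> \<longrightarrow> \<nu> A \<le> C * measure M A + r / 2" ..
      have "(\<lambda>i. C * measure M (A i \<inter> S) + r / 2) \<longlonglongrightarrow> C * 0 + r / 2"
        by (intro tendsto_intros lim)
      from order_tendstoD(2)[OF this, of r] \<open>0 < r\<close>
      have "eventually (\<lambda>i. C * measure M (A i \<inter> S) + r / 2 < r) sequentially" by simp
      then obtain N where N: "\<And>i. N \<le> i \<Longrightarrow> C * measure M (A i \<inter> S) + r / 2 < r"
        by (auto simp: eventually_sequentially)
      have "norm (\<nu> (A i) - 0) < r" if "N \<le> i" for i
      proof -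
        have "\<nu> (A i) = \<nu> (A i \<inter> S)" using A by (intro \<nu>_Int) auto
        also have "\<dots> \<le> C * measure M (A i \<inter> S) + r / 2" using C AS by blast
        also have "\<dots> < r" by (rule N[OF that])
        finally show ?thesis using \<nu>01(1)[of "A i"] by simp
      qed
      then show "\<exists>N. \<forall>i\<ge>N. norm (\<nu> (A i) - 0) < r" by blast
    qed
    then show "(\<lambda>i. ennreal (\<nu> (A i))) \<longlonglongrightarrow> 0"
      using tendsto_ennrealI by fastforce
  qed auto
  with pos have em: "emeasure (measure_of (space M) (sets M) (\<lambda>A. ennreal (\<nu> A))) A = ennreal (\<nu> A)" if "A \<in> sets M" for A
    using that by (intro emeasure_measure_of_sigma) (auto simp: sets.sigma_algebra_axioms)
  define \<mu> where "\<mu> = measure_of (space M) (sets M) (\<lambda>A. ennreal (\<nu> A))"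
  have sets_\<mu> [measurable_cong, simp]: "sets \<mu> = sets M" by (simp add: \<mu>_def)
  have space_\<mu> [simp]: "space \<mu> = space M" by (simp add: \<mu>_def)
  have em\<mu>: "emeasure \<mu> A = ennreal (\<nu> A)" if "A \<in> sets M" for A
    using em[OF that] by (simp add: \<mu>_def)
  show ?thesis
  proof (intro exI[of _ \<mu>] conjI)
    show "prob_space \<mu>" by (rule prob_spaceI) (simp add: em\<mu> \<nu>_space)
    show "emeasure \<mu> (space M - S) = 0" by (simp add: em\<mu> \<nu>_compl)
    show "absolutely_continuous M \<mu>"
      unfolding absolutely_continuous_def using \<nu>_null by (auto simp: null_sets_def em\<mu>)
    show "T \<in> \<mu> \<rightarrow>\<^sub>M \<mu>" by measurable
    show "distr \<mu> \<mu> T = \<mu>"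
    proof (rule measure_eqI)
      fix A assume "A \<in> sets (distr \<mu> \<mu> T)"
      then have A: "A \<in> sets M" by simp
      then show "emeasure (distr \<mu> \<mu> T) A = emeasure \<mu> A"
        by (subst emeasure_distr) (auto simp: em\<mu> \<nu>_inv measurable_sets[OF T])
    qed simp
  qed simp
qed

subsection \<open>Certificate for the sum of the renewal weights\<close>

text \<open>\<open>H k\<close>: \<open>k\<close> steps after a visit to the critical line.
  \<open>P k\<close>: \<open>k\<close> steps after the second of two visits at consecutive times, near the point of the line on the top side.
  \<open>Q k\<close>: \<open>k\<close> steps after the second of two visits at distance three.
  Each node carries a gauge on covectors, given by its values (in thousandths) on finitely many rays;
  the values were found by iterating the inequality that \<open>step_ok\<close> checks.
  One step is affine in \<open>\<beta>\<close>, so it suffices to check the two end points \<open>Bs\<close> (in hundredths)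
  of the range of \<open>\<beta>\<close>.\<close>

datatype node = Free | H nat | P nat | Q nat

fun is_hit :: "node \<Rightarrow> bool" where
  "is_hit Free = False"
| "is_hit (H k) = (k = 0)"
| "is_hit (P k) = (k = 0)"
| "is_hit (Q k) = (k = 0)"

definition det2 :: "'a \<times> 'a \<Rightarrow> 'a \<times> 'a \<Rightarrow> 'a :: comm_ring" where
  "det2 p q = fst p * snd q - snd p * fst q"

text \<open>The list is closed up cyclically. The rays sweep a half-plane and the cost is even, so
  in the last edge the first ray stands for its negative.\<close>

definition edges :: "'b list \<Rightarrow> ('b \<times> 'b) list" where
  "edges xs = (case xs of [] \<Rightarrow> [] | x # ys \<Rightarrow> zip xs (ys @ [x]))"

text \<open>Expands \<open>v\<close> in two neighbouring rays and uses sublinearity. With absolute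
  values of the coefficients any independent pair gives a valid bound, so the cone containing
  \<open>v\<close> need not be identified. Units: \<open>v\<close> is 200 times the covector, gauge
  values are thousandths, and all is multiplied by 2000000.\<close>

definition step_ok :: "(int \<times> int) list \<Rightarrow> int list \<Rightarrow> int \<times> int \<Rightarrow> int \<Rightarrow> int \<Rightarrow> bool" where
  "step_ok rays fs v own f = list_ex (\<lambda>((p, fp), (q, fq)).
     det2 p q \<noteq> 0 \<and>
     own * \<bar>det2 p q\<bar> + 10 * (\<bar>det2 v q\<bar> * fp + \<bar>det2 p v\<bar> * fq) \<le> 2000 * \<bar>det2 p q\<bar> * f)
     (edges (zip rays fs))"

text \<open>B is 100 \<beta>, K ten times the slope of \<open>e\<close>, and W a thousand times an
  upper bound for half its first component. The vector passed to \<open>step_ok\<close> is 200 times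
  the next covector.\<close>

definition potential_ok ::
  "(int \<times> int) list \<Rightarrow> int list \<Rightarrow> int \<Rightarrow> int \<Rightarrow> (node \<Rightarrow> (bool \<times> node) list) \<Rightarrow> (node \<Rightarrow> int list) \<Rightarrow> node list \<Rightarrow> bool"
where
  "potential_ok rays Bs K W succ tab nodes =
    list_all (\<lambda>nd. list_all (\<lambda>((a, d), f). 0 \<le> f \<and> list_all (\<lambda>(s, t). List.member nodes t \<and>
      list_all (\<lambda>B. step_ok rays (tab t) ((100 + B) * d - 2 * B * a, if s then 200 * a else - 200 * a)
        (if is_hit nd then W * \<bar>2000 * a + K * (100 + B) * d\<bar> else 0) f) Bs)
      (succ nd)) (zip rays (tab nd))) nodes"

text \<open>Each flag is the branch taken when leaving the node; both values occur where nothing is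
  forced. At the ends of the chains the history is dropped.\<close>

definition succA :: "node \<Rightarrow> (bool \<times> node) list" where
  "succA nd = (case nd of Free \<Rightarrow> [(True, Free), (True, H 0), (False, Free), (False, H 0)]
    | H k \<Rightarrow> [[(True, H 1), (True, P 0), (False, H 1), (False, P 0)], [(True, H 2), (False, H 2)],
        [(False, H 3), (False, Q 0)], [(True, H 4), (False, H 4)], [(True, Free), (True, H 0)]] ! k
    | P k \<Rightarrow> [[(True, P 1), (False, P 1)], [(False, P 2)], [(False, P 3)], [(True, P 4)], [(True, P 5)],
        [(True, P 6)], [(False, Free), (False, H 0)]] ! k
    | Q k \<Rightarrow> [[(True, Q 1), (False, Q 1)], [(True, Q 2)], [(False, Q 3)], [(False, Q 4)], [(True, Q 5)],
        [(False, Free), (False, H 0)]] ! k)"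

definition nodesA :: "node list" where
  "nodesA = [Free, H 0, H 1, H 2, H 3, H 4, P 0, P 1, P 2, P 3, P 4, P 5, P 6, Q 0, Q 1, Q 2, Q 3, Q 4, Q 5]"

definition raysA :: "(int \<times> int) list" where
  "raysA = [(1, 0), (2, 1), (1, 1), (1, 2), (0, 1), (-1, 2), (-1, 1), (-2, 1)]"

definition tabA :: "node \<Rightarrow> int list" where
  "tabA nd = (case nd of Free \<Rightarrow> [1283, 2121, 1344, 1994, 974, 2883, 1988, 3239]
    | H k \<Rightarrow> [[1464, 2710, 1618, 2362, 901, 2643, 1994, 3340],
        [988, 1789, 1013, 1427, 630, 1948, 1424, 2350],
        [947, 1913, 1291, 1983, 858, 2107, 1427, 2216],
        [1283, 2121, 1344, 1988, 854, 2814, 1983, 3239],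
        [1283, 1957, 1123, 1618, 974, 2883, 1988, 3239]] ! k
    | P k \<Rightarrow> [[1172, 2150, 1323, 1880, 624, 1873, 1514, 2672],
        [756, 1334, 611, 574, 355, 1347, 1032, 1754],
        [533, 1508, 1034, 1602, 667, 1165, 574, 840],
        [1003, 1468, 576, 689, 668, 2261, 1602, 2585],
        [1004, 1446, 689, 993, 735, 2282, 1606, 2597],
        [1104, 1957, 993, 1344, 723, 2296, 1610, 2628],
        [1086, 2121, 1344, 1994, 974, 2339, 1614, 2647]] ! k
    | Q k \<Rightarrow> [[1289, 2455, 1431, 1902, 539, 1809, 1537, 2811],
        [628, 945, 490, 799, 521, 1532, 1054, 1645],
        [782, 1500, 799, 990, 467, 1419, 1057, 1776],
        [702, 1604, 1059, 1610, 735, 1630, 990, 1553],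
        [1104, 1957, 993, 1344, 723, 2296, 1610, 2628],
        [1086, 2121, 1344, 1994, 974, 2339, 1614, 2647]] ! k)"

text \<open>For small \<alpha>: the estimates behind the Q chain and \<open>P 6\<close> assume
  \<alpha> \<ge> 0.18, so a visit at distance three restarts at \<open>H 0\<close> and the P chain
  stops at \<open>P 5\<close>.\<close>

definition succB :: "node \<Rightarrow> (bool \<times> node) list" where
  "succB nd = (case nd of Free \<Rightarrow> [(True, Free), (True, H 0), (False, Free), (False, H 0)]
    | H k \<Rightarrow> [[(True, H 1), (True, P 0), (False, H 1), (False, P 0)], [(True, H 2), (False, H 2)],
        [(False, H 3), (False, H 0)], [(True, H 4), (False, H 4)], [(True, Free), (True, H 0)]] ! k
    | P k \<Rightarrow> [[(True, P 1), (False, P 1)], [(False, P 2)], [(False, P 3)], [(True, P 4)], [(True, P 5)],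
        [(True, Free), (True, H 0)]] ! k
    | Q k \<Rightarrow> [])"

definition nodesB :: "node list" where
  "nodesB = [Free, H 0, H 1, H 2, H 3, H 4, P 0, P 1, P 2, P 3, P 4, P 5]"

definition raysB :: "(int \<times> int) list" where
  "raysB = [(1, 0), (1, 1), (0, 1), (-1, 1)]"

definition tabB :: "node \<Rightarrow> int list" where
  "tabB nd = (case nd of Free \<Rightarrow> [982, 1264, 793, 1651]
    | H k \<Rightarrow> [[1300, 1508, 678, 1850], [920, 1080, 526, 1270], [861, 1264, 793, 1367],
        [982, 1222, 600, 1506], [982, 1093, 793, 1651]] ! k
    | P k \<Rightarrow> [[1111, 1252, 364, 1419], [596, 616, 390, 894], [638, 976, 488, 743],
        [800, 772, 600, 1352], [982, 943, 600, 1506], [982, 1093, 793, 1651]] ! k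
    | Q k \<Rightarrow> [])"

text \<open>\<alpha> \<le> 0.18 gives \<beta> \<le> 0.22 and 1/(2(1-\<alpha>)) \<le> 0.610; the
  slope of \<open>e\<close> is 0.\<close>

lemma potential_okB: "potential_ok raysB [0, 22] 0 610 succB tabB nodesB"
  by code_simp

text \<open>0.18 \<le> \<alpha> \<le> 0.2481 gives 0.21 \<le> \<beta> \<le> 0.33 and
  1/(2(1-0.7\<alpha>)) \<le> 0.606; the slope of \<open>e\<close> is 3/10.\<close>

lemma potential_okA: "potential_ok raysA [21, 33] 3 606 succA tabA nodesA"
  by code_simp

section \<open>Soundness of the certificate\<close>

lemma det2_expand:
  fixes p q v :: "real \<times> real"
  assumes "det2 p q \<noteq> 0"
  shows "v = (det2 v q / det2 p q) *\<^sub>R p + (det2 p v / det2 p q) *\<^sub>R q"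
proof -
  have "det2 p q * fst v = det2 v q * fst p + det2 p v * fst q"
    "det2 p q * snd v = det2 v q * snd p + det2 p v * snd q"
    by (simp_all add: det2_def algebra_simps)
  then show ?thesis using assms by (simp add: prod_eq_iff field_simps)
qed

definition of_int2 :: "int \<times> int \<Rightarrow> real \<times> real" where
  "of_int2 p = (of_int (fst p), of_int (snd p))"

lemma det2_of_int2: "det2 (of_int2 p) (of_int2 q) = of_int (det2 p q)"
  by (simp add: det2_def of_int2_def)

lemma edges_subset: "(x, y) \<in> set (edges xs) \<Longrightarrow> x \<in> set xs \<and> y \<in> set xs"
  by (auto simp: edges_def split: list.splits dest: set_zip_leftD set_zip_rightD)

context memory_map begin

text \<open>In the coordinates \<open>(a, d)\<close> for the covector \<open>(a, c d)\<close> the step becomes affine in \<open>\<beta>\<close>.\<close>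

definition dstep :: "bool \<Rightarrow> real \<times> real \<Rightarrow> real \<times> real" where
  "dstep b v = (c * snd v - \<beta> * fst v, sgb b * fst v)"

text \<open>Total weight of the hits in the next n steps for the covector \<open>v\<close>: each hit
  evaluates it on the direction (1, \<kappa>), and \<omega> bounds \<rho>/2 for \<open>e\<close> =
  (\<rho>, \<rho>\<kappa>).\<close>

fun cost :: "real \<Rightarrow> real \<Rightarrow> real \<Rightarrow> nat \<Rightarrow> real \<times> real \<Rightarrow> real \<times> real \<Rightarrow> real" where
  "cost \<epsilon> \<omega> \<kappa> 0 z v = 0"
| "cost \<epsilon> \<omega> \<kappa> (Suc n) z v =
    (if dev z \<le> \<epsilon> then \<omega> * \<bar>fst v + \<kappa> * c * snd v\<bar> else 0) + cost \<epsilon> \<omega> \<kappa> n (G \<alpha> z) (dstep (lo z) v)"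

lemma cost_eq_sum:
  "cost \<epsilon> \<omega> \<kappa> n z v = (\<Sum>j<n. if dev ((G \<alpha> ^^ j) z) \<le> \<epsilon>
     then \<omega> * \<bar>fst (push (itin j z) (fst v, c * snd v)) + \<kappa> * snd (push (itin j z) (fst v, c * snd v))\<bar> else 0)"
proof (induction n arbitrary: z v)
  case (Suc n)
  have "cstep b (fst v, c * snd v) = (fst (dstep b v), c * snd (dstep b v))" for b
    by (simp add: cstep_def dstep_def mult.left_commute)
  then show ?case
    unfolding cost.simps Suc sum.lessThan_Suc_shift by (simp add: funpow_swap1 mult.assoc cong: if_cong)
qed simp

lemma dstep_scaleR: "dstep b (r *\<^sub>R v) = r *\<^sub>R dstep b v"
  and dstep_add: "dstep b (v + w) = dstep b v + dstep b w"
  by (simp_all add: dstep_def algebra_simps)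

lemma cost_scaleR: "cost \<epsilon> \<omega> \<kappa> n z (r *\<^sub>R v) = \<bar>r\<bar> * cost \<epsilon> \<omega> \<kappa> n z v"
proof (induction n arbitrary: z v)
  case (Suc n)
  have "\<bar>r * fst v + \<kappa> * c * (r * snd v)\<bar> = \<bar>r\<bar> * \<bar>fst v + \<kappa> * c * snd v\<bar>"
    by (simp add: algebra_simps flip: abs_mult)
  then show ?case by (simp add: Suc dstep_scaleR algebra_simps)
qed simp

lemma cost_add:
  assumes "0 \<le> \<omega>"
  shows "cost \<epsilon> \<omega> \<kappa> n z (v + w) \<le> cost \<epsilon> \<omega> \<kappa> n z v + cost \<epsilon> \<omega> \<kappa> n z w"
proof (induction n arbitrary: z v w)
  case (Suc n)
  have "\<omega> * \<bar>fst (v + w) + \<kappa> * c * snd (v + w)\<bar> \<le> \<omega> * (\<bar>fst v + \<kappa> * c * snd v\<bar> + \<bar>fst w + \<kappa> * c * snd w\<bar>)"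
    using assms abs_triangle_ineq[of "fst v + \<kappa> * c * snd v" "fst w + \<kappa> * c * snd w"]
    by (intro mult_left_mono) (simp_all add: algebra_simps)
  with Suc[of "G \<alpha> z" "dstep (lo z) v" "dstep (lo z) w"] show ?case
    by (simp add: dstep_add distrib_left)
qed simp

lemma cost_interpolate:
  assumes "0 \<le> \<omega>" "det2 p q \<noteq> 0" "cost \<epsilon> \<omega> \<kappa> n z p \<le> x" "cost \<epsilon> \<omega> \<kappa> n z q \<le> y"
  shows "cost \<epsilon> \<omega> \<kappa> n z v \<le> (\<bar>det2 v q\<bar> * x + \<bar>det2 p v\<bar> * y) / \<bar>det2 p q\<bar>"
proof -
  have "cost \<epsilon> \<omega> \<kappa> n z v = cost \<epsilon> \<omega> \<kappa> n z ((det2 v q / det2 p q) *\<^sub>R p + (det2 p v / det2 p q) *\<^sub>R q)"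
    using det2_expand[OF assms(2), of v] by simp
  also have "\<dots> \<le> \<bar>det2 v q / det2 p q\<bar> * cost \<epsilon> \<omega> \<kappa> n z p + \<bar>det2 p v / det2 p q\<bar> * cost \<epsilon> \<omega> \<kappa> n z q"
    using cost_add[OF assms(1)] unfolding cost_scaleR[symmetric] by blast
  also have "\<dots> \<le> \<bar>det2 v q / det2 p q\<bar> * x + \<bar>det2 p v / det2 p q\<bar> * y"
    using assms by (intro add_mono mult_left_mono) auto
  also have "\<dots> = (\<bar>det2 v q\<bar> * x + \<bar>det2 p v\<bar> * y) / \<bar>det2 p q\<bar>"
    by (simp add: add_divide_distrib)
  finally show ?thesis .
qed

lemma step_ok_sound:
  assumes ok: "step_ok rays fs v own f" and "0 \<le> \<omega>"
    and IH: "\<And>p fp. (p, fp) \<in> set (zip rays fs) \<Longrightarrow> cost \<epsilon> \<omega> \<kappa> n z (of_int2 p) \<le> of_int fp / 1000"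
  shows "of_int own / 2000000 + cost \<epsilon> \<omega> \<kappa> n z ((1/200) *\<^sub>R of_int2 v) \<le> of_int f / 1000"
proof -
  obtain p fp q fq where pq: "((p, fp), (q, fq)) \<in> set (edges (zip rays fs))" and "det2 p q \<noteq> 0"
    and le: "own * \<bar>det2 p q\<bar> + 10 * (\<bar>det2 v q\<bar> * fp + \<bar>det2 p v\<bar> * fq) \<le> 2000 * \<bar>det2 p q\<bar> * f"
    using ok by (auto simp: step_ok_def list_ex_iff)
  let ?D = "real_of_int \<bar>det2 p q\<bar>" and ?N = "real_of_int (\<bar>det2 v q\<bar> * fp + \<bar>det2 p v\<bar> * fq)"
  have D: "0 < ?D" using \<open>det2 p q \<noteq> 0\<close> by simp
  have "cost \<epsilon> \<omega> \<kappa> n z (of_int2 v) \<le> (\<bar>det2 (of_int2 v) (of_int2 q)\<bar> * (of_int fp / 1000)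
      + \<bar>det2 (of_int2 p) (of_int2 v)\<bar> * (of_int fq / 1000)) / \<bar>det2 (of_int2 p) (of_int2 q)\<bar>"
    using \<open>0 \<le> \<omega>\<close> \<open>det2 p q \<noteq> 0\<close> edges_subset[OF pq] by (intro cost_interpolate IH) (auto simp: det2_of_int2)
  also have "\<dots> = ?N / (1000 * ?D)"
    by (simp add: det2_of_int2 field_simps)
  finally have "cost \<epsilon> \<omega> \<kappa> n z (of_int2 v) * (1000 * ?D) \<le> ?N"
    using D by (simp add: pos_le_divide_eq)
  moreover have "real_of_int (own * \<bar>det2 p q\<bar> + 10 * (\<bar>det2 v q\<bar> * fp + \<bar>det2 p v\<bar> * fq)) \<le> real_of_int (2000 * \<bar>det2 p q\<bar> * f)"
    using le by (simp only: of_int_le_iff)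
  then have "real_of_int own * ?D + 10 * ?N \<le> 2000 * ?D * real_of_int f" by simp
  ultimately have "(real_of_int own + 10000 * cost \<epsilon> \<omega> \<kappa> n z (of_int2 v)) * ?D \<le> (2000 * real_of_int f) * ?D"
    by (simp add: algebra_simps)
  then have "real_of_int own + 10000 * cost \<epsilon> \<omega> \<kappa> n z (of_int2 v) \<le> 2000 * real_of_int f"
    using D by (simp only: mult_le_cancel_right_pos)
  then show ?thesis by (simp add: cost_scaleR)
qed

text \<open>Induction on the horizon, with \<open>potential_ok\<close> as the inequality that closes
  the step. The true \<beta> is a convex combination of the end points; the next covector and the
  hit functional are affine in \<beta>, so sublinearity interpolates. Nodes may overlap: one
  successor that fits is enough, and the choice decides which part of the past is
  remembered.\<close>

lemma cost_le_potential:
  assumes ok: "potential_ok rays [B0, B1] K W succ tab nodes"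
    and \<beta>: "of_int B0 / 100 \<le> \<beta>" "\<beta> \<le> of_int B1 / 100" and "0 \<le> W"
    and trans: "\<And>nd z. nd \<in> set nodes \<Longrightarrow> occ nd z \<Longrightarrow> \<exists>(s, t) \<in> set (succ nd). lo z = s \<and> occ t (G \<alpha> z)"
    and hit: "\<And>nd z. nd \<in> set nodes \<Longrightarrow> occ nd z \<Longrightarrow> dev z \<le> \<epsilon> \<Longrightarrow> is_hit nd"
    and "nd \<in> set nodes" "occ nd z" "(r, f) \<in> set (zip rays (tab nd))"
  shows "cost \<epsilon> (of_int W / 1000) (of_int K / 10) n z (of_int2 r) \<le> of_int f / 1000"
  using assms(7-9)
proof (induction n arbitrary: nd z r f)
  case 0
  then have "0 \<le> f" using ok unfolding potential_ok_def list_all_iff by fastforce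
  then show ?case by simp
next
  case (Suc n)
  let ?\<omega> = "real_of_int W / 1000" and ?\<kappa> = "real_of_int K / 10"
  let ?c = "\<lambda>z v. cost \<epsilon> ?\<omega> ?\<kappa> n z v"
  obtain t where t: "(lo z, t) \<in> set (succ nd)" "occ t (G \<alpha> z)" using trans[OF Suc.prems(1,2)] by auto
  have \<omega>: "0 \<le> ?\<omega>" using \<open>0 \<le> W\<close> by simp
  define w where "w B = ((100 + B) * snd r - 2 * B * fst r, if lo z then 200 * fst r else - 200 * fst r)" for B
  define own where "own B = (if is_hit nd then W * \<bar>2000 * fst r + K * (100 + B) * snd r\<bar> else 0)" for B
  have mem: "t \<in> set nodes" and step: "step_ok rays (tab t) (w B) (own B) f" if "B \<in> {B0, B1}" for B
    using ok Suc.prems t(1) that unfolding potential_ok_def list_all_iff w_def own_def by fastforce+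
  have bound: "of_int (own B) / 2000000 + ?c (G \<alpha> z) ((1/200) *\<^sub>R of_int2 (w B)) \<le> of_int f / 1000"
    if "B \<in> {B0, B1}" for B
    by (rule step_ok_sound[OF step[OF that] \<omega>]) (rule Suc.IH[OF mem[OF that] t(2)])
  have "\<beta> \<in> closed_segment (of_int B0 / 100) (of_int B1 / 100)"
    using \<beta> by (simp add: closed_segment_eq_real_ivl)
  then obtain l where l: "0 \<le> l" "l \<le> 1" "\<beta> = (1 - l) * (of_int B0 / 100) + l * (of_int B1 / 100)"
    unfolding in_segment by auto
  have dstep: "dstep (lo z) (of_int2 r) = (1 - l) *\<^sub>R ((1/200) *\<^sub>R of_int2 (w B0)) + l *\<^sub>R ((1/200) *\<^sub>R of_int2 (w B1))"
    by (simp add: dstep_def w_def of_int2_def c_eq l(3) sgb_def field_simps)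
  have c1: "?c (G \<alpha> z) (dstep (lo z) (of_int2 r))
      \<le> (1 - l) * ?c (G \<alpha> z) ((1/200) *\<^sub>R of_int2 (w B0)) + l * ?c (G \<alpha> z) ((1/200) *\<^sub>R of_int2 (w B1))"
    unfolding dstep using l(1,2) by (intro order_trans[OF cost_add[OF \<omega>]]) (simp add: cost_scaleR[where v="_ *\<^sub>R _"] del: scaleR_scaleR)
  have c2: "(if dev z \<le> \<epsilon> then ?\<omega> * \<bar>fst (of_int2 r) + ?\<kappa> * c * snd (of_int2 r)\<bar> else 0)
      \<le> (1 - l) * (of_int (own B0) / 2000000) + l * (of_int (own B1) / 2000000)"
  proof (cases "dev z \<le> \<epsilon>")
    case True
    have own: "real_of_int (own B) / 2000000 = ?\<omega> * \<bar>fst (of_int2 r) + ?\<kappa> * ((1 + of_int B / 100) / 2) * snd (of_int2 r)\<bar>" for B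
    proof -
      let ?y = "fst (of_int2 r) + ?\<kappa> * ((1 + of_int B / 100) / 2) * snd (of_int2 r)"
      have "real_of_int (2000 * fst r + K * (100 + B) * snd r) = 2000 * ?y"
        by (simp add: of_int2_def field_simps)
      then have "real_of_int (own B) = of_int W * \<bar>2000 * ?y\<bar>"
        using hit[OF Suc.prems(1,2) True] unfolding own_def by (simp only: if_True of_int_mult of_int_abs)
      then show ?thesis unfolding abs_mult by simp
    qed
    let ?x = "\<lambda>b. fst (of_int2 r) + ?\<kappa> * ((1 + b / 100) / 2) * snd (of_int2 r)"
    have "fst (of_int2 r) + ?\<kappa> * c * snd (of_int2 r) = (1 - l) * ?x (of_int B0) + l * ?x (of_int B1)"
      by (simp add: c_eq l(3) field_simps)
    also have "\<bar>\<dots>\<bar> \<le> (1 - l) * \<bar>?x (of_int B0)\<bar> + l * \<bar>?x (of_int B1)\<bar>"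
      using l(1,2) by (intro order_trans[OF abs_triangle_ineq]) (simp add: abs_mult)
    finally have "?\<omega> * \<bar>fst (of_int2 r) + ?\<kappa> * c * snd (of_int2 r)\<bar>
        \<le> ?\<omega> * ((1 - l) * \<bar>?x (of_int B0)\<bar> + l * \<bar>?x (of_int B1)\<bar>)"
      using \<omega> by (intro mult_left_mono)
    also have "\<dots> = (1 - l) * (?\<omega> * \<bar>?x (of_int B0)\<bar>) + l * (?\<omega> * \<bar>?x (of_int B1)\<bar>)"
      by (simp only: distrib_left mult.left_commute)
    finally show ?thesis using True unfolding own by (simp only: if_True)
  next
    case False
    then show ?thesis using l \<open>0 \<le> W\<close> by (auto simp: own_def intro!: add_nonneg_nonneg mult_nonneg_nonneg)
  qed
  have "cost \<epsilon> ?\<omega> ?\<kappa> (Suc n) z (of_int2 r)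
      \<le> (1 - l) * (of_int (own B0) / 2000000 + ?c (G \<alpha> z) ((1/200) *\<^sub>R of_int2 (w B0)))
       + l * (of_int (own B1) / 2000000 + ?c (G \<alpha> z) ((1/200) *\<^sub>R of_int2 (w B1)))"
    using c1 c2 by (simp add: algebra_simps)
  also have "\<dots> \<le> (1 - l) * (of_int f / 1000) + l * (of_int f / 1000)"
    using l(1,2) by (intro add_mono mult_left_mono bound) auto
  also have "\<dots> = of_int f / 1000" by (simp add: distrib_right[symmetric])
  finally show ?case .
qed

text \<open>\<open>wt\<close> reads off a second component, that is the covector (0, 1), which
  either branch sends to (1, 0). What remains is the immediate hit, of weight at most
  \<omega>\<kappa>, and the cost of (1, 0) from the second image on.\<close>

lemma hits_le_cost:
  assumes \<rho>: "0 \<le> \<rho>" "\<rho> / 2 \<le> \<omega>" and "0 \<le> \<kappa>"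
    and C: "\<And>n. (if dev (G \<alpha> u) \<le> \<epsilon> then \<omega> * \<kappa> else 0) + cost \<epsilon> \<omega> \<kappa> n (G \<alpha> (G \<alpha> u)) (1, 0) \<le> C"
  shows "(\<Sum>j<n. if dev ((G \<alpha> ^^ Suc j) u) \<le> \<epsilon> then wt (\<rho>, \<rho> * \<kappa>) j (G \<alpha> u) else 0) \<le> C"
proof (cases n)
  case 0
  have "0 \<le> \<omega>" using \<rho> by simp
  then have "0 \<le> (if dev (G \<alpha> u) \<le> \<epsilon> then \<omega> * \<kappa> else 0)" using \<open>0 \<le> \<kappa>\<close> by simp
  with C[of 0] 0 show ?thesis by simp
next
  case (Suc m)
  let ?z = "G \<alpha> (G \<alpha> u)"
  have wt: "wt (\<rho>, \<rho> * \<kappa>) j z \<le> \<omega> * \<bar>fst (push (itin j z) (0, 1)) + \<kappa> * snd (push (itin j z) (0, 1))\<bar>" for j z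
  proof -
    have "wt (\<rho>, \<rho> * \<kappa>) j z = \<bar>\<rho> * (fst (push (itin j z) (0, 1)) + \<kappa> * snd (push (itin j z) (0, 1)))\<bar> / 2"
      using push_pull[of "itin j z" "(0, 1)" "(\<rho>, \<rho> * \<kappa>)"] by (simp add: wt_def algebra_simps)
    also have "\<dots> = \<rho> / 2 * \<bar>fst (push (itin j z) (0, 1)) + \<kappa> * snd (push (itin j z) (0, 1))\<bar>"
      using \<rho> by (simp add: abs_mult)
    also have "\<dots> \<le> \<omega> * \<bar>fst (push (itin j z) (0, 1)) + \<kappa> * snd (push (itin j z) (0, 1))\<bar>"
      using \<rho> by (intro mult_right_mono) auto
    finally show ?thesis .
  qed
  have first: "wt (\<rho>, \<rho> * \<kappa>) 0 (G \<alpha> u) \<le> \<omega> * \<kappa>" using wt[of 0] \<open>0 \<le> \<kappa>\<close> by simp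
  have later: "wt (\<rho>, \<rho> * \<kappa>) (Suc j) (G \<alpha> u) \<le> \<omega> * \<bar>fst (push (itin j ?z) (1, 0)) + \<kappa> * snd (push (itin j ?z) (1, 0))\<bar>" for j
    using wt[of "Suc j" "G \<alpha> u"] by (simp add: cstep_def)
  have "(\<Sum>j<Suc m. if dev ((G \<alpha> ^^ Suc j) u) \<le> \<epsilon> then wt (\<rho>, \<rho> * \<kappa>) j (G \<alpha> u) else 0)
     = (if dev (G \<alpha> u) \<le> \<epsilon> then wt (\<rho>, \<rho> * \<kappa>) 0 (G \<alpha> u) else 0)
       + (\<Sum>j<m. if dev ((G \<alpha> ^^ j) ?z) \<le> \<epsilon> then wt (\<rho>, \<rho> * \<kappa>) (Suc j) (G \<alpha> u) else 0)"
    unfolding sum.lessThan_Suc_shift by (simp add: funpow_swap1)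
  also have "\<dots> \<le> (if dev (G \<alpha> u) \<le> \<epsilon> then \<omega> * \<kappa> else 0)
       + (\<Sum>j<m. if dev ((G \<alpha> ^^ j) ?z) \<le> \<epsilon>
          then \<omega> * \<bar>fst (push (itin j ?z) (1, 0)) + \<kappa> * snd (push (itin j ?z) (1, 0))\<bar> else 0)"
    using first later by (intro add_mono sum_mono) auto
  also have "\<dots> = (if dev (G \<alpha> u) \<le> \<epsilon> then \<omega> * \<kappa> else 0) + cost \<epsilon> \<omega> \<kappa> m ?z (1, 0)"
    by (simp add: cost_eq_sum cong: if_cong)
  also have "\<dots> \<le> C" by (rule C)
  finally show ?thesis using Suc by simp
qed

end

subsection \<open>Orbits returning to the critical line\<close>

text \<open>Errors double at each tent step; the worst accumulated one, 64 \<open>eps\<close> in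
  \<open>L7_corner\<close>, must stay below the margin there.\<close>

abbreviation eps :: real where "eps \<equiv> 1 / 10000"

context memory_map begin

definition near :: "real \<times> real \<Rightarrow> bool" where "near z \<longleftrightarrow> dev z \<le> eps"

lemma close_lo: "\<bar>l - s\<bar> \<le> d \<Longrightarrow> y = 2 * l \<Longrightarrow> t = 2 * s \<Longrightarrow> \<bar>y - t\<bar> \<le> 2 * (d :: real)"
  and close_hi: "\<bar>l - s\<bar> \<le> d \<Longrightarrow> y = 2 - 2 * l \<Longrightarrow> t = 2 - 2 * s \<Longrightarrow> \<bar>y - t\<bar> \<le> 2 * (d :: real)"
  by linarith+

text \<open>In P and Q the witness \<open>u\<close> is the first of the two visits, hence the
  offsets 1 and 3. The clause on \<open>near\<close> places every hit at a node of index 0.\<close>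

fun occ :: "node \<Rightarrow> real \<times> real \<Rightarrow> bool" where
  "occ Free z \<longleftrightarrow> z \<in> unit_square \<and> \<not> near z"
| "occ (H k) z \<longleftrightarrow> (near z \<longleftrightarrow> k = 0) \<and> (\<exists>u\<in>unit_square. near u \<and> z = (G \<alpha> ^^ k) u)"
| "occ (P k) z \<longleftrightarrow> (near z \<longleftrightarrow> k = 0) \<and>
    (\<exists>u\<in>unit_square. near u \<and> near (G \<alpha> u) \<and> z = (G \<alpha> ^^ Suc k) u)"
| "occ (Q k) z \<longleftrightarrow> (near z \<longleftrightarrow> k = 0) \<and>
    (\<exists>u\<in>unit_square. near u \<and> near ((G \<alpha> ^^ 3) u) \<and> z = (G \<alpha> ^^ (k + 3)) u)"

lemma occ_near: "occ nd z \<Longrightarrow> near z \<Longrightarrow> is_hit nd"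
  by (cases nd) auto

definition up :: "real \<times> real \<Rightarrow> bool" where "up z \<longleftrightarrow> 1/2 + eps < lin z"
definition dn :: "real \<times> real \<Rightarrow> bool" where "dn z \<longleftrightarrow> lin z < 1/2 - eps"

lemma up: "up z \<Longrightarrow> \<not> lo z \<and> \<not> near z" and dn: "dn z \<Longrightarrow> lo z \<and> \<not> near z"
  by (auto simp: up_def dn_def lo_def near_def dev_def)

lemma mix_close:
  assumes "\<bar>x - s\<bar> \<le> d" "\<bar>y - t\<bar> \<le> d"
  shows "\<bar>(\<alpha> * y + (1 - \<alpha>) * x) - (\<alpha> * t + (1 - \<alpha>) * s)\<bar> \<le> d"
proof -
  have "\<bar>(\<alpha> * y + (1 - \<alpha>) * x) - (\<alpha> * t + (1 - \<alpha>) * s)\<bar> = \<bar>\<alpha> * (y - t) + (1 - \<alpha>) * (x - s)\<bar>"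
    by (simp add: algebra_simps)
  also have "\<dots> \<le> \<alpha> * \<bar>y - t\<bar> + (1 - \<alpha>) * \<bar>x - s\<bar>"
    using \<alpha>_pos \<alpha>_less abs_triangle_ineq[of "\<alpha> * (y - t)" "(1 - \<alpha>) * (x - s)"] by (simp add: abs_mult)
  also have "\<dots> \<le> \<alpha> * d + (1 - \<alpha>) * d"
    using assms \<alpha>_pos \<alpha>_less by (intro add_mono mult_left_mono) auto
  finally show ?thesis by (simp add: algebra_simps)
qed

end

text \<open>The orbit of a point of the unit square, written as a scalar second-order recursion.\<close>

locale tent_orbit = memory_map +
  fixes x :: "nat \<Rightarrow> real" and L :: "nat \<Rightarrow> real"
  assumes \<alpha>_le: "\<alpha> \<le> 2481/10000"
    and x01: "0 \<le> x k" "x k \<le> 1"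
    and L: "L k = \<alpha> * x (Suc k) + (1 - \<alpha>) * x k"
    and x_rec: "x (k + 2) = 1 - 2 * \<bar>L k - 1/2\<bar>"
begin

lemma L_ge_fst: "(1 - \<alpha>) * x k \<le> L k"
  using x01[of "Suc k"] \<alpha>_pos by (simp add: L)

lemma x_lo: "L k \<le> 1/2 \<Longrightarrow> x (k + 2) = 2 * L k"
  and x_hi: "1/2 \<le> L k \<Longrightarrow> x (k + 2) = 2 - 2 * L k"
  unfolding x_rec by simp_all

lemma x_near: "\<bar>L k - 1/2\<bar> \<le> eps \<Longrightarrow> 1 - 2 * eps \<le> x (k + 2)"
  unfolding x_rec by simp

text \<open>Chord from 0 to 0.2481 and tangent at 0.2481 of the square function, to make later
  estimates linear.\<close>

lemma \<alpha>_sq: "\<alpha> * \<alpha> \<le> 2481/10000 * \<alpha>" "4962/10000 * \<alpha> - 615537/10000000 \<le> \<alpha> * \<alpha>"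
proof -
  show "\<alpha> * \<alpha> \<le> 2481/10000 * \<alpha>" using \<alpha>_le \<alpha>_pos by (intro mult_right_mono) auto
  have "0 \<le> (\<alpha> - 2481/10000) * (\<alpha> - 2481/10000)" by simp
  then show "4962/10000 * \<alpha> - 615537/10000000 \<le> \<alpha> * \<alpha>" by (simp add: algebra_simps)
qed

text \<open>The left side bounds \<open>L 4\<close> after any visit, up to 4 \<open>eps\<close>, and
  is the limit of \<open>L 5\<close> after a double visit; \<open>bound6\<close> is its analogue for
  \<open>L 6\<close>.\<close>

lemma bound4: "2 * \<alpha> * (1 - \<alpha>) + 4 * \<alpha> * \<alpha> * \<alpha> \<le> 44/100"
proof -
  have "4 * (\<alpha> * \<alpha>) * \<alpha> \<le> 4 * (2481/10000 * \<alpha>) * \<alpha>"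
    using \<alpha>_sq \<alpha>_pos by (intro mult_right_mono mult_left_mono) auto
  then have "2 * \<alpha> * (1 - \<alpha>) + 4 * \<alpha> * \<alpha> * \<alpha> \<le> 2 * \<alpha> - 2 * (\<alpha> * \<alpha>) + 4 * 2481/10000 * (\<alpha> * \<alpha>)"
    by (simp add: algebra_simps)
  with \<alpha>_sq \<alpha>_le show ?thesis by linarith
qed

lemma bound6: "\<alpha> * (8 * \<alpha> * \<alpha> * \<alpha> + 4 * \<alpha> * (1 - \<alpha>)) + (1 - \<alpha>) * (4 * \<alpha> * \<alpha>) \<le> 44/100"
proof -
  have "(\<alpha> * \<alpha>) * \<alpha> \<le> (2481/10000 * \<alpha>) * \<alpha>"
    using \<alpha>_sq \<alpha>_pos by (intro mult_right_mono) auto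
  then have "\<alpha> - \<alpha> * \<alpha> + \<alpha> * \<alpha> * \<alpha> \<le> \<alpha> - 7519/10000 * (\<alpha> * \<alpha>)"
    by (simp add: algebra_simps)
  also have "\<dots> \<le> 2100/10000" using \<alpha>_sq \<alpha>_le by linarith
  finally have "(8 * \<alpha>) * (\<alpha> - \<alpha> * \<alpha> + \<alpha> * \<alpha> * \<alpha>) \<le> (8 * (2481/10000)) * (2100/10000)"
    using \<alpha>_pos \<alpha>_le by (intro mult_mono') (auto simp: mult_left_le)
  then show ?thesis by (simp add: algebra_simps)
qed

section \<open>Branches forced by a single visit\<close>

context
  assumes near0: "\<bar>L 0 - 1/2\<bar> \<le> eps"
begin

lemma x2: "1 - 2 * eps \<le> x 2"
  using x_near[OF near0] by (simp add: numeral_2_eq_2)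

text \<open>A visit sends \<open>x 2\<close> to almost 1, and its coefficient 1 - \<alpha> > 3/4
  alone exceeds 1/2.\<close>

lemma L2: "1/2 + eps < L 2"
proof -
  have "(1 - 2481/10000) * (1 - 2 * eps) \<le> (1 - \<alpha>) * x 2"
    using x2 \<alpha>_le by (intro mult_mono) auto
  with L_ge_fst[of 2] show ?thesis by simp
qed

lemma x4: "2 * \<alpha> * (1 - x 3) \<le> x 4" "x 4 \<le> 2 * \<alpha> * (1 - x 3) + 4 * eps"
proof -
  have x4: "x 4 = 2 - 2 * (\<alpha> * x 3 + (1 - \<alpha>) * x 2)"
    using x_hi[of 2] L2 L[of 2] by simp
  have "(1 - \<alpha>) * (1 - x 2) \<le> 1 * (2 * eps)"
    using x2 x01[of 2] \<alpha>_pos by (intro mult_mono) auto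
  moreover have "0 \<le> (1 - \<alpha>) * (1 - x 2)" using x01[of 2] \<alpha>_less by simp
  ultimately show "2 * \<alpha> * (1 - x 3) \<le> x 4" "x 4 \<le> 2 * \<alpha> * (1 - x 3) + 4 * eps"
    unfolding x4 by (simp_all add: algebra_simps)
qed

text \<open>\<open>x 4\<close> is nearly 2\<alpha>(1 - x 3), and x 5 \<le> 2 L 3 on either branch.
  The terms 2\<alpha>(1-\<alpha>) x 3 cancel and the rest is largest at x 3 = 0.\<close>

lemma L4: "L 4 < 1/2 - eps"
proof -
  have "1 - 2 * y \<le> 2 * l" if "- (l - 1/2) \<le> y" for y l :: real using that by linarith
  from this[OF abs_ge_minus_self] have "x (3 + 2) \<le> 2 * L 3" unfolding x_rec .
  then have "x 5 \<le> 2 * L 3" by simp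
  then have "\<alpha> * x 5 \<le> \<alpha> * (2 * (\<alpha> * x 4 + (1 - \<alpha>) * x 3))"
    using \<alpha>_pos L[of 3] by (intro mult_left_mono) auto
  then have "L 4 \<le> (2 * \<alpha> * \<alpha> + 1 - \<alpha>) * x 4 + 2 * \<alpha> * (1 - \<alpha>) * x 3"
    using L[of 4] by (simp add: algebra_simps)
  also have "(2 * \<alpha> * \<alpha> + 1 - \<alpha>) * x 4 \<le> (2 * \<alpha> * \<alpha> + 1 - \<alpha>) * (2 * \<alpha> * (1 - x 3)) + 4 * eps"
  proof -
    have "0 \<le> 2 * \<alpha> * \<alpha> + 1 - \<alpha>" "2 * \<alpha> * \<alpha> + 1 - \<alpha> \<le> 1" using \<alpha>_pos \<alpha>_le \<alpha>_sq by (auto simp: mult.assoc)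
    then have "(2 * \<alpha> * \<alpha> + 1 - \<alpha>) * (x 4 - 2 * \<alpha> * (1 - x 3)) \<le> 1 * (4 * eps)"
      using x4 by (intro mult_mono) auto
    then show ?thesis by (simp add: algebra_simps)
  qed
  finally have "L 4 \<le> 2 * \<alpha> * (1 - \<alpha>) + 4 * \<alpha> * \<alpha> * \<alpha> * (1 - x 3) + 4 * eps"
    by (simp add: algebra_simps)
  moreover have "4 * \<alpha> * \<alpha> * \<alpha> * (1 - x 3) \<le> 4 * \<alpha> * \<alpha> * \<alpha> * 1"
    using x01[of 3] \<alpha>_pos by (intro mult_left_mono) auto
  ultimately show ?thesis using bound4 by simp
qed

section \<open>Branches forced by two consecutive visits\<close>

context
  assumes near1: "\<bar>L 1 - 1/2\<bar> \<le> eps"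
begin

text \<open>Now (x 2, x 3) is close to the corner (1, 1). The following lemmas track its orbit 1, 1,
  0, 2\<alpha>, 4\<alpha>^2, ... with doubling error.\<close>

lemma x3: "1 - 2 * eps \<le> x 3"
  using x_near[OF near1] by (simp add: numeral_3_eq_3)

lemma L3_corner: "1/2 + eps < L 3"
proof -
  have "(1 - 2481/10000) * (1 - 2 * eps) \<le> (1 - \<alpha>) * x 3"
    using x3 \<alpha>_le by (intro mult_mono) auto
  with L_ge_fst[of 3] show ?thesis by simp
qed

lemma x4_corner: "\<bar>x 4 - 0\<bar> \<le> 4 * eps"
proof -
  have "\<bar>L 2 - (\<alpha> * 1 + (1 - \<alpha>) * 1)\<bar> \<le> 2 * eps"
    unfolding L[of 2] using x2 x3 x01[of 2] x01[of 3] by (intro mix_close) (auto simp: numeral_3_eq_3 numeral_2_eq_2)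
  then have "\<bar>x 4 - 0\<bar> \<le> 2 * (2 * eps)"
    by (rule close_hi) (use x_hi[of 2] L2 in \<open>simp_all add: algebra_simps\<close>)
  then show ?thesis by simp
qed

lemma x5_corner: "\<bar>x 5 - 2 * \<alpha>\<bar> \<le> 8 * eps"
proof -
  have "\<bar>L 3 - (\<alpha> * 0 + (1 - \<alpha>) * 1)\<bar> \<le> 4 * eps"
    unfolding L[of 3] using x4_corner x3 x01[of 3] by (intro mix_close) auto
  then have "\<bar>x 5 - 2 * \<alpha>\<bar> \<le> 2 * (4 * eps)"
    by (rule close_hi) (use x_hi[of 3] L3_corner in \<open>simp_all add: algebra_simps\<close>)
  then show ?thesis by simp
qed

lemma x6_corner: "\<bar>x 6 - 4 * \<alpha> * \<alpha>\<bar> \<le> 16 * eps"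
proof -
  have "\<bar>L 4 - (\<alpha> * (2 * \<alpha>) + (1 - \<alpha>) * 0)\<bar> \<le> 8 * eps"
    unfolding L[of 4] using x4_corner x5_corner by (intro mix_close) auto
  then have "\<bar>x 6 - 4 * \<alpha> * \<alpha>\<bar> \<le> 2 * (8 * eps)"
    by (rule close_lo) (use x_lo[of 4] L4 in \<open>simp_all add: algebra_simps\<close>)
  then show ?thesis by simp
qed

lemma L5_close: "\<bar>L 5 - (\<alpha> * (4 * \<alpha> * \<alpha>) + (1 - \<alpha>) * (2 * \<alpha>))\<bar> \<le> 16 * eps"
  unfolding L[of 5] using x5_corner x6_corner by (intro mix_close) auto

lemma L5_corner: "L 5 < 1/2 - eps"
proof -
  have "\<alpha> * (4 * \<alpha> * \<alpha>) + (1 - \<alpha>) * (2 * \<alpha>) = 2 * \<alpha> * (1 - \<alpha>) + 4 * \<alpha> * \<alpha> * \<alpha>"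
    by (simp add: algebra_simps)
  with L5_close bound4 show ?thesis by linarith
qed

lemma x7_corner: "\<bar>x 7 - (8 * \<alpha> * \<alpha> * \<alpha> + 4 * \<alpha> * (1 - \<alpha>))\<bar> \<le> 32 * eps"
proof -
  have "\<bar>x 7 - (8 * \<alpha> * \<alpha> * \<alpha> + 4 * \<alpha> * (1 - \<alpha>))\<bar> \<le> 2 * (16 * eps)"
    by (rule close_lo[OF L5_close]) (use x_lo[of 5] L5_corner in \<open>simp_all add: algebra_simps\<close>)
  then show ?thesis by simp
qed

lemma L6_close: "\<bar>L 6 - (\<alpha> * (8 * \<alpha> * \<alpha> * \<alpha> + 4 * \<alpha> * (1 - \<alpha>)) + (1 - \<alpha>) * (4 * \<alpha> * \<alpha>))\<bar> \<le> 32 * eps"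
  unfolding L[of 6] using x6_corner x7_corner by (intro mix_close) auto

lemma L6_corner: "L 6 < 1/2 - eps"
  using L6_close bound6 by linarith

text \<open>The limit of \<open>L 7\<close> vanishes with \<alpha>, hence the lower bound on
  \<alpha>. At 0.18 the first two terms of its expansion are already estimated by 0.512, above 1/2 +
  65 \<open>eps\<close>.\<close>

lemma L7_corner:
  assumes "18/100 \<le> \<alpha>"
  shows "1/2 + eps < L 7"
proof -
  define s where "s = \<alpha> * (8 * \<alpha> * \<alpha> * \<alpha> + 4 * \<alpha> * (1 - \<alpha>)) + (1 - \<alpha>) * (4 * \<alpha> * \<alpha>)"
  have "\<bar>x 8 - 2 * s\<bar> \<le> 2 * (32 * eps)"
    by (rule close_lo[OF L6_close]) (use x_lo[of 6] L6_corner in \<open>simp_all add: s_def\<close>)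
  then have "\<bar>L 7 - (\<alpha> * (2 * s) + (1 - \<alpha>) * (8 * \<alpha> * \<alpha> * \<alpha> + 4 * \<alpha> * (1 - \<alpha>)))\<bar> \<le> 64 * eps"
    unfolding L[of 7] using x7_corner by (intro mix_close) auto
  moreover have "\<alpha> * (2 * s) + (1 - \<alpha>) * (8 * \<alpha> * \<alpha> * \<alpha> + 4 * \<alpha> * (1 - \<alpha>)) =
      4 * (\<alpha> * ((1 - \<alpha>) * (1 - \<alpha>))) + 24 * ((\<alpha> * \<alpha> * \<alpha>) * (1 - \<alpha>)) + 16 * (\<alpha> * \<alpha> * \<alpha> * (\<alpha> * \<alpha>))"
    by (simp add: s_def algebra_simps)
  moreover have "18/100 * (7519/10000 * (7519/10000)) \<le> \<alpha> * ((1 - \<alpha>) * (1 - \<alpha>))"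
    "18/100 * (18/100) * (18/100) * (7519/10000) \<le> (\<alpha> * \<alpha> * \<alpha>) * (1 - \<alpha>)"
    using assms \<alpha>_le by (intro mult_mono'; simp)+
  moreover have "0 \<le> \<alpha> * \<alpha> * \<alpha> * (\<alpha> * \<alpha>)" using \<alpha>_pos by simp
  ultimately show ?thesis by linarith
qed

end

end

text \<open>A return to the line after exactly three steps pins the orbit near one explicit point.\<close>

context
  assumes \<alpha>_ge: "18/100 \<le> \<alpha>" and near0: "\<bar>L 0 - 1/2\<bar> \<le> eps" and near3: "\<bar>L 3 - 1/2\<bar> \<le> eps"
    and x5: "1 - 2 * eps \<le> x 5" and L4': "L 4 < 1/2 - eps" and L5': "1/2 + eps < L 5"
begin

text \<open>The visits at times 0 and 3 give two linear equations for (x 3, x 4), up to the errors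
  \<eta> and \<zeta>. Eliminating \<open>x 3\<close> leaves the factor (1-2\<alpha>)(1+\<alpha>)
  \<ge> 0.59, so the solution is stable.\<close>

lemma x4_return: "\<bar>x 4 - \<alpha> / (1 + \<alpha>)\<bar> \<le> 8 * eps"
proof -
  define X where "X = \<alpha> / (1 + \<alpha>)"
  have X: "X * (1 + \<alpha>) = \<alpha>" using \<alpha>_pos by (simp add: X_def)
  define \<eta> where "\<eta> = x 4 - 2 * \<alpha> * (1 - x 3)"
  define \<zeta> where "\<zeta> = \<alpha> * x 4 + (1 - \<alpha>) * x 3 - 1/2"
  have \<eta>: "0 \<le> \<eta>" "\<eta> \<le> 4 * eps" using x4[OF near0] by (auto simp: \<eta>_def)
  have \<zeta>: "\<bar>\<zeta>\<bar> \<le> eps" using near3 L[of 3] by (simp add: \<zeta>_def)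
  have eq: "(1 - 2 * \<alpha>) * (1 + \<alpha>) * (x 4 - X) = (1 - \<alpha>) * \<eta> - 2 * \<alpha> * \<zeta>"
  proof -
    have "(1 - 2 * \<alpha>) * (1 + \<alpha>) * (x 4 - X) = (1 - 2 * \<alpha>) * (1 + \<alpha>) * x 4 - (1 - 2 * \<alpha>) * (X * (1 + \<alpha>))"
      by (simp add: algebra_simps)
    then show ?thesis unfolding X \<eta>_def \<zeta>_def by (simp add: algebra_simps)
  qed
  have num: "\<bar>(1 - \<alpha>) * \<eta> - 2 * \<alpha> * \<zeta>\<bar> \<le> 82/100 * (4 * eps) + 2 * (2481/10000) * eps"
  proof -
    have "\<bar>(1 - \<alpha>) * \<eta>\<bar> \<le> 82/100 * (4 * eps)"
      unfolding abs_mult using \<eta> \<alpha>_ge \<alpha>_less by (intro mult_mono) auto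
    moreover have "\<bar>2 * \<alpha> * \<zeta>\<bar> \<le> 2 * (2481/10000) * eps"
      unfolding abs_mult using \<zeta> \<alpha>_pos \<alpha>_le by (intro mult_mono) auto
    ultimately show ?thesis by linarith
  qed
  have "5/10 * (118/100) \<le> (1 - 2 * \<alpha>) * (1 + \<alpha>)"
    using \<alpha>_ge \<alpha>_le by (intro mult_mono) auto
  then have "5/10 * (118/100) * \<bar>x 4 - X\<bar> \<le> \<bar>(1 - 2 * \<alpha>) * (1 + \<alpha>) * (x 4 - X)\<bar>"
    unfolding abs_mult[of _ "x 4 - X"] using abs_ge_self by (intro mult_right_mono) (auto intro: order_trans)
  with num have "5/10 * (118/100) * \<bar>x 4 - X\<bar> \<le> 82/100 * (4 * eps) + 2 * (2481/10000) * eps"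
    unfolding eq by linarith
  moreover have "y \<le> 8 * eps" if "5/10 * (118/100) * y \<le> 82/100 * (4 * eps) + 2 * (2481/10000) * eps" for y :: real
    using that by linarith
  ultimately show ?thesis unfolding X_def[symmetric] by blast
qed

text \<open>Continues from (x 4, x 5) near (X, 1). The limit 4\<alpha> - 6\<alpha>^2 of
  \<open>L 6\<close> is concave and exceeds 0.525 on the range of \<alpha>; then \<open>x 8\<close>
  is at least 0.74, and its share of \<open>L 8\<close> suffices.\<close>

lemma return_close:
  shows L6_return: "1/2 + eps < L 6" and L8_return: "1/2 + eps < L 8"
proof -
  define X where "X = \<alpha> / (1 + \<alpha>)"
  have X: "X * (1 + \<alpha>) = \<alpha>" using \<alpha>_pos by (simp add: X_def)
  have "\<bar>L 4 - (\<alpha> * 1 + (1 - \<alpha>) * X)\<bar> \<le> 8 * eps"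
    unfolding L[of 4] using x4_return x5 x01[of 5] by (intro mix_close) (auto simp: X_def)
  moreover have "\<alpha> * 1 + (1 - \<alpha>) * X = 2 * X" using X by (simp add: algebra_simps)
  ultimately have "\<bar>x 6 - 4 * X\<bar> \<le> 2 * (8 * eps)"
    by (intro close_lo[of "L 4" "2 * X"]) (use x_lo[of 4] L4' in simp_all)
  then have x6: "\<bar>x 6 - 4 * X\<bar> \<le> 16 * eps" by simp
  have "\<bar>L 5 - (\<alpha> * (4 * X) + (1 - \<alpha>) * 1)\<bar> \<le> 16 * eps"
    unfolding L[of 5] using x5 x01[of 5] x6 by (intro mix_close) auto
  then have "\<bar>x 7 - (2 * \<alpha> - 8 * \<alpha> * X)\<bar> \<le> 2 * (16 * eps)"
    by (rule close_hi) (use x_hi[of 5] L5' in \<open>simp_all add: algebra_simps\<close>)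
  then have x7: "\<bar>x 7 - (2 * \<alpha> - 8 * \<alpha> * X)\<bar> \<le> 32 * eps" by simp
  have "\<bar>L 6 - (\<alpha> * (2 * \<alpha> - 8 * \<alpha> * X) + (1 - \<alpha>) * (4 * X))\<bar> \<le> 32 * eps"
    unfolding L[of 6] using x6 x7 by (intro mix_close) auto
  moreover have "\<alpha> * (2 * \<alpha> - 8 * \<alpha> * X) + (1 - \<alpha>) * (4 * X) = 4 * \<alpha> - 6 * (\<alpha> * \<alpha>)"
  proof -
    have "\<alpha> * (2 * \<alpha> - 8 * \<alpha> * X) + (1 - \<alpha>) * (4 * X) = 2 * \<alpha> * \<alpha> + 4 * (X * (1 + \<alpha>)) * (1 - 2 * \<alpha>)"
      by (simp add: algebra_simps)
    then show ?thesis unfolding X by (simp add: algebra_simps)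
  qed
  ultimately have L6: "\<bar>L 6 - (4 * \<alpha> - 6 * (\<alpha> * \<alpha>))\<bar> \<le> 32 * eps" by simp
  \<comment> \<open>The chord of the square function over the range of \<alpha>.\<close>
  have "0 \<le> (\<alpha> - 18/100) * (2481/10000 - \<alpha>)" using \<alpha>_ge \<alpha>_le by simp
  then have "\<alpha> * \<alpha> \<le> 4281/10000 * \<alpha> - 44658/1000000" by (simp add: field_simps)
  then have "525/1000 \<le> 4 * \<alpha> - 6 * (\<alpha> * \<alpha>)" using \<alpha>_ge by linarith
  with L6 show 1: "1/2 + eps < L 6" by linarith
  then have "x 8 = 2 - 2 * L 6" using x_hi[of 6] by simp
  moreover have "-8 * \<alpha> + 12 * (\<alpha> * \<alpha>) \<ge> - 1247/1000" using \<alpha>_sq \<alpha>_le by linarith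
  ultimately have "74/100 \<le> x 8" using L6 by linarith
  then have "7519/10000 * (74/100) \<le> (1 - \<alpha>) * x 8" using \<alpha>_le by (intro mult_mono) auto
  then show "1/2 + eps < L 8" using L_ge_fst[of 8] by simp
qed

end

end

subsection \<open>Existence of the invariant measure\<close>

context memory_map begin

lemma orbit_locale:
  assumes u: "u \<in> unit_square" and "\<alpha> \<le> 2481/10000"
  shows "tent_orbit \<alpha> (\<lambda>k. fst ((G \<alpha> ^^ k) u)) (\<lambda>k. lin ((G \<alpha> ^^ k) u))"
proof unfold_locales
  fix k
  have snd: "snd ((G \<alpha> ^^ k) u) = fst ((G \<alpha> ^^ Suc k) u)" for k by (simp add: G_eq)
  show "0 \<le> fst ((G \<alpha> ^^ k) u)" "fst ((G \<alpha> ^^ k) u) \<le> 1"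
    using funpow_G_square[OF u, of k] by (auto simp: mem_Times_iff)
  show "lin ((G \<alpha> ^^ k) u) = \<alpha> * fst ((G \<alpha> ^^ Suc k) u) + (1 - \<alpha>) * fst ((G \<alpha> ^^ k) u)"
    unfolding lin_def snd ..
  show "fst ((G \<alpha> ^^ (k + 2)) u) = 1 - 2 * \<bar>lin ((G \<alpha> ^^ k) u) - 1 / 2\<bar>"
    by (simp add: G_eq tent_def)
qed (rule assms)

context
  fixes u assumes u: "u \<in> unit_square" and near: "near u" and \<alpha>_le: "\<alpha> \<le> 2481/10000"
begin

interpretation tent_orbit \<alpha> "\<lambda>k. fst ((G \<alpha> ^^ k) u)" "\<lambda>k. lin ((G \<alpha> ^^ k) u)"
  by (rule orbit_locale[OF u \<alpha>_le])

lemma near0: "\<bar>lin ((G \<alpha> ^^ 0) u) - 1 / 2\<bar> \<le> eps" using near by (simp add: near_def dev_def)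

lemma up2: "up ((G \<alpha> ^^ 2) u)" unfolding up_def by (rule L2[OF near0])

lemma dn4: "dn ((G \<alpha> ^^ 4) u)" unfolding dn_def by (rule L4[OF near0])

lemma corner:
  assumes "near (G \<alpha> u)"
  shows "up ((G \<alpha> ^^ 3) u)" "dn ((G \<alpha> ^^ 5) u)" "dn ((G \<alpha> ^^ 6) u)"
    "18/100 \<le> \<alpha> \<Longrightarrow> up ((G \<alpha> ^^ 7) u)"
proof -
  have near1: "\<bar>lin ((G \<alpha> ^^ 1) u) - 1 / 2\<bar> \<le> eps" using assms by (simp add: near_def dev_def)
  show "up ((G \<alpha> ^^ 3) u)" "dn ((G \<alpha> ^^ 5) u)" "dn ((G \<alpha> ^^ 6) u)"
    "18/100 \<le> \<alpha> \<Longrightarrow> up ((G \<alpha> ^^ 7) u)"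
    unfolding up_def dn_def
    by (rule L3_corner[OF near0 near1] L5_corner[OF near0 near1] L6_corner[OF near0 near1]
        L7_corner[OF near0 near1]; assumption?)+
qed

end

text \<open>The hypotheses on times 4 and 5 come from different visits: \<open>dn4\<close> for the
  first, \<open>up2\<close> for the second at time 3.\<close>

lemma return:
  assumes u: "u \<in> unit_square" "near u" and near3: "near ((G \<alpha> ^^ 3) u)"
    and \<alpha>: "18/100 \<le> \<alpha>" "\<alpha> \<le> 2481/10000"
  shows "up ((G \<alpha> ^^ 6) u)" "up ((G \<alpha> ^^ 8) u)"
proof -
  interpret tent_orbit \<alpha> "\<lambda>k. fst ((G \<alpha> ^^ k) u)" "\<lambda>k. lin ((G \<alpha> ^^ k) u)"
    by (rule orbit_locale[OF u(1) \<alpha>(2)])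
  have n0: "\<bar>lin ((G \<alpha> ^^ 0) u) - 1 / 2\<bar> \<le> eps" and n3: "\<bar>lin ((G \<alpha> ^^ 3) u) - 1 / 2\<bar> \<le> eps"
    using u near3 by (auto simp: near_def dev_def)
  let ?q = "(G \<alpha> ^^ 3) u"
  have q: "?q \<in> unit_square" by (rule funpow_G_square[OF u(1)])
  have "(G \<alpha> ^^ 5) u = (G \<alpha> ^^ 2) ?q"
    unfolding comp_apply[of "G \<alpha> ^^ _" "G \<alpha> ^^ _" u, symmetric] funpow_add[symmetric] by simp
  then have L: "1/2 + eps < lin ((G \<alpha> ^^ 5) u)"
    using up2[OF q near3 \<alpha>(2)] by (simp add: up_def)
  have x5: "1 - 2 * eps \<le> fst ((G \<alpha> ^^ 5) u)" using x_near[OF n3] by simp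
  note * = \<alpha>(1) n0 n3 x5 L4[OF n0] L
  show "up ((G \<alpha> ^^ 6) u)" "up ((G \<alpha> ^^ 8) u)"
    unfolding up_def by (rule L6_return[OF *] L8_return[OF *])+
qed

section \<open>Transitions between nodes\<close>

lemma occ_FreeH: "z \<in> unit_square \<Longrightarrow> occ Free z \<or> occ (H 0) z"
  by (cases "near z") (auto intro!: bexI[of _ z])

text \<open>For k = 2 a hit is reported both as \<open>Q 0\<close> and as \<open>H 0\<close>, since
  the two graphs continue differently.\<close>

lemma occ_step_H:
  assumes "occ (H k) z" and \<alpha>_le: "\<alpha> \<le> 2481/10000"
  shows "k = 0 \<Longrightarrow> occ (H 1) (G \<alpha> z) \<or> occ (P 0) (G \<alpha> z)"
    "k = 1 \<Longrightarrow> occ (H 2) (G \<alpha> z)"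
    "k = 2 \<Longrightarrow> \<not> lo z \<and> (occ (H 3) (G \<alpha> z) \<or> occ (Q 0) (G \<alpha> z) \<and> occ (H 0) (G \<alpha> z))"
    "k = 3 \<Longrightarrow> occ (H 4) (G \<alpha> z)"
    "k = 4 \<Longrightarrow> lo z \<and> (occ Free (G \<alpha> z) \<or> occ (H 0) (G \<alpha> z))"
proof -
  obtain u where u: "u \<in> unit_square" "near u" "z = (G \<alpha> ^^ k) u" using assms(1) by auto
  have z: "G \<alpha> z = (G \<alpha> ^^ Suc k) u" using u by simp
  have sq: "G \<alpha> z \<in> unit_square" unfolding z by (rule funpow_G_square[OF u(1)])
  show "k = 0 \<Longrightarrow> occ (H 1) (G \<alpha> z) \<or> occ (P 0) (G \<alpha> z)" using u by auto
  show "k = 1 \<Longrightarrow> occ (H 2) (G \<alpha> z)"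
    using u z up[OF up2[OF u(1,2) \<alpha>_le]] by (auto simp: numeral_2_eq_2)
  show "k = 2 \<Longrightarrow> \<not> lo z \<and> (occ (H 3) (G \<alpha> z) \<or> occ (Q 0) (G \<alpha> z) \<and> occ (H 0) (G \<alpha> z))"
    using u z sq up[OF up2[OF u(1,2) \<alpha>_le]] by (cases "near (G \<alpha> z)") (auto simp: eval_nat_numeral)
  show "k = 3 \<Longrightarrow> occ (H 4) (G \<alpha> z)"
    using u z dn[OF dn4[OF u(1,2) \<alpha>_le]] by (auto simp: eval_nat_numeral)
  show "k = 4 \<Longrightarrow> lo z \<and> (occ Free (G \<alpha> z) \<or> occ (H 0) (G \<alpha> z))"
    using u z sq dn[OF dn4[OF u(1,2) \<alpha>_le]] occ_FreeH[OF sq] by auto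
qed

lemma occ_step_P:
  assumes "occ (P k) z" and \<alpha>_le: "\<alpha> \<le> 2481/10000"
  shows "k = 0 \<Longrightarrow> occ (P 1) (G \<alpha> z)"
    "k = 1 \<Longrightarrow> \<not> lo z \<and> occ (P 2) (G \<alpha> z)"
    "k = 2 \<Longrightarrow> \<not> lo z \<and> occ (P 3) (G \<alpha> z)"
    "k = 3 \<Longrightarrow> lo z \<and> occ (P 4) (G \<alpha> z)"
    "k = 4 \<Longrightarrow> lo z \<and> occ (P 5) (G \<alpha> z)"
    "k = 5 \<Longrightarrow> lo z \<and> (occ Free (G \<alpha> z) \<or> occ (H 0) (G \<alpha> z))"
    "k = 5 \<Longrightarrow> 18/100 \<le> \<alpha> \<Longrightarrow> occ (P 6) (G \<alpha> z)"
    "k = 6 \<Longrightarrow> 18/100 \<le> \<alpha> \<Longrightarrow> \<not> lo z \<and> (occ Free (G \<alpha> z) \<or> occ (H 0) (G \<alpha> z))"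
proof -
  obtain u where u: "u \<in> unit_square" "near u" "near (G \<alpha> u)" "z = (G \<alpha> ^^ Suc k) u" using assms(1) by auto
  have z: "G \<alpha> z = (G \<alpha> ^^ Suc (Suc k)) u" using u by simp
  have sq: "G \<alpha> z \<in> unit_square" unfolding z by (rule funpow_G_square[OF u(1)])
  have P: "occ (P (Suc k)) (G \<alpha> z)" if "\<not> near (G \<alpha> z)" using that u z by auto
  note f = up[OF up2[OF u(1,2) \<alpha>_le]] dn[OF dn4[OF u(1,2) \<alpha>_le]] up[OF corner(1)[OF u(1,2) \<alpha>_le u(3)]]
    dn[OF corner(2)[OF u(1,2) \<alpha>_le u(3)]] dn[OF corner(3)[OF u(1,2) \<alpha>_le u(3)]]
  have f7: "18/100 \<le> \<alpha> \<Longrightarrow> \<not> lo ((G \<alpha> ^^ 7) u) \<and> \<not> near ((G \<alpha> ^^ 7) u)"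
    using up[OF corner(4)[OF u(1,2) \<alpha>_le u(3)]] by blast
  have n: "Suc 0 = 1" "Suc 1 = 2" "Suc 2 = 3" "Suc 3 = 4" "Suc 4 = 5" "Suc 5 = 6" "Suc 6 = 7" by simp_all
  show "k = 0 \<Longrightarrow> occ (P 1) (G \<alpha> z)" using P f z by (simp only: n; blast)
  show "k = 1 \<Longrightarrow> \<not> lo z \<and> occ (P 2) (G \<alpha> z)" using P f z u(4) by (simp only: n; blast)
  show "k = 2 \<Longrightarrow> \<not> lo z \<and> occ (P 3) (G \<alpha> z)" using P f z u(4) by (simp only: n; blast)
  show "k = 3 \<Longrightarrow> lo z \<and> occ (P 4) (G \<alpha> z)" using P f z u(4) by (simp only: n; blast)
  show "k = 4 \<Longrightarrow> lo z \<and> occ (P 5) (G \<alpha> z)" using P f z u(4) by (simp only: n; blast)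
  show "k = 5 \<Longrightarrow> lo z \<and> (occ Free (G \<alpha> z) \<or> occ (H 0) (G \<alpha> z))"
    using f u(4) occ_FreeH[OF sq] by (simp only: n; blast)
  show "k = 5 \<Longrightarrow> 18/100 \<le> \<alpha> \<Longrightarrow> occ (P 6) (G \<alpha> z)" using P f7 z by (simp only: n; blast)
  show "k = 6 \<Longrightarrow> 18/100 \<le> \<alpha> \<Longrightarrow> \<not> lo z \<and> (occ Free (G \<alpha> z) \<or> occ (H 0) (G \<alpha> z))"
    using f7 u(4) occ_FreeH[OF sq] by (simp only: n; blast)
qed

text \<open>\<open>Q k\<close> sits at time k + 3 of \<open>u\<close>: branches 4, 5 and 7 are
  forced by one of the two visits alone, branches 6 and 8 by \<open>return\<close>.\<close>

lemma occ_step_Q: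
  assumes "occ (Q k) z" and \<alpha>: "18/100 \<le> \<alpha>" "\<alpha> \<le> 2481/10000"
  shows "k = 0 \<Longrightarrow> occ (Q 1) (G \<alpha> z)"
    "k = 1 \<Longrightarrow> lo z \<and> occ (Q 2) (G \<alpha> z)"
    "k = 2 \<Longrightarrow> \<not> lo z \<and> occ (Q 3) (G \<alpha> z)"
    "k = 3 \<Longrightarrow> \<not> lo z \<and> occ (Q 4) (G \<alpha> z)"
    "k = 4 \<Longrightarrow> lo z \<and> occ (Q 5) (G \<alpha> z)"
    "k = 5 \<Longrightarrow> \<not> lo z \<and> (occ Free (G \<alpha> z) \<or> occ (H 0) (G \<alpha> z))"
proof -
  obtain u where u: "u \<in> unit_square" "near u" "near ((G \<alpha> ^^ 3) u)" "z = (G \<alpha> ^^ (k + 3)) u" using assms(1) by auto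
  have z: "G \<alpha> z = (G \<alpha> ^^ (Suc k + 3)) u" by (simp only: u(4) add_Suc funpow.simps(2) comp_apply)
  have sq: "G \<alpha> z \<in> unit_square" unfolding z by (rule funpow_G_square[OF u(1)])
  have Q: "occ (Q (Suc k)) (G \<alpha> z)" if "\<not> near (G \<alpha> z)" using that u z by auto
  let ?q = "(G \<alpha> ^^ 3) u"
  have q: "?q \<in> unit_square" by (rule funpow_G_square[OF u(1)])
  have eq: "(G \<alpha> ^^ 5) u = (G \<alpha> ^^ 2) ?q" "(G \<alpha> ^^ 7) u = (G \<alpha> ^^ 4) ?q"
    unfolding comp_apply[of "G \<alpha> ^^ _" "G \<alpha> ^^ _" u, symmetric] funpow_add[symmetric] by simp_all
  note f = dn[OF dn4[OF u(1,2) \<alpha>(2)]] up[OF up2[OF q u(3) \<alpha>(2)], folded eq] dn[OF dn4[OF q u(3) \<alpha>(2)], folded eq]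
    up[OF return(1)[OF u(1-3) \<alpha>]] up[OF return(2)[OF u(1-3) \<alpha>]]
  have n: "Suc 0 = 1" "Suc 1 = 2" "Suc 2 = 3" "Suc 3 = 4" "Suc 4 = 5"
    "1 + 3 = (4::nat)" "2 + 3 = (5::nat)" "3 + 3 = (6::nat)" "4 + 3 = (7::nat)" "5 + 3 = (8::nat)" by simp_all
  show "k = 0 \<Longrightarrow> occ (Q 1) (G \<alpha> z)" using Q f z by (simp only: n; blast)
  show "k = 1 \<Longrightarrow> lo z \<and> occ (Q 2) (G \<alpha> z)" using Q f z u(4) by (simp only: n; blast)
  show "k = 2 \<Longrightarrow> \<not> lo z \<and> occ (Q 3) (G \<alpha> z)" using Q f z u(4) by (simp only: n; blast)
  show "k = 3 \<Longrightarrow> \<not> lo z \<and> occ (Q 4) (G \<alpha> z)" using Q f z u(4) by (simp only: n; blast)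
  show "k = 4 \<Longrightarrow> lo z \<and> occ (Q 5) (G \<alpha> z)" using Q f z u(4) by (simp only: n; blast)
  show "k = 5 \<Longrightarrow> \<not> lo z \<and> (occ Free (G \<alpha> z) \<or> occ (H 0) (G \<alpha> z))"
    using f u(4) occ_FreeH[OF sq] by (simp only: n; blast)
qed

lemma succA_simps:
  "succA Free = [(True, Free), (True, H 0), (False, Free), (False, H 0)]"
  "succA (H 0) = [(True, H 1), (True, P 0), (False, H 1), (False, P 0)]"
  "succA (H 1) = [(True, H 2), (False, H 2)]"
  "succA (H 2) = [(False, H 3), (False, Q 0)]"
  "succA (H 3) = [(True, H 4), (False, H 4)]"
  "succA (H 4) = [(True, Free), (True, H 0)]"
  "succA (P 0) = [(True, P 1), (False, P 1)]"
  "succA (P 1) = [(False, P 2)]" "succA (P 2) = [(False, P 3)]" "succA (P 3) = [(True, P 4)]"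
  "succA (P 4) = [(True, P 5)]" "succA (P 5) = [(True, P 6)]"
  "succA (P 6) = [(False, Free), (False, H 0)]"
  "succA (Q 0) = [(True, Q 1), (False, Q 1)]"
  "succA (Q 1) = [(True, Q 2)]" "succA (Q 2) = [(False, Q 3)]" "succA (Q 3) = [(False, Q 4)]"
  "succA (Q 4) = [(True, Q 5)]" "succA (Q 5) = [(False, Free), (False, H 0)]"
  by (simp_all add: succA_def)

lemma succB_simps:
  "succB Free = [(True, Free), (True, H 0), (False, Free), (False, H 0)]"
  "succB (H 0) = [(True, H 1), (True, P 0), (False, H 1), (False, P 0)]"
  "succB (H 1) = [(True, H 2), (False, H 2)]"
  "succB (H 2) = [(False, H 3), (False, H 0)]"
  "succB (H 3) = [(True, H 4), (False, H 4)]"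
  "succB (H 4) = [(True, Free), (True, H 0)]"
  "succB (P 0) = [(True, P 1), (False, P 1)]"
  "succB (P 1) = [(False, P 2)]" "succB (P 2) = [(False, P 3)]" "succB (P 3) = [(True, P 4)]"
  "succB (P 4) = [(True, P 5)]" "succB (P 5) = [(True, Free), (True, H 0)]"
  by (simp_all add: succB_def)

lemma transitionsA:
  assumes "nd \<in> set nodesA" "occ nd z" and \<alpha>: "18/100 \<le> \<alpha>" "\<alpha> \<le> 2481/10000"
  shows "\<exists>(s, t) \<in> set (succA nd). lo z = s \<and> occ t (G \<alpha> z)"
proof (cases nd)
  case Free
  then have "G \<alpha> z \<in> unit_square" using assms(2) by (intro G_square) auto
  from occ_FreeH[OF this] show ?thesis unfolding Free succA_simps by (auto simp del: occ.simps)
next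
  case (H k)
  note occ = assms(2)[unfolded H]
  consider "k = 0" | "k = 1" | "k = 2" | "k = 3" | "k = 4"
    using assms(1) unfolding H nodesA_def by auto
  then show ?thesis
  proof cases
    case 1
    show ?thesis using occ_step_H(1)[OF occ \<alpha>(2) 1] unfolding H 1 succA_simps by (auto simp del: occ.simps)
  next
    case 2
    show ?thesis using occ_step_H(2)[OF occ \<alpha>(2) 2] unfolding H 2 succA_simps by (auto simp del: occ.simps)
  next
    case 3
    show ?thesis using occ_step_H(3)[OF occ \<alpha>(2) 3] unfolding H 3 succA_simps by (auto simp del: occ.simps)
  next
    case 4
    show ?thesis using occ_step_H(4)[OF occ \<alpha>(2) 4] unfolding H 4 succA_simps by (auto simp del: occ.simps)
  next
    case 5
    show ?thesis using occ_step_H(5)[OF occ \<alpha>(2) 5] unfolding H 5 succA_simps by (auto simp del: occ.simps)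
  qed
next
  case (P k)
  note occ = assms(2)[unfolded P]
  consider "k = 0" | "k = 1" | "k = 2" | "k = 3" | "k = 4" | "k = 5" | "k = 6"
    using assms(1) unfolding P nodesA_def by auto
  then show ?thesis
  proof cases
    case 1
    show ?thesis using occ_step_P(1)[OF occ \<alpha>(2) 1] unfolding P 1 succA_simps by (auto simp del: occ.simps)
  next
    case 2
    show ?thesis using occ_step_P(2)[OF occ \<alpha>(2) 2] unfolding P 2 succA_simps by (auto simp del: occ.simps)
  next
    case 3
    show ?thesis using occ_step_P(3)[OF occ \<alpha>(2) 3] unfolding P 3 succA_simps by (auto simp del: occ.simps)
  next
    case 4
    show ?thesis using occ_step_P(4)[OF occ \<alpha>(2) 4] unfolding P 4 succA_simps by (auto simp del: occ.simps)
  next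
    case 5
    show ?thesis using occ_step_P(5)[OF occ \<alpha>(2) 5] unfolding P 5 succA_simps by (auto simp del: occ.simps)
  next
    case 6
    show ?thesis using occ_step_P(6)[OF occ \<alpha>(2) 6] occ_step_P(7)[OF occ \<alpha>(2) 6 \<alpha>(1)] unfolding P 6 succA_simps by (auto simp del: occ.simps)
  next
    case 7
    show ?thesis using occ_step_P(8)[OF occ \<alpha>(2) 7 \<alpha>(1)] unfolding P 7 succA_simps by (auto simp del: occ.simps)
  qed
next
  case (Q k)
  note occ = assms(2)[unfolded Q]
  consider "k = 0" | "k = 1" | "k = 2" | "k = 3" | "k = 4" | "k = 5"
    using assms(1) unfolding Q nodesA_def by auto
  then show ?thesis
  proof cases
    case 1
    show ?thesis using occ_step_Q(1)[OF occ \<alpha> 1] unfolding Q 1 succA_simps by (auto simp del: occ.simps)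
  next
    case 2
    show ?thesis using occ_step_Q(2)[OF occ \<alpha> 2] unfolding Q 2 succA_simps by (auto simp del: occ.simps)
  next
    case 3
    show ?thesis using occ_step_Q(3)[OF occ \<alpha> 3] unfolding Q 3 succA_simps by (auto simp del: occ.simps)
  next
    case 4
    show ?thesis using occ_step_Q(4)[OF occ \<alpha> 4] unfolding Q 4 succA_simps by (auto simp del: occ.simps)
  next
    case 5
    show ?thesis using occ_step_Q(5)[OF occ \<alpha> 5] unfolding Q 5 succA_simps by (auto simp del: occ.simps)
  next
    case 6
    show ?thesis using occ_step_Q(6)[OF occ \<alpha> 6] unfolding Q 6 succA_simps by (auto simp del: occ.simps)
  qed
qed

lemma transitionsB:
  assumes "nd \<in> set nodesB" "occ nd z" and \<alpha>: "\<alpha> \<le> 2481/10000"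
  shows "\<exists>(s, t) \<in> set (succB nd). lo z = s \<and> occ t (G \<alpha> z)"
proof (cases nd)
  case Free
  then have "G \<alpha> z \<in> unit_square" using assms(2) by (intro G_square) auto
  from occ_FreeH[OF this] show ?thesis unfolding Free succB_simps by (auto simp del: occ.simps)
next
  case (H k)
  note occ = assms(2)[unfolded H]
  consider "k = 0" | "k = 1" | "k = 2" | "k = 3" | "k = 4"
    using assms(1) unfolding H nodesB_def by auto
  then show ?thesis
  proof cases
    case 1
    show ?thesis using occ_step_H(1)[OF occ \<alpha> 1] unfolding H 1 succB_simps by (auto simp del: occ.simps)
  next
    case 2
    show ?thesis using occ_step_H(2)[OF occ \<alpha> 2] unfolding H 2 succB_simps by (auto simp del: occ.simps)
  next
    case 3
    show ?thesis using occ_step_H(3)[OF occ \<alpha> 3] unfolding H 3 succB_simps by (auto simp del: occ.simps)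
  next
    case 4
    show ?thesis using occ_step_H(4)[OF occ \<alpha> 4] unfolding H 4 succB_simps by (auto simp del: occ.simps)
  next
    case 5
    show ?thesis using occ_step_H(5)[OF occ \<alpha> 5] unfolding H 5 succB_simps by (auto simp del: occ.simps)
  qed
next
  case (P k)
  note occ = assms(2)[unfolded P]
  consider "k = 0" | "k = 1" | "k = 2" | "k = 3" | "k = 4" | "k = 5"
    using assms(1) unfolding P nodesB_def by auto
  then show ?thesis
  proof cases
    case 1
    show ?thesis using occ_step_P(1)[OF occ \<alpha> 1] unfolding P 1 succB_simps by (auto simp del: occ.simps)
  next
    case 2
    show ?thesis using occ_step_P(2)[OF occ \<alpha> 2] unfolding P 2 succB_simps by (auto simp del: occ.simps)
  next
    case 3
    show ?thesis using occ_step_P(3)[OF occ \<alpha> 3] unfolding P 3 succB_simps by (auto simp del: occ.simps)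
  next
    case 4
    show ?thesis using occ_step_P(4)[OF occ \<alpha> 4] unfolding P 4 succB_simps by (auto simp del: occ.simps)
  next
    case 5
    show ?thesis using occ_step_P(5)[OF occ \<alpha> 5] unfolding P 5 succB_simps by (auto simp del: occ.simps)
  next
    case 6
    show ?thesis using occ_step_P(6)[OF occ \<alpha> 6] unfolding P 6 succB_simps by (auto simp del: occ.simps)
  qed
next
  case (Q k)
  then show ?thesis using assms(1) by (auto simp: nodesB_def)
qed

end

text \<open>The table at the ray (1, 0) gives 947 at \<open>H 2\<close> after an isolated visit and
  756 at \<open>P 1\<close> after a double one. The double visit adds 606 * 3/10 < 182 for the
  immediate hit, so 948 covers both.\<close>

theorem expanding_large:
  assumes \<alpha>: "18/100 \<le> \<alpha>" "\<alpha> \<le> 2481/10000"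
  shows "\<exists>e. expanding_memory_map \<alpha> e eps (948/1000)"
proof -
  interpret memory_map \<alpha> using \<alpha> by unfold_locales auto
  define \<rho> where "\<rho> = 1 / (1 - \<alpha> + \<alpha> * (3/10))"
  have den: "826/1000 \<le> 1 - \<alpha> + \<alpha> * (3/10)" using \<alpha> by simp
  then have \<rho>: "0 < \<rho>" "\<rho> / 2 \<le> 606/1000" "\<rho> * (1 - \<alpha> + \<alpha> * (3/10)) = 1"
    by (simp_all add: \<rho>_def field_simps)
  have \<beta>: "of_int 21 / 100 \<le> \<beta>" "\<beta> \<le> of_int 33 / 100"
    using \<alpha> by (simp_all add: \<beta>_def field_simps)
  have cost: "cost eps (606/1000) (3/10) n z (of_int2 r) \<le> of_int f / 1000"
    if "nd \<in> set nodesA" "occ nd z" "(r, f) \<in> set (zip raysA (tabA nd))" for nd z r f n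
    using cost_le_potential[OF potential_okA \<beta> _ transitionsA[OF _ _ \<alpha>], of eps nd z r f n] that occ_near
    by (simp add: near_def)
  have "expanding_memory_map \<alpha> (\<rho>, \<rho> * (3/10)) eps (948/1000)"
  proof unfold_locales
    show "lin (z + t *\<^sub>R (\<rho>, \<rho> * (3/10))) = lin z + t" for z t
    proof -
      have "lin (z + t *\<^sub>R (\<rho>, \<rho> * (3/10))) = lin z + t * (\<rho> * (1 - \<alpha> + \<alpha> * (3/10)))"
        by (simp add: lin_def algebra_simps)
      then show ?thesis by (simp only: \<rho>(3) mult_1_right)
    qed
    show "\<bar>fst (\<rho>, \<rho> * (3/10))\<bar> \<le> 2" "\<bar>snd (\<rho>, \<rho> * (3/10))\<bar> \<le> 2" using \<rho> by auto
    fix z n assume z: "z \<in> unit_square" "dev z \<le> eps"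
    have near: "near z" using z by (simp add: near_def)
    have C: "(if dev (G \<alpha> z) \<le> eps then 606/1000 * (3/10) else 0) + cost eps (606/1000) (3/10) n (G \<alpha> (G \<alpha> z)) (1, 0) \<le> 948/1000" for n
    proof (cases "near (G \<alpha> z)")
      case True
      have "occ (P 0) (G \<alpha> z)" using z near True by auto
      from cost[OF _ occ_step_P(1)[OF this \<alpha>(2) refl], of "(1, 0)" 756 n]
      have "cost eps (606/1000) (3/10) n (G \<alpha> (G \<alpha> z)) (1, 0) \<le> 756/1000"
        by (simp add: nodesA_def tabA_def raysA_def of_int2_def)
      then show ?thesis using True by (simp add: near_def)
    next
      case False
      then have "occ (H 1) (G \<alpha> z)" using z near by auto
      from cost[OF _ occ_step_H(2)[OF this \<alpha>(2) refl], of "(1, 0)" 947 n]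
      have "cost eps (606/1000) (3/10) n (G \<alpha> (G \<alpha> z)) (1, 0) \<le> 947/1000"
        by (simp add: nodesA_def tabA_def raysA_def of_int2_def)
      then show ?thesis using False by (simp add: near_def)
    qed
    show "(\<Sum>j<n. if dev ((G \<alpha> ^^ Suc j) z) \<le> eps then wt (\<rho>, \<rho> * (3/10)) j (G \<alpha> z) else 0) \<le> 948/1000"
      by (rule hits_le_cost[OF _ _ _ C]) (use \<rho> in auto)
  qed auto
  then show ?thesis ..
qed

text \<open>With slope 0 an immediate return costs nothing, and the table gives 861 and 596. The
  constant 948 is kept so that both ranges yield the same locale instance.\<close>

theorem expanding_small:
  assumes \<alpha>: "0 < \<alpha>" "\<alpha> \<le> 18/100"
  shows "\<exists>e. expanding_memory_map \<alpha> e eps (948/1000)"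
proof -
  interpret memory_map \<alpha> using \<alpha> by unfold_locales auto
  define \<rho> where "\<rho> = 1 / (1 - \<alpha>)"
  have \<rho>: "0 < \<rho>" "\<rho> / 2 \<le> 610/1000" "\<rho> * (1 - \<alpha>) = 1"
    using \<alpha> by (simp_all add: \<rho>_def field_simps)
  have \<alpha>': "\<alpha> \<le> 2481/10000" using \<alpha> by simp
  have \<beta>: "of_int 0 / 100 \<le> \<beta>" "\<beta> \<le> of_int 22 / 100"
    using \<alpha> by (simp_all add: \<beta>_def field_simps)
  have cost: "cost eps (610/1000) 0 n z (of_int2 r) \<le> of_int f / 1000"
    if "nd \<in> set nodesB" "occ nd z" "(r, f) \<in> set (zip raysB (tabB nd))" for nd z r f n
    using cost_le_potential[OF potential_okB \<beta> _ transitionsB[OF _ _ \<alpha>'], of eps nd z r f n] that occ_near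
    by (simp add: near_def)
  have "expanding_memory_map \<alpha> (\<rho>, \<rho> * 0) eps (948/1000)"
  proof unfold_locales
    show "lin (z + t *\<^sub>R (\<rho>, \<rho> * 0)) = lin z + t" for z t
    proof -
      have "lin (z + t *\<^sub>R (\<rho>, \<rho> * 0)) = lin z + t * (\<rho> * (1 - \<alpha>))"
        by (simp add: lin_def algebra_simps)
      then show ?thesis by (simp only: \<rho>(3) mult_1_right)
    qed
    show "\<bar>fst (\<rho>, \<rho> * 0)\<bar> \<le> 2" "\<bar>snd (\<rho>, \<rho> * 0)\<bar> \<le> 2" using \<rho> by auto
    fix z n assume z: "z \<in> unit_square" "dev z \<le> eps"
    have near: "near z" using z by (simp add: near_def)
    have C: "(if dev (G \<alpha> z) \<le> eps then 610/1000 * 0 else 0) + cost eps (610/1000) 0 n (G \<alpha> (G \<alpha> z)) (1, 0) \<le> 948/1000" for n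
    proof (cases "near (G \<alpha> z)")
      case True
      have "occ (P 0) (G \<alpha> z)" using z near True by auto
      from cost[OF _ occ_step_P(1)[OF this \<alpha>' refl], of "(1, 0)" 596 n]
      have "cost eps (610/1000) 0 n (G \<alpha> (G \<alpha> z)) (1, 0) \<le> 596/1000"
        by (simp add: nodesB_def tabB_def raysB_def of_int2_def)
      then show ?thesis by simp
    next
      case False
      then have "occ (H 1) (G \<alpha> z)" using z near by auto
      from cost[OF _ occ_step_H(2)[OF this \<alpha>' refl], of "(1, 0)" 861 n]
      have "cost eps (610/1000) 0 n (G \<alpha> (G \<alpha> z)) (1, 0) \<le> 861/1000"
        by (simp add: nodesB_def tabB_def raysB_def of_int2_def)
      then show ?thesis by simp
    qed
    show "(\<Sum>j<n. if dev ((G \<alpha> ^^ Suc j) z) \<le> eps then wt (\<rho>, \<rho> * 0) j (G \<alpha> z) else 0) \<le> 948/1000"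
      by (rule hits_le_cost[OF _ _ _ C]) (use \<rho> in auto)
  qed auto
  then show ?thesis ..
qed

lemma (in expanding_memory_map) acim_exists:
  "\<exists>\<mu> :: (real \<times> real) measure. sets \<mu> = sets borel \<and> prob_space \<mu> \<and>
     emeasure \<mu> (UNIV - unit_square) = 0 \<and> absolutely_continuous lborel \<mu> \<and>
     G \<alpha> \<in> \<mu> \<rightarrow>\<^sub>M \<mu> \<and> distr \<mu> \<mu> (G \<alpha>) = \<mu>"
proof -
  have "\<exists>\<mu>. sets \<mu> = sets lborel \<and> prob_space \<mu> \<and> emeasure \<mu> (space lborel - unit_square) = 0 \<and>
    absolutely_continuous lborel \<mu> \<and> G \<alpha> \<in> \<mu> \<rightarrow>\<^sub>M \<mu> \<and> distr \<mu> \<mu> (G \<alpha>) = \<mu>"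
  proof (rule invariant_measure_exists)
    show "G \<alpha> \<in> lborel \<rightarrow>\<^sub>M lborel" by measurable
    show "emeasure lborel unit_square = 1" by (rule emeasure_square)
    show "G \<alpha> z \<in> unit_square" if "z \<in> unit_square" for z using that by (rule G_square)
    fix \<eta> :: real assume "0 < \<eta>"
    obtain p K where p: "0 < p" "p < 1" "0 \<le> K" and bound: "\<And>A t n. A \<in> sets borel \<Longrightarrow> 0 < t \<Longrightarrow> 2 * t \<le> \<theta> \<Longrightarrow>
      (\<Sum>k<n. emeasure lborel {x\<in>unit_square. (G \<alpha> ^^ k) x \<in> A})
        \<le> of_nat n * (ennreal (1 / t\<^sup>2) * emeasure lborel A + ennreal (K * t powr p))"
      by (rule cesaro_mass_bound) blast
    \<comment> \<open>Chosen so that K * t powr p \<le> \<eta>; K + 1 avoids division by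
      zero.\<close>
    define t where "t = min (\<theta> / 2) ((\<eta> / (K + 1)) powr (1 / p))"
    have t: "0 < t" "2 * t \<le> \<theta>" using \<theta>_pos \<open>0 < \<eta>\<close> p by (auto simp: t_def)
    have "t powr p \<le> ((\<eta> / (K + 1)) powr (1 / p)) powr p"
      using t p by (intro powr_mono2) (auto simp: t_def)
    also have "\<dots> = \<eta> / (K + 1)" using p \<open>0 < \<eta>\<close> by (simp add: powr_powr)
    finally have "K * t powr p \<le> K * (\<eta> / (K + 1))" using p by (intro mult_left_mono)
    also have "\<dots> \<le> \<eta>" using p \<open>0 < \<eta>\<close> by (simp add: field_simps)
    finally have \<eta>: "K * t powr p \<le> \<eta>" .
    from \<eta> have "ennreal (K * t powr p) \<le> ennreal \<eta>" by (rule ennreal_leI)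
    then have "(\<Sum>k<n. emeasure lborel {x\<in>unit_square. (G \<alpha> ^^ k) x \<in> A})
        \<le> of_nat n * (ennreal (1 / t\<^sup>2) * emeasure lborel A + ennreal \<eta>)" if "A \<in> sets lborel" for A n
      using that t by (intro order_trans[OF bound] mult_left_mono add_left_mono) auto
    then show "\<exists>C. \<forall>A n. A \<in> sets lborel \<longrightarrow> (\<Sum>k<n. emeasure lborel {x\<in>unit_square. (G \<alpha> ^^ k) x \<in> A})
        \<le> of_nat n * (ennreal C * emeasure lborel A + ennreal \<eta>)" by blast
  qed simp
  then show ?thesis by simp
qed

text \<open>Horner division at h = 0.2481: the quartic is (a - h) q plus its positive value at h,
  and q \<ge> 0 for a \<ge> 0, so it has no root in (h, 1].\<close>

lemma quartic_root_bound:
  fixes a :: real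
  assumes "0 \<le> a" "a \<le> 1" "16 * a ^ 4 + 16 * a ^ 3 - 52 * a ^ 2 + 48 * a - 9 = 0"
  shows "a \<le> 2481/10000"
proof (rule ccontr)
  assume "\<not> a \<le> 2481/10000"
  then have a: "2481/10000 < a" by simp
  define h :: real where "h = 2481/10000"
  define q where "q = 16 * a ^ 3 + (16 + 16 * h) * a ^ 2 + (-52 + h * (16 + 16 * h)) * a + (48 + h * (-52 + h * (16 + 16 * h)))"
  have "16 * a ^ 4 + 16 * a ^ 3 - 52 * a ^ 2 + 48 * a - 9 = (a - h) * q + (-9 + h * (48 + h * (-52 + h * (16 + 16 * h))))"
    unfolding q_def by (simp add: algebra_simps power2_eq_square power3_eq_cube power4_eq_xxxx)
  moreover have "0 < -9 + h * (48 + h * (-52 + h * (16 + 16 * h)))" by (simp add: h_def)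
  moreover have "0 \<le> q"
  proof -
    \<comment> \<open>The tangent of a^2 at 1.178 is steep enough to compensate the negative linear
      coefficient of q.\<close>
    have "0 \<le> (a - 1178/1000)\<^sup>2" by simp
    then have "2356/1000 * a - 1387684/1000000 \<le> a ^ 2" by (simp add: power2_eq_square algebra_simps)
    then have "(16 + 16 * h) * (2356/1000 * a - 1387684/1000000) \<le> (16 + 16 * h) * a ^ 2"
      by (intro mult_left_mono) (simp_all add: h_def)
    moreover have "0 \<le> 16 * a ^ 3" using assms(1) by simp
    moreover have "0 \<le> (16 + 16 * h) * (2356/1000 * a - 1387684/1000000)
        + (-52 + h * (16 + 16 * h)) * a + (48 + h * (-52 + h * (16 + 16 * h)))"
      using assms(1) by (simp add: h_def field_simps)
    ultimately show ?thesis unfolding q_def by linarith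
  qed
  then have "0 \<le> (a - h) * q" using a by (intro mult_nonneg_nonneg) (simp_all add: h_def)
  ultimately show False using assms(3) by linarith
qed

theorem theorem1:
  fixes \<alpha>1 \<alpha> :: real
  assumes "0 \<le> \<alpha>1" "\<alpha>1 \<le> 1"
    and "16 * \<alpha>1 ^ 4 + 16 * \<alpha>1 ^ 3 - 52 * \<alpha>1 ^ 2 + 48 * \<alpha>1 - 9 = 0"
    and "0 < \<alpha>" "\<alpha> \<le> \<alpha>1"
  shows "\<exists>\<mu> :: (real \<times> real) measure.
           sets \<mu> = sets (borel :: (real \<times> real) measure) \<and>
           prob_space \<mu> \<and>
           emeasure \<mu> (UNIV - {0..1} \<times> {0..1}) = 0 \<and>
           absolutely_continuous lborel \<mu> \<and>
           G \<alpha> \<in> \<mu> \<rightarrow>\<^sub>M \<mu> \<and>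
           distr \<mu> \<mu> (G \<alpha>) = \<mu>"
proof -
  have "\<alpha> \<le> 2481/10000" using quartic_root_bound[OF assms(1-3)] assms(5) by simp
  then obtain e where "expanding_memory_map \<alpha> e eps (948/1000)"
    using expanding_small[of \<alpha>] expanding_large[of \<alpha>] assms(4) by (cases "\<alpha> \<le> 18/100") auto
  then interpret expanding_memory_map \<alpha> e eps "948/1000" .
  show ?thesis by (rule acim_exists)
qed

end
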